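(* Let $1<p<\infty$, $n\ge2$, let $\Omega\subseteq\mathbb{R}^n$ be a domain, let $H$ be an admissible norm family on $\Omega$ that is commonly uniformly convex and satisfies the Bregman lower bound, let $V\in M^q_{\mathrm{loc}}(p;\Omega)$ be such that $(H,V)$ has the gradient regularity property in $\Omega$, and suppose that the functional $Q$ is subcritical in $\Omega$ (all these notions are defined in the context). Suppose that $V$ is nonnegative in $\Omega$. Let $g\in\mathcal{H}(\Omega)\setminus\{0\}$ and suppose that for every bounded sequence $\{\phi_k\}_{k\in\mathbb{N}}$ in $\widetilde{W}^{1,p}_0(\Omega)$ there exists $\phi\in\widetilde{W}^{1,p}_0(\Omega)$ such that, up to a subsequence, $\phi_k\to\phi$ weakly in $\widetilde{W}^{1,p}_0(\Omega)$ and $\lim_{k\to\infty}\int_\Omega|g||\phi_k|^p\,dx=\int_\Omega|g||\phi|^p\,dx$. Then the Hardy constant $S_g$ is attained in $\widetilde{W}^{1,p}_0(\Omega)$; that is, there is $\phi\in\widetilde{W}^{1,p}_0(\Omega)\setminus\{0\}$ with $\int_\Omega|g||\phi|^p\,dx>0$ and $S_g=Q[\phi]/\int_\Omega|g||\phi|^p\,dx$.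
   Context: $\omega\Subset\Omega$ means that the closure of $\omega$ is a compact subset of $\Omega$; $C_c(\Omega)$: continuous functions with compact support in $\Omega$. Admissible norm family: $H:\Omega\times\mathbb{R}^n\to\mathbb{R}$ such that for a.e. $x$, $H(x,\cdot)$ is a norm on $\mathbb{R}^n$; $x\mapsto H(x,\xi)$ is measurable for all $\xi$; for every domain $\omega\Subset\Omega$ there are $0<\kappa_\omega\le\nu_\omega<\infty$ with $\kappa_\omega|\xi|\le H(x,\xi)\le\nu_\omega|\xi|$ for a.e. $x\in\omega$ and all $\xi$; for a.e. $x$, $\mathbb{R}^n_x=(\mathbb{R}^n,H(x,\cdot))$ is uniformly convex and $H(x,\cdot)$ is differentiable in $\mathbb{R}^n\setminus\{0\}$. Write $|\xi|_{\mathcal{A}}=H(x,\xi)$ and $\mathcal{A}(x,\xi)=\nabla_\xi(\tfrac1pH(x,\xi)^p)$. Common uniform convexity: there is a null set $N\subseteq\Omega$ with $\inf_{x\in\Omega\setminus N}\delta_{\mathbb{R}^n_x}(\varepsilon)>0$ for all $\varepsilon\in(0,2]$, where $\delta_X(\varepsilon)=\inf\{1-\|\frac{x+y}2\|:\|x\|=\|y\|=1,\ \|x-y\|\ge\varepsilon\}$. Bregman lower bound: for some locally bounded measurable $\tilde\delta:\Omega\to[2,\infty)$ and every domain $\omega\Subset\Omega$ there is $C_\omega>0$ with $|\xi+\eta|_{\mathcal{A}}^p-|\xi|_{\mathcal{A}}^p-p\mathcal{A}(x,\xi)\cdot\eta\ge C_\omega|\eta|_{\mathcal{A}}^{\tilde\delta}(|\eta|_{\mathcal{A}}+|\xi|_{\mathcal{A}})^{p-\tilde\delta}$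 for a.e. $x\in\omega$ and all $\xi,\eta\in\mathbb{R}^n$ (with $\tilde\delta=\tilde\delta(x)$). Morrey space: for a domain $\omega\Subset\Omega$: if $p<n$, $q>n/p$, $\|f\|_{M^q(p;\omega)}=\sup_{y\in\omega,0<r<\mathrm{diam}\,\omega}r^{-n/q'}\int_{\omega\cap B_r(y)}|f|\,dx$, $q'=q/(q-1)$; if $p=n$, $q>n$, $\|f\|_{M^q(n;\omega)}=\sup_{y\in\omega,0<r<\mathrm{diam}\,\omega}(\log(\mathrm{diam}(\omega)/r))^{q/n'}\int_{\omega\cap B_r(y)}|f|\,dx$, $n'=n/(n-1)$; then $M^q(p;\omega)=\{f\in L^1_{\mathrm{loc}}(\omega):\|f\|_{M^q(p;\omega)}<\infty\}$; if $p>n$, $q=1$, $M^q(p;\omega)=L^1(\omega)$. $M^q_{\mathrm{loc}}(p;\Omega)=\bigcap_{\omega\Subset\Omega}M^q(p;\omega)$. Functional and equation: $Q[\phi]=Q_{p,\mathcal{A},V}[\phi]=\int_\Omega(|\nabla\phi|_{\mathcal{A}}^p+V|\phi|^p)\,dx$. A solution of $Q'[u]=f$, where $Q'_{p,\mathcal{A},V}[u]=-\mathrm{div}\,\mathcal{A}(x,\nabla u)+V|u|^{p-2}u$, is $v\in W^{1,p}_{\mathrm{loc}}$ with $\int\mathcal{A}(x,\nabla v)\cdot\nabla\phi\,dx+\int V|v|^{p-2}v\phi\,dx=\int f\phi\,dx$ for all $\phi\in C_c^\infty$. Gradient regularity property of $(H,V)$ in $\Omega$: if $p<\tilde\delta$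 on a set of positive measure, then for every subdomain $\Omega'\subseteq\Omega$ and $W\in L^\infty_{\mathrm{loc}}(\Omega')$ positive solutions of $Q'_{p,\mathcal{A},V-W}[u]=0$ in $\Omega'$ are in $W^{1,\infty}_{\mathrm{loc}}(\Omega')$, and for every $0\le f\in C_c^\infty(\Omega)\setminus\{0\}$ positive solutions of $Q'[u]=f$ in $\Omega$ are in $W^{1,\infty}_{\mathrm{loc}}(\Omega)$. Hardy-weights: $g\in L^1_{\mathrm{loc}}(\Omega)$ is a Hardy-weight of $Q$ in $\Omega$ if there is $C>0$ with $Q[\phi]\ge C\int_\Omega|g||\phi|^p\,dx$ for all $\phi\in C_c^\infty(\Omega)$; $\mathcal{H}(\Omega)$ is the space of all Hardy-weights. $Q$ is subcritical in $\Omega$ if $Q\ge0$ on $C_c^\infty(\Omega)$ and $\mathcal{H}(\Omega)\ne\{0\}$. $S_g=\inf\{Q[\phi]/\int_\Omega|g||\phi|^p\,dx:\phi\in W^{1,p}(\Omega)\cap C_c(\Omega),\ \int_\Omega|g||\phi|^p\,dx>0\}$. Spaces: fix a positive $\mathcal{V}\in C(\Omega)\cap\mathcal{H}(\Omega)$ (one exists when $Q$ is subcritical). $\widetilde{W}^{1,p}(\Omega)$ is the set of $u\in L^p(\Omega,(|V|+\mathcal{V})\,dx)$ with a weak gradient and finite norm $\|u\|_{\widetilde{W}^{1,p}(\Omega)}=\left(\int_\Omega(|\nabla u|_{\mathcal{A}}^p+(|V|+\mathcal{V})|u|^p)\,dx\right)^{1/p}$; $\widetilde{W}^{1,p}_0(\Omega)$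 is the closure of $W^{1,p}(\Omega)\cap C_c(\Omega)$ in it (it does not depend on the choice of $\mathcal{V}$). *)

theory Defs
  imports "HOL-Analysis.Analysis"
begin

text \<open>
  Functions on a domain are total functions; values outside the domain are irrelevant.
  Elements of Lebesgue and Sobolev spaces are represented by functions rather than by classes
  modulo almost everywhere equality, so that \<open>u \<noteq> 0\<close> is rendered as \<open>\<not> (AE x. u x = 0)\<close>.
\<close>

definition is_domain :: "'a::topological_space set \<Rightarrow> bool" where
  "is_domain S \<longleftrightarrow> open S \<and> connected S \<and> S \<noteq> {}"

definition compactly_inside :: "'a::topological_space set \<Rightarrow> 'a set \<Rightarrow> bool" where
  "compactly_inside \<omega> \<Omega> \<longleftrightarrow> compact (closure \<omega>) \<and> closure \<omega> \<subseteq> \<Omega>"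

definition gradient :: "('a::real_inner \<Rightarrow> real) \<Rightarrow> 'a \<Rightarrow> 'a" where
  "gradient f x = (THE D. GDERIV f x :> D)"

primrec Ck :: "nat \<Rightarrow> (real^'n \<Rightarrow> real) \<Rightarrow> bool" where
  "Ck 0 f \<longleftrightarrow> continuous_on UNIV f"
| "Ck (Suc k) f \<longleftrightarrow> (\<forall>x. f differentiable (at x)) \<and> (\<forall>i. Ck k (\<lambda>x. gradient f x $ i))"

text \<open>Compactly supported functions on \<open>\<Omega>\<close> are identified with their extensions by zero.\<close>

definition Cc :: "'a::topological_space set \<Rightarrow> ('a \<Rightarrow> real) set" where
  "Cc \<Omega> = {\<phi>. continuous_on UNIV \<phi> \<and> compactly_inside {x. \<phi> x \<noteq> 0} \<Omega>}"

definition Cc_infty :: "(real^'n) set \<Rightarrow> (real^'n \<Rightarrow> real) set" where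
  "Cc_infty \<Omega> = {\<phi>. (\<forall>k. Ck k \<phi>) \<and> compactly_inside {x. \<phi> x \<noteq> 0} \<Omega>}"


section \<open>Lebesgue and Sobolev spaces\<close>

definition L1_loc :: "(real^'n) set \<Rightarrow> (real^'n \<Rightarrow> 'b::euclidean_space) set" where
  "L1_loc \<Omega> = {f. \<forall>K. compact K \<and> K \<subseteq> \<Omega> \<longrightarrow> integrable (lebesgue_on K) f}"

definition Lp :: "real \<Rightarrow> (real^'n) set \<Rightarrow> (real^'n \<Rightarrow> 'b::euclidean_space) set" where
  "Lp p S = {f. f \<in> borel_measurable (lebesgue_on S) \<and>
                integrable (lebesgue_on S) (\<lambda>x. norm (f x) powr p)}"

definition Lp_loc :: "real \<Rightarrow> (real^'n) set \<Rightarrow> (real^'n \<Rightarrow> 'b::euclidean_space) set" where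
  "Lp_loc p \<Omega> = {f. \<forall>K. compact K \<and> K \<subseteq> \<Omega> \<longrightarrow> f \<in> Lp p K}"

definition Linf_loc :: "(real^'n) set \<Rightarrow> (real^'n \<Rightarrow> 'b::euclidean_space) set" where
  "Linf_loc \<Omega> = {f. f \<in> borel_measurable (lebesgue_on \<Omega>) \<and>
     (\<forall>K. compact K \<and> K \<subseteq> \<Omega> \<longrightarrow> (\<exists>M. AE x in lebesgue_on K. norm (f x) \<le> M))}"

definition has_weak_gradient ::
    "(real^'n) set \<Rightarrow> (real^'n \<Rightarrow> real) \<Rightarrow> (real^'n \<Rightarrow> real^'n) \<Rightarrow> bool" where
  "has_weak_gradient \<Omega> u G \<longleftrightarrow> u \<in> L1_loc \<Omega> \<and> G \<in> L1_loc \<Omega> \<and>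
     (\<forall>\<phi>\<in>Cc_infty \<Omega>. \<forall>i. (LINT x|lebesgue_on \<Omega>. u x * gradient \<phi> x $ i)
                         = - (LINT x|lebesgue_on \<Omega>. G x $ i * \<phi> x))"

text \<open>The weak gradient is unique only up to null sets; it is used only under integrals and
  in almost everywhere statements.\<close>

definition wgrad :: "(real^'n) set \<Rightarrow> (real^'n \<Rightarrow> real) \<Rightarrow> real^'n \<Rightarrow> real^'n" where
  "wgrad \<Omega> u = (SOME G. has_weak_gradient \<Omega> u G)"

definition W1p :: "real \<Rightarrow> (real^'n) set \<Rightarrow> (real^'n \<Rightarrow> real) set" where
  "W1p p \<Omega> = {u. u \<in> Lp p \<Omega> \<and> (\<exists>G. has_weak_gradient \<Omega> u G \<and> G \<in> Lp p \<Omega>)}"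

definition W1p_loc :: "real \<Rightarrow> (real^'n) set \<Rightarrow> (real^'n \<Rightarrow> real) set" where
  "W1p_loc p \<Omega> = {u. u \<in> Lp_loc p \<Omega> \<and> (\<exists>G. has_weak_gradient \<Omega> u G \<and> G \<in> Lp_loc p \<Omega>)}"

definition W1inf_loc :: "(real^'n) set \<Rightarrow> (real^'n \<Rightarrow> real) set" where
  "W1inf_loc \<Omega> = {u. u \<in> Linf_loc \<Omega> \<and> (\<exists>G. has_weak_gradient \<Omega> u G \<and> G \<in> Linf_loc \<Omega>)}"


section \<open>Norm families\<close>

definition is_norm :: "('a::real_vector \<Rightarrow> real) \<Rightarrow> bool" where
  "is_norm N \<longleftrightarrow> (\<forall>\<xi>. 0 \<le> N \<xi>) \<and> (\<forall>\<xi>. N \<xi> = 0 \<longleftrightarrow> \<xi> = 0) \<and>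
     (\<forall>c \<xi>. N (c *\<^sub>R \<xi>) = \<bar>c\<bar> * N \<xi>) \<and> (\<forall>\<xi> \<eta>. N (\<xi> + \<eta>) \<le> N \<xi> + N \<eta>)"

text \<open>The modulus is extended real valued so that infima are genuine infima even on the
  null set of points at which \<open>H x\<close> need not be a norm.\<close>

definition convexity_modulus :: "('a::real_vector \<Rightarrow> real) \<Rightarrow> real \<Rightarrow> ereal" where
  "convexity_modulus N \<epsilon> =
     Inf {ereal (1 - N ((1/2) *\<^sub>R (\<xi> + \<eta>))) | \<xi> \<eta>. N \<xi> = 1 \<and> N \<eta> = 1 \<and> N (\<xi> - \<eta>) \<ge> \<epsilon>}"

definition uniformly_convex_norm :: "('a::real_vector \<Rightarrow> real) \<Rightarrow> bool" where
  "uniformly_convex_norm N \<longleftrightarrow> (\<forall>\<epsilon>\<in>{0<..2}. convexity_modulus N \<epsilon> > 0)"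

definition admissible_norm_family ::
    "(real^'n) set \<Rightarrow> (real^'n \<Rightarrow> real^'n \<Rightarrow> real) \<Rightarrow> bool" where
  "admissible_norm_family \<Omega> H \<longleftrightarrow>
     (AE x in lebesgue_on \<Omega>. is_norm (H x)) \<and>
     (\<forall>\<xi>. (\<lambda>x. H x \<xi>) \<in> borel_measurable (lebesgue_on \<Omega>)) \<and>
     (\<forall>\<omega>. is_domain \<omega> \<and> compactly_inside \<omega> \<Omega> \<longrightarrow>
        (\<exists>\<kappa> \<nu>. 0 < \<kappa> \<and> \<kappa> \<le> \<nu> \<and>
           (AE x in lebesgue_on \<omega>. \<forall>\<xi>. \<kappa> * norm \<xi> \<le> H x \<xi> \<and> H x \<xi> \<le> \<nu> * norm \<xi>))) \<and>
     (AE x in lebesgue_on \<Omega>. uniformly_convex_norm (H x) \<and>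
        (\<forall>\<xi>. \<xi> \<noteq> 0 \<longrightarrow> H x differentiable (at \<xi>)))"

definition commonly_uniformly_convex ::
    "(real^'n) set \<Rightarrow> (real^'n \<Rightarrow> real^'n \<Rightarrow> real) \<Rightarrow> bool" where
  "commonly_uniformly_convex \<Omega> H \<longleftrightarrow>
     (\<exists>N\<in>null_sets lebesgue. N \<subseteq> \<Omega> \<and>
        (\<forall>\<epsilon>\<in>{0<..2}. (INF x\<in>\<Omega> - N. convexity_modulus (H x) \<epsilon>) > 0))"

definition flux ::
    "(real^'n \<Rightarrow> real^'n \<Rightarrow> real) \<Rightarrow> real \<Rightarrow> real^'n \<Rightarrow> real^'n \<Rightarrow> real^'n" where
  "flux H p x \<xi> = gradient (\<lambda>\<zeta>. (1 / p) * H x \<zeta> powr p) \<xi>"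

definition bregman_lower_bound ::
    "(real^'n) set \<Rightarrow> (real^'n \<Rightarrow> real^'n \<Rightarrow> real) \<Rightarrow> real \<Rightarrow> (real^'n \<Rightarrow> real) \<Rightarrow> bool" where
  "bregman_lower_bound \<Omega> H p \<delta> \<longleftrightarrow>
     \<delta> \<in> borel_measurable (lebesgue_on \<Omega>) \<and>
     (\<forall>x\<in>\<Omega>. 2 \<le> \<delta> x) \<and>
     (\<forall>K. compact K \<and> K \<subseteq> \<Omega> \<longrightarrow> bounded (\<delta> ` K)) \<and>
     (\<forall>\<omega>. is_domain \<omega> \<and> compactly_inside \<omega> \<Omega> \<longrightarrow>
        (\<exists>C>0. AE x in lebesgue_on \<omega>. \<forall>\<xi> \<eta>.
           H x (\<xi> + \<eta>) powr p - H x \<xi> powr p - p * (flux H p x \<xi> \<bullet> \<eta>)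
             \<ge> C * H x \<eta> powr \<delta> x * (H x \<eta> + H x \<xi>) powr (p - \<delta> x)))"


section \<open>Morrey spaces\<close>

definition morrey_exponent :: "'n::finite itself \<Rightarrow> real \<Rightarrow> real \<Rightarrow> bool" where
  "morrey_exponent _ p q \<longleftrightarrow> (let n = real CARD('n) in
     (p < n \<longrightarrow> q > n / p) \<and> (p = n \<longrightarrow> q > n) \<and> (p > n \<longrightarrow> q = 1))"

definition morrey_norm ::
    "real \<Rightarrow> real \<Rightarrow> (real^'n) set \<Rightarrow> (real^'n \<Rightarrow> real) \<Rightarrow> ennreal" where
  "morrey_norm p q \<omega> f = (let n = real CARD('n); q' = q / (q - 1); n' = n / (n - 1) in
     (SUP y\<in>\<omega>. SUP r\<in>{0<..<diameter \<omega>}.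
        ennreal (if p < n then r powr (- (n / q')) else ln (diameter \<omega> / r) powr (q / n')) *
        (\<integral>\<^sup>+x. ennreal \<bar>f x\<bar> \<partial>lebesgue_on (\<omega> \<inter> ball y r))))"

definition morrey_space :: "real \<Rightarrow> real \<Rightarrow> (real^'n) set \<Rightarrow> (real^'n \<Rightarrow> real) set" where
  "morrey_space p q \<omega> =
     (if p \<le> real CARD('n) then {f. f \<in> L1_loc \<omega> \<and> morrey_norm p q \<omega> f < \<infinity>}
      else {f. integrable (lebesgue_on \<omega>) f})"

definition morrey_loc :: "real \<Rightarrow> real \<Rightarrow> (real^'n) set \<Rightarrow> (real^'n \<Rightarrow> real) set" where
  "morrey_loc p q \<Omega> =
     {f. \<forall>\<omega>. is_domain \<omega> \<and> compactly_inside \<omega> \<Omega> \<longrightarrow> f \<in> morrey_space p q \<omega>}"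


section \<open>The functional and the equation\<close>

definition Q_functional ::
    "(real^'n \<Rightarrow> real^'n \<Rightarrow> real) \<Rightarrow> real \<Rightarrow> (real^'n \<Rightarrow> real) \<Rightarrow> (real^'n) set \<Rightarrow>
     (real^'n \<Rightarrow> real) \<Rightarrow> real" where
  "Q_functional H p V \<Omega> \<phi> =
     (LINT x|lebesgue_on \<Omega>. H x (wgrad \<Omega> \<phi> x) powr p + V x * \<bar>\<phi> x\<bar> powr p)"

definition weak_solution ::
    "(real^'n \<Rightarrow> real^'n \<Rightarrow> real) \<Rightarrow> real \<Rightarrow> (real^'n \<Rightarrow> real) \<Rightarrow> (real^'n) set \<Rightarrow>
     (real^'n \<Rightarrow> real) \<Rightarrow> (real^'n \<Rightarrow> real) \<Rightarrow> bool" where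
  "weak_solution H p V \<Omega> f v \<longleftrightarrow> v \<in> W1p_loc p \<Omega> \<and>
     (\<forall>\<phi>\<in>Cc_infty \<Omega>.
        integrable (lebesgue_on \<Omega>) (\<lambda>x. flux H p x (wgrad \<Omega> v x) \<bullet> gradient \<phi> x) \<and>
        integrable (lebesgue_on \<Omega>) (\<lambda>x. V x * \<bar>v x\<bar> powr (p - 2) * v x * \<phi> x) \<and>
        integrable (lebesgue_on \<Omega>) (\<lambda>x. f x * \<phi> x) \<and>
        (LINT x|lebesgue_on \<Omega>. flux H p x (wgrad \<Omega> v x) \<bullet> gradient \<phi> x) +
        (LINT x|lebesgue_on \<Omega>. V x * \<bar>v x\<bar> powr (p - 2) * v x * \<phi> x) =
        (LINT x|lebesgue_on \<Omega>. f x * \<phi> x))"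

definition positive_weak_solution ::
    "(real^'n \<Rightarrow> real^'n \<Rightarrow> real) \<Rightarrow> real \<Rightarrow> (real^'n \<Rightarrow> real) \<Rightarrow> (real^'n) set \<Rightarrow>
     (real^'n \<Rightarrow> real) \<Rightarrow> (real^'n \<Rightarrow> real) \<Rightarrow> bool" where
  "positive_weak_solution H p V \<Omega> f v \<longleftrightarrow>
     weak_solution H p V \<Omega> f v \<and> (AE x in lebesgue_on \<Omega>. v x > 0)"

text \<open>Here \<open>\<delta>\<close> is the exponent function of the Bregman lower bound.\<close>

definition gradient_regularity ::
    "(real^'n) set \<Rightarrow> (real^'n \<Rightarrow> real^'n \<Rightarrow> real) \<Rightarrow> real \<Rightarrow> (real^'n \<Rightarrow> real) \<Rightarrow>
     (real^'n \<Rightarrow> real) \<Rightarrow> bool" where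
  "gradient_regularity \<Omega> H p \<delta> V \<longleftrightarrow>
     (emeasure lebesgue {x\<in>\<Omega>. p < \<delta> x} > 0 \<longrightarrow>
        (\<forall>\<Omega>' W u. is_domain \<Omega>' \<and> \<Omega>' \<subseteq> \<Omega> \<and> W \<in> Linf_loc \<Omega>' \<and>
             positive_weak_solution H p (\<lambda>x. V x - W x) \<Omega>' (\<lambda>_. 0) u
             \<longrightarrow> u \<in> W1inf_loc \<Omega>') \<and>
        (\<forall>f u. f \<in> Cc_infty \<Omega> \<and> (\<forall>x. 0 \<le> f x) \<and> f \<noteq> (\<lambda>_. 0) \<and>
             positive_weak_solution H p V \<Omega> f u
             \<longrightarrow> u \<in> W1inf_loc \<Omega>))"


section \<open>Hardy weights\<close>

definition hardy_weights ::
    "(real^'n \<Rightarrow> real^'n \<Rightarrow> real) \<Rightarrow> real \<Rightarrow> (real^'n \<Rightarrow> real) \<Rightarrow> (real^'n) set \<Rightarrow>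
     (real^'n \<Rightarrow> real) set" where
  "hardy_weights H p V \<Omega> = {g. g \<in> L1_loc \<Omega> \<and>
     (\<exists>C>0. \<forall>\<phi>\<in>Cc_infty \<Omega>.
        Q_functional H p V \<Omega> \<phi> \<ge> C * (LINT x|lebesgue_on \<Omega>. \<bar>g x\<bar> * \<bar>\<phi> x\<bar> powr p))}"

definition subcritical ::
    "(real^'n \<Rightarrow> real^'n \<Rightarrow> real) \<Rightarrow> real \<Rightarrow> (real^'n \<Rightarrow> real) \<Rightarrow> (real^'n) set \<Rightarrow> bool" where
  "subcritical H p V \<Omega> \<longleftrightarrow>
     (\<forall>\<phi>\<in>Cc_infty \<Omega>. Q_functional H p V \<Omega> \<phi> \<ge> 0) \<and>
     (\<exists>g\<in>hardy_weights H p V \<Omega>. \<not> (AE x in lebesgue_on \<Omega>. g x = 0))"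

definition hardy_constant ::
    "(real^'n \<Rightarrow> real^'n \<Rightarrow> real) \<Rightarrow> real \<Rightarrow> (real^'n \<Rightarrow> real) \<Rightarrow> (real^'n) set \<Rightarrow>
     (real^'n \<Rightarrow> real) \<Rightarrow> real" where
  "hardy_constant H p V \<Omega> g =
     Inf {Q_functional H p V \<Omega> \<phi> / (LINT x|lebesgue_on \<Omega>. \<bar>g x\<bar> * \<bar>\<phi> x\<bar> powr p) | \<phi>.
        \<phi> \<in> W1p p \<Omega> \<inter> Cc \<Omega> \<and> (LINT x|lebesgue_on \<Omega>. \<bar>g x\<bar> * \<bar>\<phi> x\<bar> powr p) > 0}"


section \<open>The energy spaces\<close>

definition Wt ::
    "(real^'n \<Rightarrow> real^'n \<Rightarrow> real) \<Rightarrow> real \<Rightarrow> (real^'n \<Rightarrow> real) \<Rightarrow> (real^'n \<Rightarrow> real) \<Rightarrow>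
     (real^'n) set \<Rightarrow> (real^'n \<Rightarrow> real) set" where
  "Wt H p V \<V> \<Omega> = {u. u \<in> borel_measurable (lebesgue_on \<Omega>) \<and>
     integrable (lebesgue_on \<Omega>) (\<lambda>x. (\<bar>V x\<bar> + \<V> x) * \<bar>u x\<bar> powr p) \<and>
     (\<exists>G. has_weak_gradient \<Omega> u G) \<and>
     integrable (lebesgue_on \<Omega>) (\<lambda>x. H x (wgrad \<Omega> u x) powr p)}"

definition Wt_norm ::
    "(real^'n \<Rightarrow> real^'n \<Rightarrow> real) \<Rightarrow> real \<Rightarrow> (real^'n \<Rightarrow> real) \<Rightarrow> (real^'n \<Rightarrow> real) \<Rightarrow>
     (real^'n) set \<Rightarrow> (real^'n \<Rightarrow> real) \<Rightarrow> real" where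
  "Wt_norm H p V \<V> \<Omega> u =
     (LINT x|lebesgue_on \<Omega>. H x (wgrad \<Omega> u x) powr p + (\<bar>V x\<bar> + \<V> x) * \<bar>u x\<bar> powr p)
       powr (1 / p)"

definition Wt0 ::
    "(real^'n \<Rightarrow> real^'n \<Rightarrow> real) \<Rightarrow> real \<Rightarrow> (real^'n \<Rightarrow> real) \<Rightarrow> (real^'n \<Rightarrow> real) \<Rightarrow>
     (real^'n) set \<Rightarrow> (real^'n \<Rightarrow> real) set" where
  "Wt0 H p V \<V> \<Omega> = {u \<in> Wt H p V \<V> \<Omega>.
     \<forall>\<epsilon>>0. \<exists>\<phi>\<in>W1p p \<Omega> \<inter> Cc \<Omega>. Wt_norm H p V \<V> \<Omega> (\<lambda>x. u x - \<phi> x) < \<epsilon>}"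

text \<open>Bounded linear functionals on, and weak convergence in, a vector space \<open>X\<close> of functions
  with (semi)norm \<open>N\<close>. Bounded functionals respect the identification of functions
  whose difference has \<open>N\<close> equal to zero.\<close>

definition bounded_functional ::
    "('a \<Rightarrow> real) set \<Rightarrow> (('a \<Rightarrow> real) \<Rightarrow> real) \<Rightarrow> (('a \<Rightarrow> real) \<Rightarrow> real) \<Rightarrow> bool" where
  "bounded_functional X N l \<longleftrightarrow>
     (\<forall>u\<in>X. \<forall>v\<in>X. l (\<lambda>x. u x + v x) = l u + l v) \<and>
     (\<forall>c. \<forall>u\<in>X. l (\<lambda>x. c * u x) = c * l u) \<and>
     (\<exists>C. \<forall>u\<in>X. \<bar>l u\<bar> \<le> C * N u)"

definition weakly_converges ::
    "('a \<Rightarrow> real) set \<Rightarrow> (('a \<Rightarrow> real) \<Rightarrow> real) \<Rightarrow> (nat \<Rightarrow> 'a \<Rightarrow> real) \<Rightarrow> ('a \<Rightarrow> real) \<Rightarrow> bool" where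
  "weakly_converges X N \<phi> \<psi> \<longleftrightarrow>
     (\<forall>l. bounded_functional X N l \<longrightarrow> (\<lambda>k. l (\<phi> k)) \<longlonglongrightarrow> l \<psi>)"

end

theory Submission
  imports Defs "HOL-Library.Function_Algebras"
begin

text \<open>
  Since \<open>V\<close> is nonnegative, the \<open>p\<close>-th root of \<open>Q\<close> is a seminorm that is dominated by the norm of
  \<open>Wt0\<close>, so by Hahn-Banach it is weakly lower semicontinuous. A minimizing sequence in
  \<open>W1p \<inter> Cc\<close>, normalized by \<open>\<integral> \<bar>g\<bar> \<bar>\<phi>\<bar>\<^sup>p = 1\<close>, is bounded because \<open>\<V>\<close> is a Hardy-weight;
  this needs the Hardy inequality on \<open>W1p \<inter> Cc\<close> and not only on smooth functions, hence
  mollification. The compactness hypothesis gives a weak limit \<open>\<psi>\<close> that satisfies the constraint,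
  and \<open>Q \<psi>\<close> is at most the Hardy constant. For the converse inequality take approximants of \<open>\<psi>\<close>
  in \<open>W1p \<inter> Cc\<close> and apply the compactness hypothesis once more to them: their weak limit is \<open>\<psi>\<close>,
  so \<open>\<integral> \<bar>g\<bar> \<bar>\<cdot>\<bar>\<^sup>p\<close> converges along a subsequence.
\<close>

section \<open>Hahn-Banach and weak lower semicontinuity\<close>

text \<open>Functions are not identified modulo null sets, so \<open>Wt_norm\<close> is only a
  seminorm on a set of total functions. Hahn-Banach is therefore proved for sublinear functions on a
  subspace, and weak limits are determined only up to seminorm zero; positivity of
  \<open>\<V>\<close> on \<open>\<Omega>\<close> turns seminorm zero into almost everywhere
  equality.

  The converse inequality needs an argument because the infimum in the Hardy constant ranges over
  \<open>W1p p \<Omega> \<inter> Cc \<Omega>\<close>, to which the weak limit need not belong.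
  Seminorm convergence of the approximants controls the numerator of the quotient, and the second
  use of the compactness hypothesis controls the denominator.

  In the mollification step the obstacle is that \<open>H\<close> is comparable to the Euclidean
  norm only locally, with constants depending on the compact set. All mollifications of one function
  are therefore kept inside a single compact subset of \<open>\<Omega>\<close>. Only convergence of
  their energies is shown, which is all that the Hardy inequality asks for.\<close>

definition sublinear_on :: "(real \<Rightarrow> 'v \<Rightarrow> 'v) \<Rightarrow> 'v::ab_group_add set \<Rightarrow> ('v \<Rightarrow> real) \<Rightarrow> bool" where
  "sublinear_on sc X q \<longleftrightarrow>
     (\<forall>x\<in>X. \<forall>y\<in>X. q (x + y) \<le> q x + q y) \<and> (\<forall>c>0. \<forall>x\<in>X. q (sc c x) \<le> c * q x)"

text \<open>The scalar multiplication is a parameter so that the results apply to real functions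
  with pointwise operations.\<close>

locale real_subspace = vector_space scale for scale :: "real \<Rightarrow> 'v::ab_group_add \<Rightarrow> 'v" (infixr "\<odot>" 75) +
  fixes X
  assumes subspace_X: "subspace X"
begin

section \<open>Sublinear functions on a subspace\<close>

lemma X_closed:
  "0 \<in> X" "x \<in> X \<Longrightarrow> y \<in> X \<Longrightarrow> x + y \<in> X" "x \<in> X \<Longrightarrow> c \<odot> x \<in> X" "x \<in> X \<Longrightarrow> - x \<in> X"
  using subspace_X subspace_0 subspace_add subspace_scale subspace_neg by blast+

text \<open>The inequality in \<open>sublinear_on\<close>, applied to \<open>c \<odot> x\<close>
  with the inverse of \<open>c\<close>, is the converse inequality. Homogeneity of an infimum thus
  has to be checked in one direction only.\<close>

lemma sublinear_scale:
  assumes "sublinear_on scale X q" "c > 0" "x \<in> X"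
  shows "q (c \<odot> x) = c * q x"
proof (rule antisym)
  show "q (c \<odot> x) \<le> c * q x"
    using assms by (auto simp: sublinear_on_def)
  have "q (inverse c \<odot> (c \<odot> x)) \<le> inverse c * q (c \<odot> x)"
    using assms(1,2) X_closed(3)[OF assms(3)] by (simp add: sublinear_on_def del: scale_scale)
  then have "q x \<le> inverse c * q (c \<odot> x)"
    using assms(2) by simp
  then show "c * q x \<le> q (c \<odot> x)"
    using assms(2) by (simp add: field_simps)
qed

lemma sublinear_zero:
  assumes "sublinear_on scale X q"
  shows "q 0 = 0"
  using sublinear_scale[OF assms, of 2 0] X_closed(1) by simp

lemma sublinear_ge_minus:
  assumes "sublinear_on scale X q" "x \<in> X"
  shows "- q (- x) \<le> q x"
proof -
  have "q (x + - x) \<le> q x + q (- x)"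
    using assms X_closed(4) unfolding sublinear_on_def by blast
  then show ?thesis using sublinear_zero[OF assms(1)] by simp
qed

text \<open>The shift stays below \<open>q\<close> while its value at \<open>- y\<close> drops to at
  most \<open>- q y\<close>. The construction is used twice: on the given sublinear function, to
  make the functional norming at \<open>y\<close>, and on a minimal sublinear function, to prove
  additivity.\<close>

lemma sublinear_shift:
  assumes q: "sublinear_on scale X q" and y: "y \<in> X"
  defines "q' \<equiv> \<lambda>x. INF t\<in>{0..}. q (x + t \<odot> y) - t * q y"
  shows "sublinear_on scale X q'" "\<And>x t. x \<in> X \<Longrightarrow> t \<ge> 0 \<Longrightarrow> q' x \<le> q (x + t \<odot> y) - t * q y"
proof -
  have add: "q (a + b) \<le> q a + q b" if "a \<in> X" "b \<in> X" for a b
    using q that unfolding sublinear_on_def by blast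
  have scale0: "q (t \<odot> a) = t * q a" if "t \<ge> 0" "a \<in> X" for t a
    using that sublinear_scale[OF q] sublinear_zero[OF q] by (cases "t = 0") auto
  \<comment> \<open>Subadditivity for \<open>t \<odot> y = (x + t \<odot> y) + (- x)\<close> gives a
    lower bound independent of \<open>t\<close>, so the real infimum is a genuine one.\<close>
  have bdd: "bdd_below ((\<lambda>t. q (x + t \<odot> y) - t * q y) ` {0..})" if x: "x \<in> X" for x
  proof (intro bdd_belowI2)
    fix t :: real assume "t \<in> {0..}"
    then show "- q (- x) \<le> q (x + t \<odot> y) - t * q y"
      using add[of "x + t \<odot> y" "- x"] x y X_closed scale0[of t y] by (simp add: algebra_simps)
  qed
  show le: "q' x \<le> q (x + t \<odot> y) - t * q y" if "x \<in> X" "t \<ge> 0" for x t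
    unfolding q'_def using that by (intro cINF_lower[OF bdd]) auto
  have q'_ge: "a \<le> q' x" if "\<And>t. t \<ge> 0 \<Longrightarrow> a \<le> q (x + t \<odot> y) - t * q y" for a x
    unfolding q'_def using that by (intro cINF_greatest) auto
  have scale_le: "q' (c \<odot> x) \<le> c * q' x" if "c > 0" "x \<in> X" for c x
  proof -
    have "inverse c * q' (c \<odot> x) \<le> q (x + t \<odot> y) - t * q y" if "t \<ge> 0" for t
    proof -
      have "q' (c \<odot> x) \<le> q (c \<odot> x + (c * t) \<odot> y) - (c * t) * q y"
        using le[of "c \<odot> x" "c * t"] that \<open>c > 0\<close> \<open>x \<in> X\<close> X_closed by simp
      also have "c \<odot> x + (c * t) \<odot> y = c \<odot> (x + t \<odot> y)"
        by (simp add: scale_right_distrib)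
      also have "q \<dots> = c * q (x + t \<odot> y)"
        using \<open>c > 0\<close> \<open>x \<in> X\<close> y X_closed by (intro scale0) auto
      finally show ?thesis using \<open>c > 0\<close> by (simp add: field_simps)
    qed
    then have "inverse c * q' (c \<odot> x) \<le> q' x"
      by (rule q'_ge)
    then show ?thesis using \<open>c > 0\<close> by (simp add: field_simps)
  qed
  have add_le: "q' (x + z) \<le> q' x + q' z" if "x \<in> X" "z \<in> X" for x z
  proof -
    \<comment> \<open>The parameters \<open>t\<close> and \<open>s\<close> merge into the admissible
      parameter \<open>t + s\<close>; since they are independent, the two infima can then be taken
      one after the other.\<close>
    have *: "q' (x + z) \<le> (q (x + t \<odot> y) - t * q y) + (q (z + s \<odot> y) - s * q y)"
      if "t \<ge> 0" "s \<ge> 0" for t s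
    proof -
      have "q' (x + z) \<le> q ((x + z) + (t + s) \<odot> y) - (t + s) * q y"
        using le[of "x + z" "t + s"] \<open>x \<in> X\<close> \<open>z \<in> X\<close> that X_closed by simp
      also have "(x + z) + (t + s) \<odot> y = (x + t \<odot> y) + (z + s \<odot> y)"
        by (simp add: algebra_simps)
      also have "q \<dots> \<le> q (x + t \<odot> y) + q (z + s \<odot> y)"
        using \<open>x \<in> X\<close> \<open>z \<in> X\<close> y X_closed by (intro add) auto
      finally show ?thesis by (simp add: algebra_simps)
    qed
    have "q' (x + z) - (q (x + t \<odot> y) - t * q y) \<le> q' z" if "t \<ge> 0" for t
      using *[OF that] by (intro q'_ge) (auto simp: algebra_simps)
    then have "q' (x + z) - q' z \<le> q' x"
      by (intro q'_ge) (auto simp: algebra_simps)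
    then show ?thesis by simp
  qed
  show "sublinear_on scale X q'"
    unfolding sublinear_on_def using scale_le add_le by blast
qed

text \<open>Subadditivity of an infimum uses the chain condition: of two members, the smaller one
  serves both summands. The common upper bound \<open>P\<close> yields the lower bound
  \<open>- P (- x)\<close> that makes the infimum finite.\<close>

lemma sublinear_INF_chain:
  assumes C: "C \<noteq> {}" and sub: "\<And>q. q \<in> C \<Longrightarrow> sublinear_on scale X q"
    and le: "\<And>q x. q \<in> C \<Longrightarrow> x \<in> X \<Longrightarrow> q x \<le> P x"
    and chain: "\<And>q r. q \<in> C \<Longrightarrow> r \<in> C \<Longrightarrow> (\<forall>x\<in>X. q x \<le> r x) \<or> (\<forall>x\<in>X. r x \<le> q x)"
  defines "m \<equiv> \<lambda>x. INF q\<in>C. q x"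
  shows "sublinear_on scale X m" "\<And>q x. q \<in> C \<Longrightarrow> x \<in> X \<Longrightarrow> m x \<le> q x"
proof -
  have bdd: "bdd_below ((\<lambda>q. q x) ` C)" if "x \<in> X" for x
  proof (intro bdd_belowI2)
    fix q assume "q \<in> C"
    then show "- P (- x) \<le> q x"
      using sublinear_ge_minus[OF sub that] le[of q "- x"] X_closed that by fastforce
  qed
  show lower: "m x \<le> q x" if "q \<in> C" "x \<in> X" for q x
    unfolding m_def using that by (intro cINF_lower bdd) auto
  have m_ge: "a \<le> m z" if "\<And>q. q \<in> C \<Longrightarrow> a \<le> q z" for a z
    unfolding m_def by (intro cINF_greatest[OF C] that)
  have add: "m (x + y) \<le> m x + m y" if xy: "x \<in> X" "y \<in> X" for x y
  proof -
    have *: "m (x + y) \<le> q x + r y" if "q \<in> C" "r \<in> C" for q r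
    proof -
      obtain s where s: "s \<in> C" "s x \<le> q x" "s y \<le> r y"
        using chain[OF \<open>q \<in> C\<close> \<open>r \<in> C\<close>] \<open>q \<in> C\<close> \<open>r \<in> C\<close> xy by blast
      have "m (x + y) \<le> s (x + y)" using s xy X_closed lower by simp
      also have "\<dots> \<le> s x + s y"
        using sub[OF s(1)] xy unfolding sublinear_on_def by blast
      finally show ?thesis using s by simp
    qed
    have "m (x + y) - q x \<le> m y" if "q \<in> C" for q
      using *[OF that] by (intro m_ge) (auto simp: algebra_simps)
    then have "m (x + y) - m y \<le> m x"
      by (intro m_ge) (auto simp: algebra_simps)
    then show ?thesis by simp
  qed
  have sc: "m (c \<odot> x) \<le> c * m x" if "c > 0" "x \<in> X" for c x
  proof -
    have "inverse c * m (c \<odot> x) \<le> m x"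
    proof (rule m_ge)
      fix q assume "q \<in> C"
      then have "m (c \<odot> x) \<le> c * q x"
        using lower[of q "c \<odot> x"] sublinear_scale[OF sub] that X_closed by fastforce
      then show "inverse c * m (c \<odot> x) \<le> q x" using that by (simp add: field_simps)
    qed
    then show ?thesis using that by (simp add: field_simps)
  qed
  show "sublinear_on scale X m" unfolding sublinear_on_def using add sc by blast
qed

text \<open>Zorn's lemma applied downwards, with the infimum of a chain as its lower bound.\<close>

lemma exists_minimal_sublinear:
  assumes P: "sublinear_on scale X P"
  obtains l where "sublinear_on scale X l" "\<And>x. x \<in> X \<Longrightarrow> l x \<le> P x"
    "\<And>q x. sublinear_on scale X q \<Longrightarrow> (\<And>x. x \<in> X \<Longrightarrow> q x \<le> l x) \<Longrightarrow> x \<in> X \<Longrightarrow> q x = l x"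
proof -
  \<comment> \<open>Fixing the values outside \<open>X\<close> to be zero makes comparison on
    \<open>X\<close> antisymmetric, as a partial order requires.\<close>
  define cut where "cut = (\<lambda>(q :: 'v \<Rightarrow> real) x. if x \<in> X then q x else 0)"
  have sub_cut: "sublinear_on scale X (cut q) \<longleftrightarrow> sublinear_on scale X q" for q
    unfolding sublinear_on_def cut_def using X_closed by simp
  define A where "A = {q. sublinear_on scale X q \<and> (\<forall>x\<in>X. q x \<le> P x) \<and> (\<forall>x. x \<notin> X \<longrightarrow> q x = 0)}"
  \<comment> \<open>The order is reversed, so that a maximal element in the sense of Zorn is a
    minimal sublinear function.\<close>
  define R where "R = (\<lambda>q r :: 'v \<Rightarrow> real. \<forall>x\<in>X. r x \<le> q x)"
  have cut_P: "cut P \<in> A" using P sub_cut by (auto simp: A_def cut_def)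
  have "\<exists>m\<in>A. \<forall>a\<in>A. R m a \<longrightarrow> a = m"
  proof (rule predicate_Zorn)
    show "partial_order_on A (relation_of R A)"
    proof (rule partial_order_on_relation_ofI)
      fix a b assume ab: "a \<in> A" "b \<in> A" "R a b" "R b a"
      show "a = b"
      proof
        fix x show "a x = b x" using ab by (cases "x \<in> X") (auto simp: A_def R_def intro: antisym)
      qed
    qed (auto simp: R_def intro: order_trans)
    fix C assume C: "C \<in> Chains (relation_of R A)"
    then have CA: "C \<subseteq> A" and ch: "\<And>q r. q \<in> C \<Longrightarrow> r \<in> C \<Longrightarrow> R q r \<or> R r q"
      unfolding Chains_def relation_of_def by auto
    show "\<exists>u\<in>A. \<forall>a\<in>C. R a u"
    proof (cases "C = {}")
      case True then show ?thesis using cut_P by blast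
    next
      case False
      define m where "m = (\<lambda>x. INF q\<in>C. q x)"
      have "sublinear_on scale X m" and lower: "\<And>q x. q \<in> C \<Longrightarrow> x \<in> X \<Longrightarrow> m x \<le> q x"
        unfolding m_def using sublinear_INF_chain[OF False, of P] CA ch
        by (auto simp: A_def R_def subset_eq)
      moreover have "m x \<le> P x" if "x \<in> X" for x
      proof -
        obtain q where "q \<in> C" using False by blast
        then show ?thesis using lower[of q x] that CA by (force simp: A_def)
      qed
      ultimately have "cut m \<in> A" using sub_cut by (auto simp: A_def cut_def)
      moreover have "R a (cut m)" if "a \<in> C" for a
        using lower[OF that] by (simp add: R_def cut_def)
      ultimately show ?thesis by blast
    qed
  qed
  then obtain l where l: "l \<in> A" and min: "\<And>a. a \<in> A \<Longrightarrow> R l a \<Longrightarrow> a = l" by blast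
  show ?thesis
  proof (rule that)
    fix q x assume q: "sublinear_on scale X q" "\<And>x. x \<in> X \<Longrightarrow> q x \<le> l x" and x: "x \<in> X"
    have "cut q \<in> A" using q l sub_cut by (force simp: A_def cut_def)
    moreover have "R l (cut q)" using q by (simp add: R_def cut_def)
    ultimately have "cut q = l" by (rule min)
    then show "q x = l x" using x unfolding cut_def by meson
  qed (use l in \<open>auto simp: A_def\<close>)
qed

text \<open>A minimal function cannot be lowered by its own shift in direction \<open>y\<close>, so
  it coincides with it; the parameter 1 in the shift then gives superadditivity.\<close>

lemma minimal_sublinear_additive:
  assumes l: "sublinear_on scale X l"
    and min: "\<And>q x. sublinear_on scale X q \<Longrightarrow> (\<And>x. x \<in> X \<Longrightarrow> q x \<le> l x) \<Longrightarrow> x \<in> X \<Longrightarrow> q x = l x"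
    and x: "x \<in> X" and y: "y \<in> X"
  shows "l (x + y) = l x + l y"
proof (rule antisym)
  show "l (x + y) \<le> l x + l y" using l x y unfolding sublinear_on_def by blast
  define q where "q = (\<lambda>x. INF t\<in>{0..}. l (x + t \<odot> y) - t * l y)"
  note shift = sublinear_shift[OF l y, folded q_def]
  have "q z \<le> l z" if "z \<in> X" for z
    using shift(2)[OF that, of 0] unfolding q_def by simp
  then have "q x = l x" by (intro min shift x)
  then show "l x + l y \<le> l (x + y)" using shift(2)[OF x, of 1] unfolding q_def by simp
qed

text \<open>The minimal function is taken below the shift of \<open>P\<close> and not merely below
  \<open>P\<close>. The shift forces \<open>l (- y) \<le> - P y\<close>, and linearity turns this
  into \<open>l y = P y\<close>.\<close>

theorem hahn_banach_norming:
  assumes P: "sublinear_on scale X P" and y: "y \<in> X"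
  obtains l where "\<And>u v. u \<in> X \<Longrightarrow> v \<in> X \<Longrightarrow> l (u + v) = l u + l v"
    "\<And>c u. u \<in> X \<Longrightarrow> l (c \<odot> u) = c * l u" "\<And>u. u \<in> X \<Longrightarrow> l u \<le> P u" "l y = P y"
proof -
  define q where "q = (\<lambda>x. INF t\<in>{0..}. P (x + t \<odot> y) - t * P y)"
  note shift = sublinear_shift[OF P y, folded q_def]
  obtain l where l: "sublinear_on scale X l" "\<And>x. x \<in> X \<Longrightarrow> l x \<le> q x"
    and min: "\<And>q x. sublinear_on scale X q \<Longrightarrow> (\<And>x. x \<in> X \<Longrightarrow> q x \<le> l x) \<Longrightarrow> x \<in> X \<Longrightarrow> q x = l x"
    using exists_minimal_sublinear[OF shift(1)] by blast
  have add: "l (u + v) = l u + l v" if "u \<in> X" "v \<in> X" for u v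
    by (rule minimal_sublinear_additive[OF l(1) _ that]) (rule min)
  have neg: "l (- u) = - l u" if "u \<in> X" for u
    using add[of u "- u"] that X_closed sublinear_zero[OF l(1)] by simp
  have scale: "l (c \<odot> u) = c * l u" if u: "u \<in> X" for c u
  proof -
    consider "c = 0" | "c > 0" | "c < 0" by linarith
    then show ?thesis
    proof cases
      case 1 then show ?thesis using sublinear_zero[OF l(1)] by simp
    next
      case 2 then show ?thesis using sublinear_scale[OF l(1) _ u] by simp
    next
      case 3
      then have "l ((- c) \<odot> u) = - c * l u" using sublinear_scale[OF l(1) _ u, of "- c"] by simp
      then show ?thesis using neg[of "c \<odot> u"] u X_closed by simp
    qed
  qed
  have le: "l u \<le> P u" if "u \<in> X" for u
    using l(2)[OF that] shift(2)[OF that, of 0] unfolding q_def by simp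
  have "l (- y) \<le> - P y"
    using l(2)[of "- y"] shift(2)[of "- y" 1] sublinear_zero[OF P] y X_closed unfolding q_def by simp
  then have "l y = P y" using neg[OF y] le[OF y] by simp
  then show ?thesis using that add scale le by blast
qed

end

lemma real_subspace_fun:
  assumes "\<And>u v. u \<in> X \<Longrightarrow> v \<in> X \<Longrightarrow> (\<lambda>x. u x + v x) \<in> X"
    and "\<And>c u. u \<in> X \<Longrightarrow> (\<lambda>x. c * u x) \<in> X" and "X \<noteq> {}"
  shows "real_subspace (\<lambda>c (u :: 'a \<Rightarrow> real) x. c * u x) X"
proof -
  interpret vector_space "\<lambda>c (u :: 'a \<Rightarrow> real) x. c * u x"
    by unfold_locales (auto simp: fun_eq_iff plus_fun_def algebra_simps)
  show ?thesis
  proof unfold_locales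
    obtain u where "u \<in> X" using assms(3) by blast
    \<comment> \<open>The zero function is obtained as the multiple by 0 of some element, whence the
      nonemptiness assumption.\<close>
    from assms(2)[OF this, of 0] show "subspace X"
      unfolding subspace_def using assms by (auto simp: plus_fun_def zero_fun_def)
  qed
qed

section \<open>Seminorms on function spaces and weak convergence\<close>

definition seminorm_on :: "('a \<Rightarrow> real) set \<Rightarrow> (('a \<Rightarrow> real) \<Rightarrow> real) \<Rightarrow> bool" where
  "seminorm_on X P \<longleftrightarrow>
     (\<forall>u\<in>X. \<forall>v\<in>X. (\<lambda>x. u x + v x) \<in> X \<and> P (\<lambda>x. u x + v x) \<le> P u + P v) \<and>
     (\<forall>c. \<forall>u\<in>X. (\<lambda>x. c * u x) \<in> X \<and> P (\<lambda>x. c * u x) = \<bar>c\<bar> * P u)"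

lemma seminorm_onD:
  assumes "seminorm_on X P" "u \<in> X"
  shows "v \<in> X \<Longrightarrow> (\<lambda>x. u x + v x) \<in> X" "(\<lambda>x. c * u x) \<in> X"
    "v \<in> X \<Longrightarrow> P (\<lambda>x. u x + v x) \<le> P u + P v" "P (\<lambda>x. c * u x) = \<bar>c\<bar> * P u"
  using assms unfolding seminorm_on_def by blast+

text \<open>The functional norms the smaller seminorm \<open>P\<close> but is bounded for the larger
  \<open>N\<close>. This is what allows weak convergence with respect to \<open>N\<close> to be used
  for \<open>P\<close>.\<close>

lemma seminorm_on_norming_functional:
  assumes P: "seminorm_on X P" and le: "\<And>u. u \<in> X \<Longrightarrow> P u \<le> N u" and \<psi>: "\<psi> \<in> X"
  obtains l where "bounded_functional X N l" "\<And>u. u \<in> X \<Longrightarrow> l u \<le> P u" "l \<psi> = P \<psi>"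
proof -
  interpret real_subspace "\<lambda>c (u :: 'a \<Rightarrow> real) x. c * u x" X
    using P \<psi> by (intro real_subspace_fun) (auto simp: seminorm_on_def)
  have "sublinear_on (\<lambda>c u x. c * u x) X P"
    using P by (auto simp: sublinear_on_def seminorm_on_def plus_fun_def)
  from hahn_banach_norming[OF this \<psi>] obtain l where
    add: "\<And>u v. u \<in> X \<Longrightarrow> v \<in> X \<Longrightarrow> l (u + v) = l u + l v"
    and scale: "\<And>c u. u \<in> X \<Longrightarrow> l (\<lambda>x. c * u x) = c * l u"
    and l: "\<And>u. u \<in> X \<Longrightarrow> l u \<le> P u" and eq: "l \<psi> = P \<psi>" by blast
  have "\<bar>l u\<bar> \<le> 1 * N u" if u: "u \<in> X" for u
  proof -
    have "P (\<lambda>x. (- 1) * u x) = P u" "(\<lambda>x. (- 1) * u x) \<in> X"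
      using P u unfolding seminorm_on_def by (metis abs_minus_cancel abs_one mult_1, metis)
    then have "- l u \<le> P u" using l[of "\<lambda>x. (- 1) * u x"] scale[OF u, of "- 1"] by simp
    then show ?thesis using l[OF u] le[OF u] by simp
  qed
  then have "bounded_functional X N l"
    unfolding bounded_functional_def using add scale unfolding plus_fun_def by blast
  then show ?thesis using that l eq by blast
qed

text \<open>For a functional \<open>l\<close> below \<open>P\<close> that norms
  \<open>\<psi>\<close>, the value \<open>P \<psi> = l \<psi>\<close> is the limit of
  \<open>l (\<phi> k)\<close>, and \<open>l (\<phi> k) \<le> P (\<phi> k)\<close>.\<close>

lemma weak_lower_semicontinuous:
  assumes P: "seminorm_on X P" and le: "\<And>u. u \<in> X \<Longrightarrow> P u \<le> N u"
    and \<psi>: "\<psi> \<in> X" and \<phi>: "\<And>k. \<phi> k \<in> X"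
    and weak: "weakly_converges X N \<phi> \<psi>" and lim: "(\<lambda>k. P (\<phi> k)) \<longlonglongrightarrow> a"
  shows "P \<psi> \<le> a"
proof -
  obtain l where l: "bounded_functional X N l" "\<And>u. u \<in> X \<Longrightarrow> l u \<le> P u" "l \<psi> = P \<psi>"
    using seminorm_on_norming_functional[OF P le \<psi>] by blast
  have "(\<lambda>k. l (\<phi> k)) \<longlonglongrightarrow> P \<psi>"
    using weak l unfolding weakly_converges_def by auto
  then show ?thesis
    by (rule LIMSEQ_le[OF _ lim]) (use l(2) \<phi> in auto)
qed

text \<open>A functional that norms the difference of the two limits takes the same value at both,
  because a sequence converging in seminorm also converges weakly to the same limit.\<close>

lemma weak_limit_unique:
  assumes N: "seminorm_on X N" and X: "\<psi> \<in> X" "\<psi>' \<in> X" "\<And>k. \<phi> k \<in> X"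
    and weak: "weakly_converges X N \<phi> \<psi>'"
    and strong: "(\<lambda>k. N (\<lambda>x. \<psi> x - \<phi> k x)) \<longlonglongrightarrow> 0"
  shows "N (\<lambda>x. \<psi> x - \<psi>' x) = 0"
proof -
  have diff: "(\<lambda>x. u x - v x) \<in> X" if "u \<in> X" "v \<in> X" for u v
  proof -
    have "(\<lambda>x. u x + (- 1) * v x) \<in> X" by (rule seminorm_onD[OF N]) (rule seminorm_onD[OF N] that)+
    then show ?thesis by simp
  qed
  obtain l where l: "bounded_functional X N l" "l (\<lambda>x. \<psi> x - \<psi>' x) = N (\<lambda>x. \<psi> x - \<psi>' x)"
    using seminorm_on_norming_functional[OF N order_refl diff[OF X(1,2)]] by blast
  then obtain C where C: "\<And>u. u \<in> X \<Longrightarrow> \<bar>l u\<bar> \<le> C * N u"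
    unfolding bounded_functional_def by blast
  have l_diff: "l (\<lambda>x. u x - v x) = l u - l v" if "u \<in> X" "v \<in> X" for u v
  proof -
    have "(\<lambda>x. (- 1) * v x) \<in> X" using N that unfolding seminorm_on_def by blast
    then have "l (\<lambda>x. u x + (- 1) * v x) = l u + (- 1) * l v"
      using l(1) that unfolding bounded_functional_def by metis
    then show ?thesis by simp
  qed
  have "(\<lambda>k. C * N (\<lambda>x. \<psi> x - \<phi> k x)) \<longlonglongrightarrow> C * 0" by (intro tendsto_intros strong)
  then have "(\<lambda>k. C * N (\<lambda>x. \<psi> x - \<phi> k x)) \<longlonglongrightarrow> 0" by simp
  moreover have "\<bar>l (\<lambda>x. \<psi> x - \<phi> k x)\<bar> \<le> C * N (\<lambda>x. \<psi> x - \<phi> k x)" for k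
    by (rule C) (rule diff X)+
  ultimately have "(\<lambda>k. l (\<lambda>x. \<psi> x - \<phi> k x)) \<longlonglongrightarrow> 0"
    by - (rule Lim_null_comparison[where g = "\<lambda>k. C * N (\<lambda>x. \<psi> x - \<phi> k x)", rotated], auto)
  then have "(\<lambda>k. l \<psi> - l (\<phi> k)) \<longlonglongrightarrow> 0" using l_diff X by simp
  moreover have "(\<lambda>k. l \<psi> - l (\<phi> k)) \<longlonglongrightarrow> l \<psi> - l \<psi>'"
    using weak l(1) by (intro tendsto_intros) (auto simp: weakly_converges_def)
  ultimately have "l \<psi> - l \<psi>' = 0" by (metis LIMSEQ_unique)
  then show ?thesis using l(2) l_diff X by simp
qed

section \<open>Smooth functions and mollifiers\<close>

lemma gradient_eqI:
  assumes "GDERIV f x :> D"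
  shows "gradient f x = D"
  unfolding gradient_def
proof (rule the_equality)
  show "GDERIV f x :> D" by (rule assms)
  fix E assume "GDERIV f x :> E"
  then have "(\<lambda>h. inner h E) = (\<lambda>h. inner h D)"
    using assms unfolding gderiv_def by (rule has_derivative_unique)
  then have "inner h (E - D) = 0" for h by (simp add: fun_eq_iff inner_diff_right)
  from this[of "E - D"] show "E = D" by simp
qed

lemma GDERIV_gradient:
  fixes f :: "real^'n \<Rightarrow> real"
  assumes "f differentiable (at x)"
  shows "GDERIV f x :> gradient f x"
proof -
  obtain f' where f': "(f has_derivative f') (at x)" using assms by (auto simp: differentiable_def)
  define D where "D = adjoint f' 1"
  have "f' h = inner h D" for h
    using adjoint_works[OF has_derivative_linear[OF f'], of h 1] by (simp add: D_def)
  then have "f' = (\<lambda>h. inner h D)" by (rule ext)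
  then have "GDERIV f x :> D" using f' by (simp add: gderiv_def)
  then show ?thesis using gradient_eqI by metis
qed

lemma Ck_SucI:
  assumes "\<And>x. GDERIV f x :> G x" "\<And>i. Ck k (\<lambda>x. G x $ i)"
  shows "Ck (Suc k) f"
  using assms gradient_eqI[OF assms(1)] by (auto simp: gderiv_def differentiable_def)

lemma Ck_GDERIV: "Ck (Suc k) f \<Longrightarrow> GDERIV f x :> gradient f x"
  by (simp add: GDERIV_gradient)

lemma Ck_continuous: "Ck k f \<Longrightarrow> continuous_on UNIV f"
  by (cases k) (auto simp: differentiable_on_def intro: differentiable_imp_continuous_on)

lemma Ck_SucD: "Ck (Suc k) f \<Longrightarrow> Ck k f"
proof (induction k arbitrary: f)
  case 0 then show ?case using Ck_continuous[OF 0] by simp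
next
  case (Suc k) then show ?case by (metis Ck.simps(2))
qed

lemma Ck_const: "Ck k (\<lambda>x. c)"
proof (induction k arbitrary: c)
  case (Suc k)
  then show ?case by (intro Ck_SucI[OF GDERIV_const]) auto
qed auto

lemma Ck_add: "Ck k f \<Longrightarrow> Ck k g \<Longrightarrow> Ck k (\<lambda>x. f x + g x)"
proof (induction k arbitrary: f g)
  case (Suc k)
  then show ?case
    by (intro Ck_SucI[OF GDERIV_add[OF Ck_GDERIV Ck_GDERIV]]) auto
qed (auto intro!: continuous_intros)

lemma Ck_mult: "Ck k f \<Longrightarrow> Ck k g \<Longrightarrow> Ck k (\<lambda>x. f x * g x)"
proof (induction k arbitrary: f g)
  case (Suc k)
  note CkD = Ck_SucD[OF Suc.prems(1)] Ck_SucD[OF Suc.prems(2)]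
  show ?case
  proof (rule Ck_SucI[OF GDERIV_mult[OF Ck_GDERIV Ck_GDERIV]])
    show "Ck k (\<lambda>x. (f x *\<^sub>R gradient g x + g x *\<^sub>R gradient f x) $ i)" for i
      using Suc.prems CkD by (auto intro!: Ck_add Suc.IH)
  qed (use Suc.prems in auto)
qed (auto intro!: continuous_intros)

lemma GDERIV_component: "GDERIV (\<lambda>x :: real^'n. x $ i) x :> axis i 1"
  by (auto simp: gderiv_def inner_axis intro!: derivative_eq_intros bounded_linear_imp_has_derivative bounded_linear_vec_nth)

lemma Ck_component: "Ck k (\<lambda>x. x $ i)"
proof (cases k)
  case (Suc m)
  then show ?thesis using Ck_SucI[OF GDERIV_component, of m i] Ck_const by auto
qed (auto intro!: continuous_intros)

lemma GDERIV_reflect: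
  assumes "GDERIV f (x - y) :> D"
  shows "GDERIV (\<lambda>y. f (x - y)) y :> - D"
proof -
  have "((\<lambda>y. f (x - y)) has_derivative (\<lambda>h. inner (0 - h) D)) (at y)"
    by (rule has_derivative_compose[where f = "\<lambda>y. x - y" and g = f])
       (use assms in \<open>auto simp: gderiv_def intro!: derivative_eq_intros\<close>)
  then show ?thesis by (simp add: gderiv_def)
qed

lemma GDERIV_translate:
  assumes "GDERIV f (x - y) :> D"
  shows "GDERIV (\<lambda>x. f (x - y)) x :> D"
proof -
  have "((\<lambda>x. f (x - y)) has_derivative (\<lambda>h. inner (h - 0) D)) (at x)"
    by (rule has_derivative_compose[where f = "\<lambda>x. x - y" and g = f])
       (use assms in \<open>auto simp: gderiv_def intro!: derivative_eq_intros\<close>)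
  then show ?thesis by (simp add: gderiv_def)
qed

lemma Ck_reflect: "Ck k f \<Longrightarrow> Ck k (\<lambda>y. f (x - y))"
proof (induction k arbitrary: f)
  case (Suc k)
  have "Ck k (\<lambda>y. (- 1) * gradient f (x - y) $ i)" for i
    using Suc by (intro Ck_mult Ck_const) auto
  then show ?case
    by (intro Ck_SucI[OF GDERIV_reflect[OF Ck_GDERIV[OF Suc.prems]]]) auto
next
  case 0
  then have "continuous_on UNIV f" by simp
  then show ?case by (auto intro!: continuous_intros continuous_on_compose2[of UNIV f])
qed

section \<open>A smooth bump function built from \<open>exp (- inverse t)\<close>\<close>

definition flat :: "nat \<Rightarrow> real \<Rightarrow> real" where
  "flat m t = (if t > 0 then exp (- inverse t) * inverse t ^ m else 0)"

lemma flat_nonneg: "0 \<le> flat m t"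
  by (simp add: flat_def)

lemma flat_eq_0_iff: "flat m t = 0 \<longleftrightarrow> t \<le> 0"
  by (simp add: flat_def)

text \<open>In the variable \<open>inverse t\<close> the exponential beats every power.\<close>

lemma flat_tendsto_0: "flat m \<midarrow>0\<rightarrow> 0"
proof -
  have "((\<lambda>t :: real. inverse t ^ m / exp (inverse t)) \<longlongrightarrow> 0) (at_right 0)"
    by (rule filterlim_compose[OF tendsto_power_div_exp_0 filterlim_inverse_at_top_right])
  then have "(flat m \<longlongrightarrow> 0) (at_right 0)"
    by (rule Lim_transform_eventually)
       (auto simp: flat_def exp_minus field_simps eventually_at_filter)
  moreover have "(flat m \<longlongrightarrow> 0) (at_left 0)"
    by (rule tendsto_eventually) (auto simp: flat_def eventually_at_filter)
  ultimately show ?thesis by (simp add: filterlim_split_at)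
qed

text \<open>The powers of \<open>inverse t\<close> are carried along because they close the family
  under differentiation, up to linear combinations. At the origin the difference quotient of
  \<open>flat m\<close> is \<open>flat (Suc m)\<close>, which tends to 0.\<close>

lemma DERIV_flat: "DERIV (flat m) t :> flat (m + 2) t - m * flat (m + 1) t"
proof -
  consider "t > 0" | "t < 0" | "t = 0" by linarith
  then show ?thesis
  proof cases
    case 1
    have "DERIV (\<lambda>t. exp (- inverse t) * inverse t ^ m) t :> flat (m + 2) t - m * flat (m + 1) t"
      using 1 by (auto intro!: derivative_eq_intros simp: flat_def)
         (cases m; simp add: field_simps power2_eq_square)
    then show ?thesis
      by (rule has_field_derivative_transform_within[where d = t])
         (use 1 in \<open>auto simp: flat_def dist_real_def\<close>)
  next
    case 2
    have "DERIV (\<lambda>t. 0) t :> flat (m + 2) t - m * flat (m + 1) t"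
      using 2 by (auto simp: flat_def)
    then show ?thesis
      by (rule has_field_derivative_transform_within[where d = "- t"])
         (use 2 in \<open>auto simp: flat_def dist_real_def\<close>)
  next
    case 3
    have "(\<lambda>h. (flat m (0 + h) - flat m 0) / h) \<midarrow>0\<rightarrow> 0"
      by (rule Lim_transform_eventually[OF flat_tendsto_0[of "Suc m"]])
         (auto simp: flat_def eventually_at_filter field_simps)
    then show ?thesis using 3 by (simp add: DERIV_def flat_def)
  qed
qed

text \<open>The induction treats all \<open>m\<close> at once, since a derivative of
  \<open>flat m\<close> involves \<open>flat (m + 1)\<close> and \<open>flat (m + 2)\<close>.
  Composing with the smooth function \<open>inner x x\<close> in place of the norm avoids a
  singularity at the centre.\<close>

lemma Ck_flat_ball: "Ck k (\<lambda>x :: real^'n. flat m (c - inner x x))"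
proof (induction k arbitrary: m)
  case 0
  have "continuous_on UNIV (flat m)"
    using DERIV_flat by (intro continuous_at_imp_continuous_on ballI) (rule DERIV_isCont)
  then show ?case by (auto intro!: continuous_intros continuous_on_compose2[of UNIV "flat m"])
next
  case (Suc k)
  have inner: "GDERIV (\<lambda>x :: real^'n. c - inner x x) x :> - 2 *\<^sub>R x" for x
    by (auto simp: gderiv_def inner_commute intro!: derivative_eq_intros)
  show ?case
  proof (rule Ck_SucI[OF GDERIV_DERIV_compose[OF inner DERIV_flat]])
    fix i
    have "Ck k (\<lambda>x :: real^'n. (flat (m + 2) (c - inner x x) + (- real m) * flat (m + 1) (c - inner x x)) * ((- 2) * x $ i))"
      by (intro Ck_mult Ck_add Ck_const Ck_component Suc)
    then show "Ck k (\<lambda>x :: real^'n. ((flat (m + 2) (c - inner x x) - real m * flat (m + 1) (c - inner x x)) *\<^sub>R - 2 *\<^sub>R x) $ i)"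
      by (simp add: algebra_simps)
  qed
qed

text \<open>The support condition is an equivalence on purpose: vanishing outside the ball localizes
  convolutions, while strict positivity inside it is what
  \<open>exists_weighted_integral_pos\<close> uses to detect where a weight vanishes.\<close>

definition mollifier :: "real \<Rightarrow> (real^'n \<Rightarrow> real) \<Rightarrow> bool" where
  "mollifier \<epsilon> \<rho> \<longleftrightarrow> (\<forall>k. Ck k \<rho>) \<and> (\<forall>x. 0 \<le> \<rho> x) \<and> (\<forall>x. \<rho> x \<noteq> 0 \<longleftrightarrow> norm x < \<epsilon>) \<and>
     integral\<^sup>L lborel \<rho> = 1"

lemma integrable_lborel_continuous_compact_support:
  fixes f :: "'a::euclidean_space \<Rightarrow> 'b::{banach, second_countable_topology}"
  assumes "continuous_on UNIV f" "compact K" "\<And>x. x \<notin> K \<Longrightarrow> f x = 0"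
  shows "integrable lborel f"
proof -
  have "integrable lborel (\<lambda>x. indicator K x *\<^sub>R f x)"
    by (intro borel_integrable_compact assms continuous_on_subset[OF assms(1)]) auto
  moreover have "(\<lambda>x. indicator K x *\<^sub>R f x) = f" using assms(3) by (auto simp: indicator_def)
  ultimately show ?thesis by simp
qed

lemma exists_mollifier:
  assumes "\<epsilon> > 0"
  obtains \<rho> :: "real^'n \<Rightarrow> real" where "mollifier \<epsilon> \<rho>"
proof -
  define f :: "real^'n \<Rightarrow> real" where "f = (\<lambda>x. flat 0 (\<epsilon>\<^sup>2 - inner x x))"
  have f0: "f x \<noteq> 0 \<longleftrightarrow> norm x < \<epsilon>" for x
    using assms by (auto simp: f_def flat_eq_0_iff power2_norm_eq_inner[symmetric] not_le power_mono_iff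
        intro: power2_less_imp_less)
  have fnn: "f x \<ge> 0" for x by (simp add: f_def flat_nonneg)
  have Ckf: "Ck k f" for k unfolding f_def by (rule Ck_flat_ball)
  have cont: "continuous_on UNIV f" using Ck_continuous[OF Ckf] .
  have int: "integrable lborel f"
    by (rule integrable_lborel_continuous_compact_support[OF cont compact_cball[of 0 \<epsilon>]])
       (use f0 in force)
  define c where "c = integral\<^sup>L lborel f"
  \<comment> \<open>Otherwise \<open>f\<close> would vanish almost everywhere, although it is
    nonzero on a nonempty open ball.\<close>
  have "c \<noteq> 0"
  proof
    assume "c = 0"
    then have "AE x in lborel. f x = 0"
      using integral_nonneg_eq_0_iff_AE[OF int] fnn by (simp add: c_def)
    then have "AE x in lborel. x \<notin> ball (0 :: real^'n) \<epsilon>"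
      by eventually_elim (use f0 in auto)
    then have "emeasure lborel (ball (0 :: real^'n) \<epsilon>) = 0"
      by (subst (asm) AE_iff_measurable[OF _ refl]) (auto simp: ball_def)
    then show False using open_not_negligible[of "ball (0 :: real^'n) \<epsilon>"] assms
      by (auto simp: negligible_iff_null_sets null_sets_def)
  qed
  moreover have "c \<ge> 0" unfolding c_def by (simp add: fnn)
  ultimately have "c > 0" by simp
  have "mollifier \<epsilon> (\<lambda>x. inverse c * f x)"
    unfolding mollifier_def using f0 fnn \<open>c > 0\<close>
    by (auto intro!: Ck_mult Ck_const Ckf simp: c_def[symmetric])
  then show ?thesis using that by blast
qed

section \<open>Convolution\<close>

lemma lborel_distr_minus:
  fixes x :: "'a::euclidean_space"
  shows "distr lborel borel (\<lambda>y. x - y) = lborel"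
  by (subst (2) lborel_affine[of "-1" x]) (auto simp: density_1 one_ennreal_def[symmetric])

lemma nn_integral_lborel_translate:
  fixes y :: "'a::euclidean_space"
  assumes [measurable]: "f \<in> borel_measurable borel"
  shows "(\<integral>\<^sup>+x. f (x - y) \<partial>lborel) = (\<integral>\<^sup>+x. f x \<partial>lborel)"
  by (subst (2) lborel_distr_plus[of "- y", symmetric], subst nn_integral_distr) auto

lemma integral_lborel_minus:
  fixes f :: "'a::euclidean_space \<Rightarrow> 'b::{banach, second_countable_topology}"
  assumes [measurable]: "f \<in> borel_measurable borel"
  shows "(LINT y|lborel. f (x - y)) = (LINT y|lborel. f y)"
  by (subst (2) lborel_distr_minus[of x, symmetric], subst integral_distr) auto

lemma integral_lborel_translate:
  fixes f :: "'a::euclidean_space \<Rightarrow> 'b::{banach, second_countable_topology}"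
  assumes [measurable]: "f \<in> borel_measurable borel"
  shows "(LINT x|lborel. f (x - y)) = (LINT x|lborel. f x)"
  by (subst (2) lborel_distr_plus[of "- y", symmetric], subst integral_distr) auto

text \<open>The integral is over the completed measure because \<open>f\<close> may be only Lebesgue
  measurable.\<close>

definition conv :: "('a::euclidean_space \<Rightarrow> real) \<Rightarrow> ('a \<Rightarrow> real) \<Rightarrow> 'a \<Rightarrow> real" where
  "conv f \<rho> x = (LINT y|lebesgue. f y * \<rho> (x - y))"

lemma continuous_on_UNIV_borel:
  fixes f :: "'a::euclidean_space \<Rightarrow> real"
  shows "continuous_on UNIV f \<Longrightarrow> f \<in> borel_measurable borel"
  by (simp add: borel_measurable_continuous_onI)

lemma mollifierD:
  assumes "mollifier \<epsilon> \<rho>"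
  shows "Ck k \<rho>" "continuous_on UNIV \<rho>" "0 \<le> \<rho> x" "norm x \<ge> \<epsilon> \<Longrightarrow> \<rho> x = 0" "norm x < \<epsilon> \<Longrightarrow> 0 < \<rho> x"
    "\<rho> \<in> borel_measurable borel" "integrable lborel \<rho>" "(LINT x|lborel. \<rho> x) = 1"
    "(\<integral>\<^sup>+x. ennreal (\<rho> x) \<partial>lborel) = 1"
proof -
  show "Ck k \<rho>" "0 \<le> \<rho> x" "norm x \<ge> \<epsilon> \<Longrightarrow> \<rho> x = 0" "(LINT x|lborel. \<rho> x) = 1" for x
    using assms unfolding mollifier_def by (auto simp: not_less[symmetric])
  show "norm x < \<epsilon> \<Longrightarrow> 0 < \<rho> x"
    using assms unfolding mollifier_def by (auto simp: less_le)
  show cont: "continuous_on UNIV \<rho>"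
    using assms Ck_continuous unfolding mollifier_def by blast
  show "\<rho> \<in> borel_measurable borel"
    using cont by (rule continuous_on_UNIV_borel)
  show int: "integrable lborel \<rho>"
    by (rule integrable_lborel_continuous_compact_support[OF cont compact_cball[of 0 \<epsilon>]])
       (use assms in \<open>force simp: mollifier_def\<close>)
  show "(\<integral>\<^sup>+x. ennreal (\<rho> x) \<partial>lborel) = 1"
    using assms by (subst nn_integral_eq_integral[OF int]) (auto simp: mollifier_def)
qed

lemma bounded_continuous_compact_support:
  fixes f :: "'a::euclidean_space \<Rightarrow> 'b::real_normed_vector"
  assumes "continuous_on UNIV f" "compact K" "\<And>x. x \<notin> K \<Longrightarrow> f x = 0"
  obtains B where "B > 0" "\<And>x. norm (f x) \<le> B"
proof -
  have "bounded (f ` K)"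
    by (intro compact_imp_bounded compact_continuous_image assms continuous_on_subset[OF assms(1)]) auto
  then obtain B where B: "\<And>x. x \<in> K \<Longrightarrow> norm (f x) \<le> B" unfolding bounded_iff by blast
  have "norm (f x) \<le> max B 1" for x
    using B[of x] assms(3)[of x] by (cases "x \<in> K") (auto simp: le_max_iff_disj)
  then show ?thesis using that[of "max B 1"] by auto
qed

lemma conv_integrable:
  assumes "integrable lebesgue f" "mollifier \<epsilon> \<rho>"
  shows "integrable lebesgue (\<lambda>y. f y * \<rho> (x - y))"
proof -
  note \<rho> = mollifierD[OF assms(2)]
  obtain B where B: "\<And>x. norm (\<rho> x) \<le> B"
  proof (rule bounded_continuous_compact_support[OF \<rho>(2) compact_cball[of 0 \<epsilon>]])
    show "\<rho> x = 0" if "x \<notin> cball 0 \<epsilon>" for x using \<rho>(4)[of x] that by simp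
  qed blast
  have [measurable]: "\<rho> \<in> borel_measurable borel" by (rule \<rho>)
  have m: "(\<lambda>y. \<rho> (x - y)) \<in> borel_measurable lebesgue"
    by (rule measurable_completion) measurable
  have "\<bar>f y * \<rho> (x - y)\<bar> \<le> \<bar>B * f y\<bar>" for y
    using B[of "x - y"] mult_right_mono[of "\<bar>\<rho> (x - y)\<bar>" "\<bar>B\<bar>" "\<bar>f y\<bar>"] by (simp add: abs_mult mult.commute)
  then show ?thesis
    by (intro Bochner_Integration.integrable_bound[OF integrable_mult_right[OF assms(1), of B]])
       (use assms(1) m in auto)
qed

lemma conv_cong_AE:
  assumes "f \<in> borel_measurable lebesgue" "f' \<in> borel_measurable lebesgue"
    "AE x in lebesgue. f x = f' x" "mollifier \<epsilon> \<rho>"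
  shows "conv f \<rho> x = conv f' \<rho> x"
proof -
  have [measurable]: "\<rho> \<in> borel_measurable borel" by (rule mollifierD[OF assms(4)])
  have m: "(\<lambda>y. \<rho> (x - y)) \<in> borel_measurable lebesgue"
    by (rule measurable_completion) measurable
  show ?thesis unfolding conv_def
    by (rule integral_cong_AE) (use assms m in auto)
qed

text \<open>Prepares for Tonelli's theorem, which is applied to jointly Borel measurable
  integrands.\<close>

lemma borel_version:
  fixes f :: "'a::euclidean_space \<Rightarrow> real"
  assumes "f \<in> borel_measurable lebesgue"
  obtains f' where "f' \<in> borel_measurable borel" "AE x in lebesgue. f x = f' x"
proof -
  obtain f' where f': "f' \<in> borel_measurable lborel" "AE x in lborel. f x = f' x"
    using completion_ex_borel_measurable_real[OF assms] by blast
  show ?thesis by (rule that[of f']) (use f' AE_completion in auto)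
qed

text \<open>Young's inequality with exponent one: exchange the integrals and use that every
  translate of the mollifier has integral one.\<close>

lemma conv_L1_bound:
  assumes f: "integrable lebesgue f" and \<rho>: "mollifier \<epsilon> \<rho>"
  shows "integrable lebesgue (conv f \<rho>)" "(LINT x|lebesgue. \<bar>conv f \<rho> x\<bar>) \<le> (LINT x|lebesgue. \<bar>f x\<bar>)"
proof -
  note D = mollifierD[OF \<rho>]
  have [measurable]: "\<rho> \<in> borel_measurable borel" by (rule D)
  obtain f' where [measurable]: "f' \<in> borel_measurable borel" and f': "AE x in lebesgue. f x = f' x"
    using borel_version f by blast
  have [measurable]: "f' \<in> borel_measurable lebesgue" by (rule measurable_completion) measurable
  have eq: "conv f \<rho> = (\<lambda>x. LINT y|lborel. f' y * \<rho> (x - y))"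
    using conv_cong_AE[OF _ _ f' \<rho>] f by (auto simp: conv_def integral_completion fun_eq_iff)
  have m: "conv f \<rho> \<in> borel_measurable borel" unfolding eq by measurable
  have "(\<integral>\<^sup>+x. ennreal \<bar>conv f \<rho> x\<bar> \<partial>lborel) \<le> (\<integral>\<^sup>+x. \<integral>\<^sup>+y. ennreal (\<bar>f' y\<bar> * \<rho> (x - y)) \<partial>lborel \<partial>lborel)"
  proof (rule nn_integral_mono)
    fix x
    show "ennreal \<bar>conv f \<rho> x\<bar> \<le> (\<integral>\<^sup>+y. ennreal (\<bar>f' y\<bar> * \<rho> (x - y)) \<partial>lborel)"
    \<comment> \<open>If the integrand is not integrable, its Bochner integral has the default value
      0 and the bound is trivial.\<close>
    proof (cases "integrable lborel (\<lambda>y. f' y * \<rho> (x - y))")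
      case True
      then show ?thesis unfolding eq
        using integral_norm_bound_ennreal[OF True] D(3) by (simp add: abs_mult)
    qed (simp add: eq not_integrable_integral_eq)
  qed
  also have "\<dots> = (\<integral>\<^sup>+y. \<integral>\<^sup>+x. ennreal (\<bar>f' y\<bar> * \<rho> (x - y)) \<partial>lborel \<partial>lborel)"
    by (rule lborel_pair.Fubini') measurable
  also have "\<dots> = (\<integral>\<^sup>+y. ennreal \<bar>f' y\<bar> * (\<integral>\<^sup>+x. ennreal (\<rho> (x - y)) \<partial>lborel) \<partial>lborel)"
    by (simp add: ennreal_mult D(3) nn_integral_cmult)
  also have "\<dots> = (\<integral>\<^sup>+y. ennreal \<bar>f' y\<bar> \<partial>lborel)"
    by (simp add: nn_integral_lborel_translate[of "\<lambda>x. ennreal (\<rho> x)"] D(9))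
  also have "\<dots> = (\<integral>\<^sup>+y. ennreal \<bar>f y\<bar> \<partial>lebesgue)"
    using f' by (subst nn_integral_completion[symmetric], intro nn_integral_cong_AE) auto
  also have "\<dots> = ennreal (LINT x|lebesgue. \<bar>f x\<bar>)"
    using f by (intro nn_integral_eq_integral) auto
  finally have le: "(\<integral>\<^sup>+x. ennreal \<bar>conv f \<rho> x\<bar> \<partial>lebesgue) \<le> ennreal (LINT x|lebesgue. \<bar>f x\<bar>)"
    by (simp add: nn_integral_completion)
  show int: "integrable lebesgue (conv f \<rho>)"
  proof (rule integrableI_bounded)
    show "conv f \<rho> \<in> borel_measurable lebesgue" using m by (simp add: measurable_completion)
    show "(\<integral>\<^sup>+x. ennreal (norm (conv f \<rho> x)) \<partial>lebesgue) < \<infinity>"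
      using le by (auto simp: le_less_trans)
  qed
  show "(LINT x|lebesgue. \<bar>conv f \<rho> x\<bar>) \<le> (LINT x|lebesgue. \<bar>f x\<bar>)"
  proof -
    have "ennreal (LINT x|lebesgue. \<bar>conv f \<rho> x\<bar>) \<le> ennreal (LINT x|lebesgue. \<bar>f x\<bar>)"
      using le by (subst nn_integral_eq_integral[symmetric]) (use int in auto)
    then show ?thesis by (simp add: ennreal_le_iff)
  qed
qed

lemma conv_diff:
  assumes "integrable lebesgue f" "integrable lebesgue g" "mollifier \<epsilon> \<rho>"
  shows "conv (\<lambda>x. f x - g x) \<rho> x = conv f \<rho> x - conv g \<rho> x"
  using conv_integrable[OF assms(1,3), of x] conv_integrable[OF assms(2,3), of x]
  by (simp add: conv_def left_diff_distrib)

lemma conv_eq_0: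
  assumes "\<And>y. norm (x - y) < \<epsilon> \<Longrightarrow> f y = 0" "mollifier \<epsilon> \<rho>"
  shows "conv f \<rho> x = 0"
proof -
  have "f y * \<rho> (x - y) = 0" for y
    using assms(1)[of y] mollifierD(4)[OF assms(2), of "x - y"] by (cases "norm (x - y) < \<epsilon>") auto
  then have "(\<lambda>y. f y * \<rho> (x - y)) = (\<lambda>y. 0)" by (rule ext)
  then show ?thesis unfolding conv_def by simp
qed

text \<open>As the mollifier has integral one, the difference is a weighted mean of
  \<open>g y - g x\<close> over the ball of radius \<open>\<epsilon>\<close> around
  \<open>x\<close>.\<close>

lemma conv_continuous_close:
  assumes cont: "continuous_on UNIV g" and \<rho>: "mollifier \<epsilon> \<rho>"
    and close: "\<And>y. norm (x - y) < \<epsilon> \<Longrightarrow> \<bar>g y - g x\<bar> \<le> \<omega>"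
  shows "\<bar>conv g \<rho> x - g x\<bar> \<le> \<omega>"
proof -
  note D = mollifierD[OF \<rho>]
  have [measurable]: "\<rho> \<in> borel_measurable borel" "g \<in> borel_measurable borel"
    using D continuous_on_UNIV_borel[OF cont] by auto
  have cont\<rho>: "continuous_on UNIV (\<lambda>y. \<rho> (x - y))"
    by (intro continuous_on_compose2[OF D(2)] continuous_intros) auto
  have int: "integrable lborel (\<lambda>y. h y * \<rho> (x - y))" if "continuous_on UNIV h" for h :: "_ \<Rightarrow> real"
    by (rule integrable_lborel_continuous_compact_support[OF _ compact_cball[of x \<epsilon>]])
       (use that cont\<rho> D(4) in \<open>auto intro!: continuous_intros simp: dist_norm\<close>)
  have one: "(LINT y|lborel. \<rho> (x - y)) = 1"
    by (simp add: integral_lborel_minus D(8))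
  have "conv g \<rho> x = (LINT y|lborel. g y * \<rho> (x - y))"
    by (simp add: conv_def integral_completion)
  then have "conv g \<rho> x - g x = (LINT y|lborel. g y * \<rho> (x - y)) - (LINT y|lborel. g x * \<rho> (x - y))"
    by (simp add: one)
  also have "\<dots> = (LINT y|lborel. g y * \<rho> (x - y) - g x * \<rho> (x - y))"
    by (intro Bochner_Integration.integral_diff[symmetric] int cont continuous_intros)
  also have "\<bar>\<dots>\<bar> \<le> (LINT y|lborel. \<bar>g y * \<rho> (x - y) - g x * \<rho> (x - y)\<bar>)"
    by (rule integral_abs_bound)
  also have "\<dots> \<le> (LINT y|lborel. \<omega> * \<rho> (x - y))"
  proof (rule integral_mono)
    show "integrable lborel (\<lambda>y. \<bar>g y * \<rho> (x - y) - g x * \<rho> (x - y)\<bar>)"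
      by (intro integrable_abs Bochner_Integration.integrable_diff int cont continuous_intros)
    show "integrable lborel (\<lambda>y. \<omega> * \<rho> (x - y))" by (intro int continuous_intros)
    fix y
    show "\<bar>g y * \<rho> (x - y) - g x * \<rho> (x - y)\<bar> \<le> \<omega> * \<rho> (x - y)"
      using close[of y] D(3)[of "x - y"] D(4)[of "x - y"]
      by (cases "norm (x - y) < \<epsilon>")
         (auto simp: left_diff_distrib[symmetric] abs_mult intro: mult_right_mono)
  qed
  also have "\<dots> = \<omega>" by (simp add: one)
  finally show ?thesis .
qed

text \<open>First \<open>f\<close> is truncated both in its domain and in its values. The truncation
  is an almost everywhere limit of continuous functions, but these may be unbounded and spread over
  the whole space, so they are truncated again before dominated convergence is applied.\<close>

lemma continuous_dense_L1:
  fixes f :: "'a::euclidean_space \<Rightarrow> real"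
  assumes f: "integrable lebesgue f" and \<eta>: "\<eta> > 0"
  obtains g R where "continuous_on UNIV g" "\<And>x. norm x > R \<Longrightarrow> g x = 0" "R > 0"
    "(LINT x|lebesgue. \<bar>f x - g x\<bar>) < \<eta>"
proof -
  define c where "c = (\<lambda>n :: nat. \<lambda>t. max (- real n) (min (real n) t))"
  define F where "F = (\<lambda>(n :: nat) x. indicator (cball 0 (real n)) x * c n (f x))"
  have [measurable]: "f \<in> borel_measurable lebesgue" using f by auto
  have [measurable]: "cball (0 :: 'a) r \<in> sets lebesgue" for r by auto
  have Fm: "F n \<in> borel_measurable lebesgue" for n unfolding F_def c_def by measurable
  have Fle: "\<bar>F n x\<bar> \<le> \<bar>f x\<bar>" for n x by (auto simp: F_def c_def indicator_def)
  have Fint: "integrable lebesgue (F n)" for n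
    by (rule Bochner_Integration.integrable_bound[OF integrable_abs[OF f] Fm]) (use Fle in auto)
  have "(\<lambda>n. LINT x|lebesgue. \<bar>f x - F n x\<bar>) \<longlonglongrightarrow> (LINT x|(lebesgue :: 'a measure). (0 :: real))"
  proof (rule integral_dominated_convergence[where w = "\<lambda>x. 2 * \<bar>f x\<bar>"])
    show "AE x in lebesgue. (\<lambda>n. \<bar>f x - F n x\<bar>) \<longlonglongrightarrow> 0"
    proof (intro AE_I2)
      fix x
      obtain N where N: "real N \<ge> max (norm x) \<bar>f x\<bar>" using real_arch_simple by blast
      have "eventually (\<lambda>n. \<bar>f x - F n x\<bar> = 0) sequentially"
        unfolding eventually_sequentially
        by (intro exI[of _ N]) (use N in \<open>force simp: F_def c_def indicator_def\<close>)
      then show "(\<lambda>n. \<bar>f x - F n x\<bar>) \<longlonglongrightarrow> 0" by (rule tendsto_eventually)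
    qed
    have "\<bar>f x - F n x\<bar> \<le> 2 * \<bar>f x\<bar>" for n x using Fle[of n x] by linarith
    then show "AE x in lebesgue. norm \<bar>f x - F n x\<bar> \<le> 2 * \<bar>f x\<bar>" for n by simp
  qed (use f Fm in auto)
  then have "eventually (\<lambda>n. (LINT x|lebesgue. \<bar>f x - F n x\<bar>) < \<eta> / 2) sequentially"
    using \<eta> by (intro order_tendstoD) auto
  then obtain n where n: "(LINT x|lebesgue. \<bar>f x - F n x\<bar>) < \<eta> / 2"
    by (auto simp: eventually_sequentially)
  obtain N g where N: "negligible N" and g: "\<And>k. continuous_on UNIV (g k)"
    and lim: "\<And>x. x \<notin> N \<Longrightarrow> (\<lambda>k. g k x) \<longlonglongrightarrow> F n x"
    using lebesgue_measurable_imp_measurable_on_real[OF Fm, of UNIV n] unfolding measurable_on_def by auto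
  \<comment> \<open>The first factor is a continuous cutoff, equal to 1 on the ball of radius
    \<open>n\<close> outside which \<open>F n\<close> vanishes and to 0 beyond radius
    \<open>n + 1\<close>. Clipping by \<open>c n\<close> restores a uniform bound and does not
    change the limit, because the values of \<open>F n\<close> already lie between
    \<open>- n\<close> and \<open>n\<close>.\<close>
  define G where "G = (\<lambda>k x. max 0 (min 1 (real n + 1 - norm x)) * c n (g k x))"
  have Gcont: "continuous_on UNIV (G k)" for k
    unfolding G_def c_def by (intro continuous_intros g)
  have Gm: "G k \<in> borel_measurable lebesgue" for k
    using continuous_on_UNIV_borel[OF Gcont] by (simp add: measurable_completion)
  have G0: "G k x = 0" if "norm x > real n + 1" for k x using that by (auto simp: G_def)
  have "(\<lambda>k. LINT x|lebesgue. \<bar>F n x - G k x\<bar>) \<longlonglongrightarrow> (LINT x|(lebesgue :: 'a measure). (0 :: real))"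
  proof (rule integral_dominated_convergence[where w = "\<lambda>x. (2 * real n) * indicator (cball 0 (real n + 1)) x"])
    have "(\<lambda>k. \<bar>F n x - G k x\<bar>) \<longlonglongrightarrow> 0" if "x \<notin> N" for x
    proof -
      have "(\<lambda>k. c n (g k x)) \<longlonglongrightarrow> c n (F n x)" unfolding c_def by (intro tendsto_intros lim that)
      then have "(\<lambda>k. \<bar>F n x - G k x\<bar>) \<longlonglongrightarrow> \<bar>F n x - max 0 (min 1 (real n + 1 - norm x)) * c n (F n x)\<bar>"
        unfolding G_def by (intro tendsto_intros)
      also have "\<bar>F n x - max 0 (min 1 (real n + 1 - norm x)) * c n (F n x)\<bar> = 0"
        by (auto simp: F_def c_def indicator_def)
      finally show ?thesis .
    qed
    then show "AE x in lebesgue. (\<lambda>k. \<bar>F n x - G k x\<bar>) \<longlonglongrightarrow> 0"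
      using N by (auto simp: negligible_iff_null_sets intro: AE_I')
    have cabs: "\<bar>c n t\<bar> \<le> real n" for t by (auto simp: c_def)
    have "\<bar>F n x - G k x\<bar> \<le> (2 * real n) * indicator (cball 0 (real n + 1)) x" for k x
    proof (cases "norm x \<le> real n + 1")
      case True
      have "\<bar>F n x\<bar> \<le> real n" using cabs by (auto simp: F_def indicator_def)
      moreover have "\<bar>G k x\<bar> \<le> 1 * real n"
        unfolding G_def abs_mult by (intro mult_mono cabs) auto
      ultimately show ?thesis using True by (simp add: indicator_def)
    next
      case False
      then show ?thesis using G0[of x k] by (auto simp: F_def indicator_def)
    qed
    then show "AE x in lebesgue. norm \<bar>F n x - G k x\<bar> \<le> (2 * real n) * indicator (cball 0 (real n + 1)) x" for k
      by simp
    show "integrable lebesgue (\<lambda>x :: 'a. (2 * real n) * indicator (cball 0 (real n + 1)) x)"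
      using emeasure_lborel_cball_finite[of "0 :: 'a" "real n + 1"]
      by (intro integrable_mult_right integrable_real_indicator) auto
  qed (use Fm Gm in auto)
  then have "eventually (\<lambda>k. (LINT x|lebesgue. \<bar>F n x - G k x\<bar>) < \<eta> / 2) sequentially"
    using \<eta> by (intro order_tendstoD) auto
  then obtain k where k: "(LINT x|lebesgue. \<bar>F n x - G k x\<bar>) < \<eta> / 2"
    by (auto simp: eventually_sequentially)
  have Gint: "integrable lebesgue (G k)"
    using integrable_lborel_continuous_compact_support[OF Gcont compact_cball[of 0 "real n + 1"], of k] G0
    by (simp add: integrable_completion borel_measurable_integrable)
  have "(LINT x|lebesgue. \<bar>f x - G k x\<bar>) \<le> (LINT x|lebesgue. \<bar>f x - F n x\<bar> + \<bar>F n x - G k x\<bar>)"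
    by (intro integral_mono integrable_abs Bochner_Integration.integrable_add Bochner_Integration.integrable_diff f Fint Gint) auto
  also have "\<dots> = (LINT x|lebesgue. \<bar>f x - F n x\<bar>) + (LINT x|lebesgue. \<bar>F n x - G k x\<bar>)"
    by (intro Bochner_Integration.integral_add integrable_abs Bochner_Integration.integrable_diff f Fint Gint)
  also have "\<dots> < \<eta>" using n k by simp
  finally show ?thesis using that[of "G k" "real n + 1"] Gcont G0 by auto
qed

lemma Ck_1_GDERIV: "Ck 1 f \<Longrightarrow> GDERIV f x :> gradient f x"
  by (metis Ck_GDERIV One_nat_def)

text \<open>A three-term estimate: replacing \<open>f\<close> by a compactly supported continuous
  \<open>g\<close> costs less than \<open>\<eta> / 3\<close> before and after convolution, because
  convolution contracts the L1 norm, and for \<open>g\<close> itself uniform continuity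
  suffices.\<close>

lemma mollification_L1:
  fixes f :: "real^'n \<Rightarrow> real"
  assumes f: "integrable lebesgue f" and \<eta>: "\<eta> > 0"
  obtains d where "d > 0"
    "\<And>\<epsilon> \<rho>. 0 < \<epsilon> \<Longrightarrow> \<epsilon> \<le> d \<Longrightarrow> mollifier \<epsilon> \<rho> \<Longrightarrow> (LINT x|lebesgue. \<bar>conv f \<rho> x - f x\<bar>) < \<eta>"
proof -
  obtain g R where g: "continuous_on UNIV g" and R: "\<And>x. norm x > R \<Longrightarrow> g x = 0" "R > 0"
    and fg: "(LINT x|lebesgue. \<bar>f x - g x\<bar>) < \<eta> / 3"
    using continuous_dense_L1[OF f, of "\<eta> / 3"] \<eta> by auto
  define v where "v = measure lebesgue (cball (0 :: real^'n) (R + 1))"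
  have v: "v \<ge> 0" by (simp add: v_def)
  \<comment> \<open>The permitted pointwise error, to be integrated over a ball of volume
    \<open>v\<close>; the 1 in the denominator avoids division by zero and gives a strict
    inequality.\<close>
  define \<omega> where "\<omega> = \<eta> / (3 * (v + 1))"
  have \<omega>: "\<omega> > 0" "\<omega> * v < \<eta> / 3" using \<eta> v by (auto simp: \<omega>_def field_simps)
  \<comment> \<open>For mollifiers of radius at most 1 the mollified \<open>g\<close> vanishes
    outside radius \<open>R + 1\<close>, and inside that radius its values involve \<open>g\<close>
    only up to radius \<open>R + 2\<close>.\<close>
  have "uniformly_continuous_on (cball 0 (R + 2)) g"
    by (intro compact_uniformly_continuous continuous_on_subset[OF g]) auto
  then obtain d where d: "d > 0"
    "\<And>x y. x \<in> cball 0 (R + 2) \<Longrightarrow> y \<in> cball 0 (R + 2) \<Longrightarrow> dist y x < d \<Longrightarrow> dist (g y) (g x) < \<omega>"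
    using \<omega> unfolding uniformly_continuous_on_def by blast
  have gint: "integrable lebesgue g"
    using integrable_lborel_continuous_compact_support[OF g compact_cball[of 0 R]] R
    by (simp add: integrable_completion borel_measurable_integrable)
  show ?thesis
  proof (rule that[of "min d 1"])
    fix \<epsilon> and \<rho> :: "real^'n \<Rightarrow> real"
    assume \<epsilon>: "0 < \<epsilon>" "\<epsilon> \<le> min d 1" and \<rho>: "mollifier \<epsilon> \<rho>"
    note fgint = Bochner_Integration.integrable_diff[OF f gint]
    note c1 = conv_L1_bound[OF fgint \<rho>] and c2 = conv_L1_bound[OF gint \<rho>]
    have pt: "\<bar>conv g \<rho> x - g x\<bar> \<le> \<omega> * indicator (cball 0 (R + 1)) x" for x
    proof (cases "x \<in> cball 0 (R + 1)")
      case True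
      have "\<bar>conv g \<rho> x - g x\<bar> \<le> \<omega>"
      proof (rule conv_continuous_close[OF g \<rho>])
        fix y assume y: "norm (x - y) < \<epsilon>"
        have "norm y \<le> norm x + norm (x - y)" by (metis norm_minus_commute norm_triangle_sub)
        then have "dist (g y) (g x) < \<omega>"
          using y \<epsilon> True by (intro d) (auto simp: dist_norm norm_minus_commute)
        then show "\<bar>g y - g x\<bar> \<le> \<omega>" by (simp add: dist_real_def)
      qed
      then show ?thesis using True by simp
    next
      case False
      have "conv g \<rho> x = 0"
      proof (rule conv_eq_0[OF _ \<rho>])
        fix y assume "norm (x - y) < \<epsilon>"
        moreover have "norm x \<le> norm y + norm (x - y)" by (metis norm_triangle_sub)
        ultimately show "g y = 0" using False \<epsilon> by (intro R) auto
      qed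
      then show ?thesis using False R(1)[of x] by simp
    qed
    have "(LINT x|lebesgue. \<bar>conv g \<rho> x - g x\<bar>) \<le> (LINT x|lebesgue. \<omega> * indicator (cball (0 :: real^'n) (R + 1)) x)"
      using emeasure_lborel_cball_finite[of "0 :: real^'n" "R + 1"]
      by (intro integral_mono pt integrable_abs Bochner_Integration.integrable_diff c2 gint
          integrable_mult_right integrable_real_indicator) auto
    also have "\<dots> = \<omega> * v" by (simp add: v_def)
    finally have gg: "(LINT x|lebesgue. \<bar>conv g \<rho> x - g x\<bar>) < \<eta> / 3" using \<omega> by simp
    have "(LINT x|lebesgue. \<bar>conv f \<rho> x - f x\<bar>) \<le>
      (LINT x|lebesgue. \<bar>conv (\<lambda>x. f x - g x) \<rho> x\<bar> + (\<bar>conv g \<rho> x - g x\<bar> + \<bar>f x - g x\<bar>))"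
      by (intro integral_mono integrable_abs Bochner_Integration.integrable_add
          Bochner_Integration.integrable_diff c1 c2 f gint conv_L1_bound[OF f \<rho>])
         (auto simp: conv_diff[OF f gint \<rho>])
    also have "\<dots> = (LINT x|lebesgue. \<bar>conv (\<lambda>x. f x - g x) \<rho> x\<bar>) +
        ((LINT x|lebesgue. \<bar>conv g \<rho> x - g x\<bar>) + (LINT x|lebesgue. \<bar>f x - g x\<bar>))"
      using c1(1) c2(1) fgint gint by simp
    also have "\<dots> < \<eta>" using c1(2) gg fg by linarith
    finally show "(LINT x|lebesgue. \<bar>conv f \<rho> x - f x\<bar>) < \<eta>" .
  qed (use d in auto)
qed

text \<open>The derivative is put on \<open>\<rho>\<close>, since \<open>u\<close> is only
  continuous. The compact support of \<open>u\<close> reduces the convolution to an integral over a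
  fixed box, where the Leibniz rule for parameter integrals applies.\<close>

lemma GDERIV_conv:
  fixes u \<rho> :: "real^'n \<Rightarrow> real"
  assumes u: "continuous_on UNIV u" and R: "\<And>x. norm x > R \<Longrightarrow> u x = 0" and \<rho>: "Ck 1 \<rho>"
  shows "GDERIV (conv u \<rho>) x :> (\<chi> i. conv u (\<lambda>z. gradient \<rho> z $ i) x)"
proof -
  obtain a :: "real^'n" where a: "cball 0 R \<subseteq> cbox (- a) a"
    using bounded_subset_cbox_symmetric[OF bounded_cball] by blast
  \<comment> \<open>The kernel is kept general because this is used both for \<open>\<rho>\<close>
    and for its partial derivatives.\<close>
  have conv_eq: "((\<lambda>t. u t * \<sigma> (x - t)) has_integral conv u \<sigma> x) (cbox (- a) a)"
    if \<sigma>: "continuous_on UNIV \<sigma>" for \<sigma> :: "real^'n \<Rightarrow> real" and x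
  proof -
    have c: "continuous_on UNIV (\<lambda>t. u t * \<sigma> (x - t))"
      by (intro continuous_intros u continuous_on_compose2[OF \<sigma>]) auto
    have "integrable lborel (\<lambda>t. u t * \<sigma> (x - t))"
      by (rule integrable_lborel_continuous_compact_support[OF c compact_cball[of 0 R]]) (use R in auto)
    then have "((\<lambda>t. u t * \<sigma> (x - t)) has_integral (LINT t|lborel. u t * \<sigma> (x - t))) UNIV"
      by (rule has_integral_integral_lborel)
    moreover have "conv u \<sigma> x = (LINT t|lborel. u t * \<sigma> (x - t))"
      using continuous_on_UNIV_borel[OF c] by (simp add: conv_def integral_completion)
    ultimately have "((\<lambda>t. u t * \<sigma> (x - t)) has_integral conv u \<sigma> x) UNIV" by simp
    then have "((\<lambda>t. if t \<in> cbox (- a) a then u t * \<sigma> (x - t) else 0) has_integral conv u \<sigma> x) UNIV"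
      by (rule has_integral_eq[rotated]) (use R a in \<open>force simp: subset_eq not_le\<close>)
    then show ?thesis by (simp only: has_integral_restrict_UNIV)
  qed
  have \<rho>c: "continuous_on UNIV \<rho>" using Ck_continuous[OF \<rho>] .
  have grc: "continuous_on UNIV (\<lambda>z. gradient \<rho> z $ i)" for i
    using \<rho> by simp
  have gc: "continuous_on UNIV (gradient \<rho>)"
    using continuous_on_vec_lambda[of UNIV "\<lambda>i z. gradient \<rho> z $ i"] grc by simp
  \<comment> \<open>The derivative in the parameter, packaged as a bounded linear map so that it can
    itself be integrated.\<close>
  define fx :: "real^'n \<Rightarrow> real^'n \<Rightarrow> (real^'n) \<Rightarrow>\<^sub>L real"
    where "fx = (\<lambda>x t. blinfun_inner_left (u t *\<^sub>R gradient \<rho> (x - t)))"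
  have "((\<lambda>x. integral (cbox (- a) a) (\<lambda>t. u t * \<rho> (x - t))) has_derivative
     blinfun_apply (integral (cbox (- a) a) (fx x))) (at x within UNIV)"
  proof (rule leibniz_rule)
    fix x t :: "real^'n"
    have "GDERIV (\<lambda>x. \<rho> (x - t)) x :> gradient \<rho> (x - t)"
      by (intro GDERIV_translate Ck_1_GDERIV \<rho>)
    then have "((\<lambda>x. u t * \<rho> (x - t)) has_derivative (\<lambda>h. u t * inner h (gradient \<rho> (x - t)))) (at x)"
      unfolding gderiv_def by (intro has_derivative_mult_right)
    then show "((\<lambda>x. u t * \<rho> (x - t)) has_derivative blinfun_apply (fx x t)) (at x within UNIV)"
      by (simp add: fx_def)
    show "(\<lambda>t. u t * \<rho> (x - t)) integrable_on cbox (- a) a"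
      using conv_eq[OF \<rho>c] by blast
  next
    have "continuous_on (UNIV \<times> cbox (- a) a) (\<lambda>p. blinfun_inner_left (u (snd p) *\<^sub>R gradient \<rho> (fst p - snd p)))"
      by (intro bounded_linear.continuous_on[OF bounded_linear_blinfun_inner_left] continuous_intros
          continuous_on_compose2[OF u] continuous_on_compose2[OF gc]) auto
    then show "continuous_on (UNIV \<times> cbox (- a) a) (\<lambda>(x, t). fx x t)"
      by (simp add: fx_def case_prod_beta)
  qed auto
  moreover have "(\<lambda>x. integral (cbox (- a) a) (\<lambda>t. u t * \<rho> (x - t))) = conv u \<rho>"
    using conv_eq[OF \<rho>c] by (auto intro: integral_unique)
  moreover have "blinfun_apply (integral (cbox (- a) a) (fx x)) = (\<lambda>h. inner h (\<chi> i. conv u (\<lambda>z. gradient \<rho> z $ i) x))"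
  proof
    fix h
    have "continuous_on (cbox (- a) a) (fx x)" unfolding fx_def
      by (intro bounded_linear.continuous_on[OF bounded_linear_blinfun_inner_left] continuous_intros
          continuous_on_compose2[OF u] continuous_on_compose2[OF gc]) auto
    then have "fx x integrable_on cbox (- a) a" by (rule integrable_continuous)
    then have "blinfun_apply (integral (cbox (- a) a) (fx x)) h = integral (cbox (- a) a) (\<lambda>t. blinfun_apply (fx x t) h)"
      by (rule blinfun_apply_integral)
    also have "(\<lambda>t. blinfun_apply (fx x t) h) = (\<lambda>t. \<Sum>i\<in>UNIV. h $ i * (u t * gradient \<rho> (x - t) $ i))"
      by (simp add: fx_def inner_vec_def sum_distrib_left algebra_simps)
    also have "integral (cbox (- a) a) \<dots> = (\<Sum>i\<in>UNIV. h $ i * conv u (\<lambda>z. gradient \<rho> z $ i) x)"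
      by (intro integral_unique has_integral_sum has_integral_mult_right conv_eq grc) auto
    finally show "blinfun_apply (integral (cbox (- a) a) (fx x)) h = inner h (\<chi> i. conv u (\<lambda>z. gradient \<rho> z $ i) x)"
      by (simp add: inner_vec_def)
  qed
  ultimately show ?thesis by (simp add: gderiv_def)
qed

text \<open>A partial derivative of the convolution is again a convolution of \<open>u\<close>, with
  a partial derivative of \<open>\<rho>\<close>; hence the induction is over all smooth kernels
  simultaneously.\<close>

lemma Ck_conv:
  fixes u \<rho> :: "real^'n \<Rightarrow> real"
  assumes u: "continuous_on UNIV u" and R: "\<And>x. norm x > R \<Longrightarrow> u x = 0" and \<rho>: "\<And>k. Ck k \<rho>"
  shows "Ck k (conv u \<rho>)"
proof -
  have "\<forall>\<rho>. (\<forall>k. Ck k \<rho>) \<longrightarrow> Ck (Suc k) (conv u \<rho>)" for k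
  proof (induction k)
    case 0
    show ?case
    proof (intro allI impI)
      fix \<rho> :: "real^'n \<Rightarrow> real" assume \<rho>: "\<forall>k. Ck k \<rho>"
      have grad: "\<forall>k. Ck k (\<lambda>z. gradient \<rho> z $ i)" for i using \<rho> Ck.simps(2) by blast
      show "Ck (Suc 0) (conv u \<rho>)"
      proof (rule Ck_SucI)
        show "GDERIV (conv u \<rho>) x :> (\<chi> i. conv u (\<lambda>z. gradient \<rho> z $ i) x)" for x
          using \<rho> by (intro GDERIV_conv u R) auto
        fix i
        have "GDERIV (conv u (\<lambda>z. gradient \<rho> z $ i)) x :> (\<chi> j. conv u (\<lambda>z. gradient (\<lambda>z. gradient \<rho> z $ i) z $ j) x)" for x
          using grad by (intro GDERIV_conv u R) auto
        then have "continuous_on UNIV (conv u (\<lambda>z. gradient \<rho> z $ i))"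
          unfolding gderiv_def by (intro differentiable_imp_continuous_on) (auto simp: differentiable_on_def differentiable_def)
        then show "Ck 0 (\<lambda>x. (\<chi> i. conv u (\<lambda>z. gradient \<rho> z $ i) x) $ i)" by simp
      qed
    qed
  next
    case (Suc k)
    show ?case
    proof (intro allI impI)
      fix \<rho> :: "real^'n \<Rightarrow> real" assume \<rho>: "\<forall>k. Ck k \<rho>"
      have grad: "\<forall>k. Ck k (\<lambda>z. gradient \<rho> z $ i)" for i using \<rho> Ck.simps(2) by blast
      show "Ck (Suc (Suc k)) (conv u \<rho>)"
      proof (rule Ck_SucI)
        show "GDERIV (conv u \<rho>) x :> (\<chi> i. conv u (\<lambda>z. gradient \<rho> z $ i) x)" for x
          using \<rho> by (intro GDERIV_conv u R) auto
        show "Ck (Suc k) (\<lambda>x. (\<chi> i. conv u (\<lambda>z. gradient \<rho> z $ i) x) $ i)" for i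
          using Suc grad by (simp del: Ck.simps)
      qed
    qed
  qed
  then show ?thesis using \<rho> Ck_SucD by blast
qed

section \<open>Integration by parts\<close>

lemma GDERIV_zero_outside:
  fixes f :: "real^'n \<Rightarrow> real"
  assumes "closed K" "\<And>x. x \<notin> K \<Longrightarrow> f x = 0" "x \<notin> K"
  shows "GDERIV f x :> 0"
proof -
  have "((\<lambda>x. 0) has_derivative (\<lambda>h. 0)) (at x)" by simp
  then have "(f has_derivative (\<lambda>h. 0)) (at x)"
    by (rule has_derivative_transform_within_open[where s = "- K"]) (use assms in auto)
  then show ?thesis by (simp add: gderiv_def)
qed

text \<open>By translation invariance every difference quotient of \<open>w\<close> has integral
  zero. A gradient bound makes \<open>w\<close> Lipschitz, so the quotients are uniformly bounded
  and dominated convergence carries the identity to the derivative.\<close>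

lemma integral_gradient_eq_0:
  fixes w :: "real^'n \<Rightarrow> real"
  assumes w: "Ck 1 w" and K: "compact K" and w0: "\<And>x. x \<notin> K \<Longrightarrow> w x = 0"
  shows "(LINT x|lborel. gradient w x $ i) = 0"
proof -
  have wc: "continuous_on UNIV w" using Ck_continuous[OF w] .
  have [measurable]: "w \<in> borel_measurable borel" using wc by (rule continuous_on_UNIV_borel)
  have gic: "continuous_on UNIV (\<lambda>z. gradient w z $ i)" for i using w by simp
  have gc: "continuous_on UNIV (gradient w)"
    using continuous_on_vec_lambda[of UNIV "\<lambda>i z. gradient w z $ i"] gic by simp
  have gd: "GDERIV w x :> gradient w x" for x by (intro Ck_1_GDERIV w)
  have g0: "gradient w x = 0" if "x \<notin> K" for x
    by (rule gradient_eqI[OF GDERIV_zero_outside[OF compact_imp_closed[OF K] w0 that]])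
  obtain B where B: "B > 0" "\<And>x. norm (gradient w x) \<le> B"
    using bounded_continuous_compact_support[OF gc K g0] by blast
  have lip: "norm (w x - w y) \<le> B * norm (x - y)" for x y
  proof (rule differentiable_bound[OF convex_UNIV])
    show "(w has_derivative (\<lambda>h. inner h (gradient w z))) (at z within UNIV)" for z
      using gd by (simp add: gderiv_def)
    show "onorm (\<lambda>h. inner h (gradient w z)) \<le> B" for z
    proof (rule onorm_bound)
      show "norm (inner h (gradient w z)) \<le> B * norm h" for h
        using Cauchy_Schwarz_ineq2[of h "gradient w z"] mult_right_mono[OF B(2)[of z], of "norm h"]
        by (simp add: mult.commute)
    qed (use B in auto)
  qed auto
  define e :: "real^'n" where "e = axis i 1"
  \<comment> \<open>The step sizes are at most 1, so all quotients vanish outside the unit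
    neighbourhood \<open>K'\<close> of \<open>K\<close>, which provides the common dominant.\<close>
  define D where "D = (\<lambda>(n :: nat) x. (w (x + inverse (real (Suc n)) *\<^sub>R e) - w x) / inverse (real (Suc n)))"
  define K' where "K' = {x + y | x y. x \<in> K \<and> y \<in> cball 0 1}"
  have K': "compact K'" unfolding K'_def by (intro compact_sums K compact_cball)
  have ne: "norm e = 1" by (simp add: e_def)
  have D0: "D n x = 0" if "x \<notin> K'" for n x
  proof -
    have "x = x + 0" "x = (x + inverse (real (Suc n)) *\<^sub>R e) + (- (inverse (real (Suc n)) *\<^sub>R e))" by auto
    moreover have "- (inverse (real (Suc n)) *\<^sub>R e) \<in> cball 0 1" using ne by (simp add: field_simps)
    ultimately have "x \<notin> K" "x + inverse (real (Suc n)) *\<^sub>R e \<notin> K"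
      using that unfolding K'_def by (fastforce, blast)
    then show ?thesis using w0 by (simp add: D_def)
  qed
  have Dle: "\<bar>D n x\<bar> \<le> B * indicator K' x" for n x
  proof (cases "x \<in> K'")
    case True
    have "\<bar>w (x + inverse (real (Suc n)) *\<^sub>R e) - w x\<bar> \<le> B * inverse (real (Suc n))"
      using lip[of "x + inverse (real (Suc n)) *\<^sub>R e" x] ne by simp
    then have "\<bar>w (x + inverse (real (Suc n)) *\<^sub>R e) - w x\<bar> / inverse (real (Suc n)) \<le> B"
      by (subst pos_divide_le_eq) auto
    then show ?thesis using True by (simp add: D_def abs_divide)
  qed (use D0 in auto)
  have "(\<lambda>n. LINT x|lborel. D n x) \<longlonglongrightarrow> (LINT x|lborel. gradient w x $ i)"
  proof (rule integral_dominated_convergence[where w = "\<lambda>x. B * indicator K' x"])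
    show "(\<lambda>x. gradient w x $ i) \<in> borel_measurable lborel"
      using continuous_on_UNIV_borel[OF gic] by simp
    show "D n \<in> borel_measurable lborel" for n unfolding D_def by measurable
    show "integrable lborel (\<lambda>x. B * indicator K' x)"
      using emeasure_compact_finite[OF K'] K'
      by (intro integrable_mult_right integrable_real_indicator) (auto simp: borel_compact)
    show "AE x in lborel. norm (D n x) \<le> B * indicator K' x" for n using Dle by simp
    have "(\<lambda>n. D n x) \<longlonglongrightarrow> gradient w x $ i" for x
    proof -
      have d: "((\<lambda>t. w (x + t *\<^sub>R e)) has_derivative (\<lambda>s. inner (s *\<^sub>R e) (gradient w x))) (at 0)"
        by (rule has_derivative_compose[where f = "\<lambda>t. x + t *\<^sub>R e" and g = w])
           (use gd in \<open>auto simp: gderiv_def intro!: derivative_eq_intros\<close>)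
      have "(\<lambda>s. inner (s *\<^sub>R e) (gradient w x)) = (*) (gradient w x $ i)"
        by (auto simp: e_def inner_axis' fun_eq_iff)
      with d have "DERIV (\<lambda>t. w (x + t *\<^sub>R e)) 0 :> gradient w x $ i"
        by (simp add: has_field_derivative_def)
      then have lim: "((\<lambda>t. (w (x + t *\<^sub>R e) - w x) / t) \<longlongrightarrow> gradient w x $ i) (at 0)"
        by (simp add: DERIV_def)
      have "filterlim (\<lambda>n. inverse (real (Suc n))) (at 0) sequentially"
        unfolding filterlim_at using LIMSEQ_inverse_real_of_nat by auto
      then show ?thesis unfolding D_def by (rule filterlim_compose[OF lim])
    qed
    then show "AE x in lborel. (\<lambda>n. D n x) \<longlonglongrightarrow> gradient w x $ i" by simp
  qed
  moreover have "(LINT x|lborel. D n x) = 0" for n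
  proof -
    have wi: "integrable lborel (\<lambda>x. w (x + y))" for y
    proof (rule integrable_lborel_continuous_compact_support)
      show "continuous_on UNIV (\<lambda>x. w (x + y))" by (intro continuous_on_compose2[OF wc] continuous_intros) auto
      show "compact ((\<lambda>x. x - y) ` K)" using K by (intro compact_continuous_image continuous_intros)
      show "w (x + y) = 0" if "x \<notin> (\<lambda>x. x - y) ` K" for x
        using that by (intro w0) (auto simp: image_iff)
    qed
    have "(LINT x|lborel. w (x - (- (inverse (real (Suc n)) *\<^sub>R e)))) = (LINT x|lborel. w x)"
      by (rule integral_lborel_translate) measurable
    then show ?thesis unfolding D_def using wi[of 0] wi[of "inverse (real (Suc n)) *\<^sub>R e"] by simp
  qed
  ultimately show ?thesis by (simp add: LIMSEQ_const_iff)
qed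

text \<open>The product rule for \<open>u x * \<phi> x\<close>, which inherits compact support from
  \<open>\<phi>\<close>.\<close>

lemma integration_by_parts:
  fixes u \<phi> :: "real^'n \<Rightarrow> real"
  assumes u: "Ck 1 u" and \<phi>: "Ck 1 \<phi>" and K: "compact K" "\<And>x. x \<notin> K \<Longrightarrow> \<phi> x = 0"
  shows "(LINT x|lborel. u x * gradient \<phi> x $ i) = - (LINT x|lborel. gradient u x $ i * \<phi> x)"
proof -
  have g: "gradient (\<lambda>x. u x * \<phi> x) x = u x *\<^sub>R gradient \<phi> x + \<phi> x *\<^sub>R gradient u x" for x
    by (intro gradient_eqI GDERIV_mult Ck_1_GDERIV u \<phi>)
  have c: "continuous_on UNIV u" "continuous_on UNIV \<phi>"
    "continuous_on UNIV (\<lambda>x. gradient u x $ i)" "continuous_on UNIV (\<lambda>x. gradient \<phi> x $ i)"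
    using Ck_continuous[OF u] Ck_continuous[OF \<phi>] u \<phi> by simp_all
  have g0: "gradient \<phi> x = 0" if "x \<notin> K" for x
    by (rule gradient_eqI[OF GDERIV_zero_outside[OF compact_imp_closed[OF K(1)] K(2) that]])
  have "integrable lborel (\<lambda>x. u x * gradient \<phi> x $ i)" "integrable lborel (\<lambda>x. gradient u x $ i * \<phi> x)"
    by (rule integrable_lborel_continuous_compact_support[OF _ K(1)];
        use K(2) g0 c in \<open>auto intro!: continuous_intros\<close>)+
  moreover have "(LINT x|lborel. gradient (\<lambda>x. u x * \<phi> x) x $ i) = 0"
    by (rule integral_gradient_eq_0[OF Ck_mult[OF u \<phi>] K(1)]) (simp add: K(2))
  moreover have "(\<lambda>x. gradient (\<lambda>x. u x * \<phi> x) x $ i) = (\<lambda>x. u x * gradient \<phi> x $ i + gradient u x $ i * \<phi> x)"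
    by (auto simp: g fun_eq_iff)
  ultimately show ?thesis by (simp add: eq_neg_iff_add_eq_0)
qed

section \<open>Weak gradients\<close>

lemma open_lebesgue: "open S \<Longrightarrow> S \<in> sets lebesgue"
  by simp

lemma integral_lebesgue_on_eq:
  fixes F :: "'a::euclidean_space \<Rightarrow> 'b::{banach, second_countable_topology}"
  assumes "S \<in> sets lebesgue" "\<And>x. x \<notin> S \<Longrightarrow> F x = 0"
  shows "integral\<^sup>L (lebesgue_on S) F = integral\<^sup>L lebesgue F"
    "integrable (lebesgue_on S) F \<longleftrightarrow> integrable lebesgue F"
proof -
  have "(\<lambda>x. indicator S x *\<^sub>R F x) = F" using assms(2) by (auto simp: indicator_def)
  then show "integral\<^sup>L (lebesgue_on S) F = integral\<^sup>L lebesgue F"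
    "integrable (lebesgue_on S) F \<longleftrightarrow> integrable lebesgue F"
    using assms(1) by (simp_all add: integral_restrict_space integrable_restrict_space)
qed

text \<open>A set that is negligible near each of its points is negligible, by a Lindelof argument.
  Almost everywhere claims can thus be proved on small balls.\<close>

lemma AE_lebesgue_on_local:
  fixes S :: "'a::euclidean_space set"
  assumes S: "S \<in> sets lebesgue"
    and loc: "\<And>x. x \<in> S \<Longrightarrow> \<exists>r>0. AE y in lebesgue. y \<in> ball x r \<longrightarrow> P y"
  shows "AE x in lebesgue_on S. P x"
proof -
  have "negligible {x \<in> S. \<not> P x}"
  proof (rule locally_negligible_alt[THEN iffD2], rule ballI)
    fix x assume x: "x \<in> {x \<in> S. \<not> P x}"
    then have "x \<in> S" by simp
    from loc[OF this] obtain r where r: "r > 0" "AE y in lebesgue. y \<in> ball x r \<longrightarrow> P y" by (elim exE conjE)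
    from r(2) obtain N where N: "N \<in> null_sets lebesgue" "{y \<in> space lebesgue. \<not> (y \<in> ball x r \<longrightarrow> P y)} \<subseteq> N"
      unfolding eventually_ae_filter by (elim bexE)
    have "negligible ({x \<in> S. \<not> P x} \<inter> ball x r)"
      by (rule negligible_subset[of N]) (use N in \<open>auto simp: negligible_iff_null_sets\<close>)
    then show "\<exists>U. openin (top_of_set {x \<in> S. \<not> P x}) U \<and> x \<in> U \<and> negligible U"
      using x r(1) by (intro exI[of _ "{x \<in> S. \<not> P x} \<inter> ball x r"]) auto
  qed
  then have "AE x in lebesgue. x \<notin> {x \<in> S. \<not> P x}"
    by (intro AE_not_in) (simp add: negligible_iff_null_sets)
  then show ?thesis
    using S by (subst AE_restrict_space_iff) auto
qed

lemma L1_loc_integrable_on: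
  assumes "f \<in> L1_loc \<Omega>" "compact K" "K \<subseteq> \<Omega>"
  shows "integrable lebesgue (\<lambda>x. indicator K x *\<^sub>R f x)"
  using assms unfolding L1_loc_def by (auto simp: integrable_restrict_space lmeasurable_compact fmeasurableD)

text \<open>\<open>L1_loc\<close> speaks only about compact subsets. Measurability on the open set
  comes from a compact exhaustion, along which the truncations are eventually constant at each
  point.\<close>

lemma L1_loc_borel_measurable:
  fixes f :: "real^'n \<Rightarrow> 'b::euclidean_space"
  assumes "f \<in> L1_loc \<Omega>" "open \<Omega>"
  shows "f \<in> borel_measurable (lebesgue_on \<Omega>)"
proof -
  obtain C where C: "\<And>n. compact (C n)" "\<And>n. C n \<subseteq> \<Omega>" "\<And>n. C n \<subseteq> interior (C (Suc n))"
    "\<Union>(range C) = \<Omega>"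
    "\<And>K. compact K \<Longrightarrow> K \<subseteq> \<Omega> \<Longrightarrow> \<exists>N. \<forall>n\<ge>N. K \<subseteq> C n"
    by (rule open_Union_compact_subsets[OF assms(2)]) iprover
  have "(\<lambda>x. indicator \<Omega> x *\<^sub>R f x) \<in> borel_measurable lebesgue"
  proof (rule borel_measurable_LIMSEQ_metric)
    show "(\<lambda>x. indicator (C n) x *\<^sub>R f x) \<in> borel_measurable lebesgue" for n
      using L1_loc_integrable_on[OF assms(1) C(1,2)] by auto
    show "(\<lambda>n. indicator (C n) x *\<^sub>R f x) \<longlonglongrightarrow> indicator \<Omega> x *\<^sub>R f x" for x
    proof (cases "x \<in> \<Omega>")
      case True
      then obtain N where "\<forall>n\<ge>N. x \<in> C n" using C(5)[of "{x}"] by auto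
      then show ?thesis using True
        by (intro tendsto_eventually eventually_sequentiallyI[of N]) auto
    next
      case False
      then have "x \<notin> C n" for n using C(2) by blast
      then show ?thesis using False by simp
    qed
  qed
  then show ?thesis using assms(2) by (subst borel_measurable_restrict_space_iff) auto
qed

lemma L1_loc_mult_integrable:
  fixes f :: "real^'n \<Rightarrow> real"
  assumes f: "f \<in> L1_loc \<Omega>" and \<Omega>: "open \<Omega>" and \<phi>: "continuous_on UNIV \<phi>"
    and K: "compact K" "K \<subseteq> \<Omega>" "\<And>x. x \<notin> K \<Longrightarrow> \<phi> x = 0"
  shows "integrable lebesgue (\<lambda>x. f x * \<phi> x)" "integrable (lebesgue_on \<Omega>) (\<lambda>x. f x * \<phi> x)"
proof -
  obtain B where B: "B > 0" "\<And>x. norm (\<phi> x) \<le> B"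
    using bounded_continuous_compact_support[OF \<phi> K(1,3)] by blast
  have [measurable]: "\<phi> \<in> borel_measurable lebesgue"
    using continuous_on_UNIV_borel[OF \<phi>] by (simp add: measurable_completion)
  note int = L1_loc_integrable_on[OF f K(1,2)]
  have "integrable lebesgue (\<lambda>x. indicator K x *\<^sub>R f x * \<phi> x)"
  proof (rule Bochner_Integration.integrable_bound[OF integrable_mult_left[OF int, of B]])
    have "\<bar>indicator K x *\<^sub>R f x * \<phi> x\<bar> \<le> \<bar>indicator K x *\<^sub>R f x * B\<bar>" for x
      unfolding abs_mult using B by (intro mult_left_mono) (auto intro: order_trans)
    then show "AE x in lebesgue. norm (indicator K x *\<^sub>R f x * \<phi> x) \<le> norm (indicator K x *\<^sub>R f x * B)" by simp
    show "(\<lambda>x. indicator K x *\<^sub>R f x * \<phi> x) \<in> borel_measurable lebesgue"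
      using borel_measurable_integrable[OF int] by measurable
  qed
  moreover have "(\<lambda>x. indicator K x *\<^sub>R f x * \<phi> x) = (\<lambda>x. f x * \<phi> x)"
    using K(3) by (auto simp: indicator_def fun_eq_iff)
  ultimately show "integrable lebesgue (\<lambda>x. f x * \<phi> x)" by simp
  then show "integrable (lebesgue_on \<Omega>) (\<lambda>x. f x * \<phi> x)"
    using K \<Omega> by (subst integral_lebesgue_on_eq(2)) (auto simp: subset_eq)
qed

section \<open>The fundamental lemma of the calculus of variations\<close>

lemma Cc_inftyD:
  assumes "\<phi> \<in> Cc_infty \<Omega>"
  shows "Ck k \<phi>" "compact (closure {x. \<phi> x \<noteq> 0})" "closure {x. \<phi> x \<noteq> 0} \<subseteq> \<Omega>"
    "x \<notin> closure {x. \<phi> x \<noteq> 0} \<Longrightarrow> \<phi> x = 0"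
    "x \<notin> closure {x. \<phi> x \<noteq> 0} \<Longrightarrow> gradient \<phi> x = 0"
    "continuous_on UNIV \<phi>" "continuous_on UNIV (\<lambda>x. gradient \<phi> x $ i)"
proof -
  show *: "Ck k \<phi>" "compact (closure {x. \<phi> x \<noteq> 0})" "closure {x. \<phi> x \<noteq> 0} \<subseteq> \<Omega>" for k
    using assms by (auto simp: Cc_infty_def compactly_inside_def)
  show z: "x \<notin> closure {x. \<phi> x \<noteq> 0} \<Longrightarrow> \<phi> x = 0" for x
    using closure_subset[of "{x. \<phi> x \<noteq> 0}"] by blast
  show "x \<notin> closure {x. \<phi> x \<noteq> 0} \<Longrightarrow> gradient \<phi> x = 0"
    by (rule gradient_eqI[OF GDERIV_zero_outside[OF closed_closure z]])
  show "continuous_on UNIV \<phi>" using Ck_continuous[OF *(1)] .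
  show "continuous_on UNIV (\<lambda>x. gradient \<phi> x $ i)" using *(1)[of 1] by simp
qed

text \<open>Lets the value of a convolution at \<open>x\<close> be read as the pairing with a test
  function.\<close>

lemma Cc_infty_reflected_mollifier:
  assumes "mollifier \<epsilon> \<rho>" "cball x \<epsilon> \<subseteq> \<Omega>"
  shows "(\<lambda>y. \<rho> (x - y)) \<in> Cc_infty \<Omega>"
proof -
  have "{y. \<rho> (x - y) \<noteq> 0} \<subseteq> cball x \<epsilon>"
    using assms(1) by (auto simp: mollifier_def dist_norm)
  then have "closure {y. \<rho> (x - y) \<noteq> 0} \<subseteq> cball x \<epsilon>" by (rule closure_minimal) simp
  then have "compactly_inside {y. \<rho> (x - y) \<noteq> 0} \<Omega>"
    unfolding compactly_inside_def using assms(2)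
    by (meson closed_closure compact_cball compact_closure bounded_subset bounded_cball closure_subset order_trans)
  then show ?thesis using mollifierD(1)[OF assms(1)] by (simp add: Cc_infty_def Ck_reflect)
qed

text \<open>Reflected mollifiers are test functions, so the hypothesis says that the mollifications
  of \<open>f\<close> vanish near \<open>x0\<close>; on the other hand they converge to
  \<open>f\<close> in L1.\<close>

lemma du_bois_reymond:
  fixes f :: "real^'n \<Rightarrow> real"
  assumes f: "f \<in> L1_loc \<Omega>" and \<Omega>: "open \<Omega>"
    and test: "\<And>\<phi>. \<phi> \<in> Cc_infty \<Omega> \<Longrightarrow> (LINT x|lebesgue_on \<Omega>. f x * \<phi> x) = 0"
  shows "AE x in lebesgue_on \<Omega>. f x = 0"
proof (rule AE_lebesgue_on_local[OF open_lebesgue[OF \<Omega>]])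
  fix x0 assume "x0 \<in> \<Omega>"
  then obtain s where s: "s > 0" "cball x0 s \<subseteq> \<Omega>" using \<Omega> open_contains_cball by blast
  \<comment> \<open>Half the radius leaves room for the mollifier ball around any point of
    \<open>ball x0 r\<close> to stay inside \<open>cball x0 s\<close>, where \<open>F\<close> and
    \<open>f\<close> agree.\<close>
  define r where "r = s / 2"
  have r: "r > 0" using s by (simp add: r_def)
  define F where "F = (\<lambda>x. indicator (cball x0 s) x *\<^sub>R f x)"
  have F: "integrable lebesgue F" unfolding F_def by (rule L1_loc_integrable_on[OF f compact_cball s(2)])
  \<comment> \<open>The mollification of \<open>F\<close> will be zero on the small ball, so there
    \<open>\<bar>F\<bar>\<close> equals the mollification error and the integral of \<open>G\<close>
    is arbitrarily small.\<close>
  define G where "G = (\<lambda>x. indicator (ball x0 r) x * \<bar>F x\<bar>)"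
  have G: "integrable lebesgue G" unfolding G_def
    using integrable_mult_indicator[OF _ integrable_abs[OF F], of "ball x0 r"] by simp
  have "(LINT x|lebesgue. G x) \<le> 0"
  proof (rule field_le_epsilon)
    fix \<eta> :: real assume "\<eta> > 0"
    then obtain d where d: "d > 0"
      "\<And>\<epsilon> \<rho>. 0 < \<epsilon> \<Longrightarrow> \<epsilon> \<le> d \<Longrightarrow> mollifier \<epsilon> \<rho> \<Longrightarrow> (LINT x|lebesgue. \<bar>conv F \<rho> x - F x\<bar>) < \<eta>"
      using mollification_L1[OF F] by blast
    define \<epsilon> where "\<epsilon> = min d r"
    have \<epsilon>: "0 < \<epsilon>" "\<epsilon> \<le> d" "\<epsilon> \<le> r" using d r by (auto simp: \<epsilon>_def)
    obtain \<rho> :: "real^'n \<Rightarrow> real" where \<rho>: "mollifier \<epsilon> \<rho>" using exists_mollifier \<epsilon> by blast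
    have conv0: "conv F \<rho> x = 0" if x: "x \<in> ball x0 r" for x
    proof -
      have "cball x \<epsilon> \<subseteq> cball x0 s"
      proof
        fix y assume "y \<in> cball x \<epsilon>"
        then show "y \<in> cball x0 s"
          using x \<epsilon> dist_triangle[of x0 y x] by (simp add: r_def)
      qed
      then have sub: "cball x \<epsilon> \<subseteq> \<Omega>" using s by blast
      have eq: "F y * \<rho> (x - y) = f y * \<rho> (x - y)" for y
        using \<open>cball x \<epsilon> \<subseteq> cball x0 s\<close> mollifierD(4)[OF \<rho>, of "x - y"]
        by (cases "y \<in> cball x \<epsilon>") (auto simp: F_def dist_norm)
      have "conv F \<rho> x = (LINT y|lebesgue. f y * \<rho> (x - y))"
        by (simp add: conv_def eq)
      also have "\<dots> = (LINT y|lebesgue_on \<Omega>. f y * \<rho> (x - y))"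
      proof (rule integral_lebesgue_on_eq(1)[OF open_lebesgue[OF \<Omega>], symmetric])
        fix y assume "y \<notin> \<Omega>"
        then show "f y * \<rho> (x - y) = 0"
          using sub mollifierD(4)[OF \<rho>, of "x - y"] by (cases "y \<in> cball x \<epsilon>") (auto simp: dist_norm)
      qed
      also have "\<dots> = 0" by (rule test[OF Cc_infty_reflected_mollifier[OF \<rho> sub]])
      finally show ?thesis .
    qed
    have "(LINT x|lebesgue. G x) \<le> (LINT x|lebesgue. \<bar>conv F \<rho> x - F x\<bar>)"
      by (intro integral_mono G integrable_abs Bochner_Integration.integrable_diff F conv_L1_bound[OF F \<rho>])
         (auto simp: G_def indicator_def conv0)
    then show "(LINT x|lebesgue. G x) \<le> 0 + \<eta>" using d(2)[OF \<epsilon>(1,2) \<rho>] by simp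
  qed
  moreover have "(LINT x|lebesgue. G x) \<ge> 0" by (intro integral_nonneg_AE) (simp add: G_def)
  ultimately have "(LINT x|lebesgue. G x) = 0" by simp
  then have "AE x in lebesgue. G x = 0"
    using integral_nonneg_eq_0_iff_AE[OF G] by (simp add: G_def)
  then have "AE y in lebesgue. y \<in> ball x0 r \<longrightarrow> f y = 0"
  proof eventually_elim
    case (elim y)
    have "y \<in> cball x0 s" if "y \<in> ball x0 r" using that s by (auto simp: r_def)
    then show ?case using elim by (auto simp: G_def F_def)
  qed
  then show "\<exists>r>0. AE y in lebesgue. y \<in> ball x0 r \<longrightarrow> f y = 0" using r by blast
qed

section \<open>Uniqueness and algebra of weak gradients\<close>

lemma L1_loc_add: "f \<in> L1_loc \<Omega> \<Longrightarrow> g \<in> L1_loc \<Omega> \<Longrightarrow> (\<lambda>x. f x + g x) \<in> L1_loc \<Omega>"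
  by (auto simp: L1_loc_def)

lemma L1_loc_scaleR: "f \<in> L1_loc \<Omega> \<Longrightarrow> (\<lambda>x. c *\<^sub>R f x) \<in> L1_loc \<Omega>"
  by (auto simp: L1_loc_def)

lemma L1_loc_component: "G \<in> L1_loc \<Omega> \<Longrightarrow> (\<lambda>x. G x $ i) \<in> L1_loc \<Omega>"
  by (auto simp: L1_loc_def intro: integrable_bounded_linear[OF bounded_linear_vec_nth])

lemma L1_loc_subset: "f \<in> L1_loc \<Omega> \<Longrightarrow> U \<subseteq> \<Omega> \<Longrightarrow> f \<in> L1_loc U"
  by (auto simp: L1_loc_def)

lemma L1_loc_Cc_infty_integrable:
  assumes "f \<in> L1_loc \<Omega>" "open \<Omega>" "\<phi> \<in> Cc_infty \<Omega>"
  shows "integrable (lebesgue_on \<Omega>) (\<lambda>x. f x * \<phi> x)"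
    "integrable (lebesgue_on \<Omega>) (\<lambda>x. f x * gradient \<phi> x $ i)"
proof -
  note D = Cc_inftyD[OF assms(3)]
  show "integrable (lebesgue_on \<Omega>) (\<lambda>x. f x * \<phi> x)"
    by (rule L1_loc_mult_integrable(2)[OF assms(1,2) D(6,2,3,4)])
  have "gradient \<phi> x $ i = 0" if "x \<notin> closure {x. \<phi> x \<noteq> 0}" for x using D(5)[OF that] by simp
  then show "integrable (lebesgue_on \<Omega>) (\<lambda>x. f x * gradient \<phi> x $ i)"
    by (rule L1_loc_mult_integrable(2)[OF assms(1,2) D(7,2,3)])
qed

lemma L1_loc_continuous:
  fixes f :: "real^'n \<Rightarrow> 'b::euclidean_space"
  assumes "continuous_on \<Omega> f"
  shows "f \<in> L1_loc \<Omega>"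
  unfolding L1_loc_def
proof (intro CollectI allI impI)
  fix K assume K: "compact K \<and> K \<subseteq> \<Omega>"
  then have c: "continuous_on K f" using assms continuous_on_subset by blast
  have int: "integrable lborel (\<lambda>x. indicator K x *\<^sub>R f x)" using K c borel_integrable_compact by blast
  have "integrable lebesgue (\<lambda>x. indicator K x *\<^sub>R f x)"
    by (subst integrable_completion) (use int in auto)
  then show "integrable (lebesgue_on K) f"
    using K by (subst integrable_restrict_space) (auto simp: lmeasurable_compact fmeasurableD)
qed

text \<open>As \<open>wgrad\<close> is an arbitrary choice, this is what allows an explicit weak
  gradient to replace it under integrals.\<close>

lemma has_weak_gradient_unique:
  assumes "open \<Omega>" "has_weak_gradient \<Omega> u G" "has_weak_gradient \<Omega> u G'"
  shows "AE x in lebesgue_on \<Omega>. G x = G' x"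
proof -
  have "AE x in lebesgue_on \<Omega>. G x $ i - G' x $ i = 0" for i
  proof (rule du_bois_reymond[OF _ assms(1)])
    have G: "(\<lambda>x. G x $ i) \<in> L1_loc \<Omega>" "(\<lambda>x. G' x $ i) \<in> L1_loc \<Omega>"
      using assms by (auto simp: has_weak_gradient_def intro: L1_loc_component)
    show "(\<lambda>x. G x $ i - G' x $ i) \<in> L1_loc \<Omega>"
      using L1_loc_add[OF G(1) L1_loc_scaleR[OF G(2), of "- 1"]] by simp
    fix \<phi> assume \<phi>: "\<phi> \<in> Cc_infty \<Omega>"
    then show "(LINT x|lebesgue_on \<Omega>. (G x $ i - G' x $ i) * \<phi> x) = 0"
      using assms L1_loc_Cc_infty_integrable(1)[OF G(1) assms(1) \<phi>]
        L1_loc_Cc_infty_integrable(1)[OF G(2) assms(1) \<phi>]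
      by (simp add: has_weak_gradient_def left_diff_distrib)
  qed
  then have "AE x in lebesgue_on \<Omega>. \<forall>i. G x $ i - G' x $ i = 0" by (subst AE_all_countable) auto
  then show ?thesis by eventually_elim (simp add: vec_eq_iff)
qed

lemma has_weak_gradient_add:
  assumes "open \<Omega>" "has_weak_gradient \<Omega> u G" "has_weak_gradient \<Omega> v G'"
  shows "has_weak_gradient \<Omega> (\<lambda>x. u x + v x) (\<lambda>x. G x + G' x)"
proof -
  have L: "u \<in> L1_loc \<Omega>" "v \<in> L1_loc \<Omega>" "G \<in> L1_loc \<Omega>" "G' \<in> L1_loc \<Omega>"
    using assms by (auto simp: has_weak_gradient_def)
  show ?thesis
    unfolding has_weak_gradient_def
  proof (intro conjI ballI allI L1_loc_add L)
    fix \<phi> i assume \<phi>: "\<phi> \<in> Cc_infty \<Omega>"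
    note int = L1_loc_Cc_infty_integrable[OF _ assms(1) \<phi>]
    note int = int(2)[OF L(1), of i] int(2)[OF L(2), of i] int(1)[OF L1_loc_component[OF L(3)], of i]
      int(1)[OF L1_loc_component[OF L(4)], of i]
    show "(LINT x|lebesgue_on \<Omega>. (u x + v x) * gradient \<phi> x $ i) = - (LINT x|lebesgue_on \<Omega>. (G x + G' x) $ i * \<phi> x)"
      using assms \<phi> int by (simp add: has_weak_gradient_def distrib_right)
  qed
qed

lemma has_weak_gradient_scale:
  assumes "has_weak_gradient \<Omega> u G"
  shows "has_weak_gradient \<Omega> (\<lambda>x. c * u x) (\<lambda>x. c *\<^sub>R G x)"
  using assms L1_loc_scaleR[of u \<Omega> c] L1_loc_scaleR[of G \<Omega> c]
  by (simp add: has_weak_gradient_def mult.assoc)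

lemma has_weak_gradient_C1:
  assumes "open \<Omega>" "Ck 1 u"
  shows "has_weak_gradient \<Omega> u (gradient u)"
  unfolding has_weak_gradient_def
proof (intro conjI ballI allI)
  have uc: "continuous_on UNIV u" using Ck_continuous[OF assms(2)] .
  have gic: "continuous_on UNIV (\<lambda>z. gradient u z $ i)" for i using assms(2) by simp
  have gc: "continuous_on UNIV (gradient u)"
    using continuous_on_vec_lambda[of UNIV "\<lambda>i z. gradient u z $ i"] gic by simp
  show "u \<in> L1_loc \<Omega>" "gradient u \<in> L1_loc \<Omega>"
    by (intro L1_loc_continuous continuous_on_subset[OF uc] continuous_on_subset[OF gc] subset_UNIV)+
  fix \<phi> i assume \<phi>: "\<phi> \<in> Cc_infty \<Omega>"
  note D = Cc_inftyD[OF \<phi>]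
  have out: "\<phi> x = 0" "gradient \<phi> x = 0" if "x \<notin> \<Omega>" for x using D(3,4,5) that by blast+
  have m: "(\<lambda>x. u x * gradient \<phi> x $ i) \<in> borel_measurable borel"
    "(\<lambda>x. gradient u x $ i * \<phi> x) \<in> borel_measurable borel"
    by (intro continuous_on_UNIV_borel continuous_intros uc gic D)+
  have "(LINT x|lebesgue_on \<Omega>. u x * gradient \<phi> x $ i) = (LINT x|lborel. u x * gradient \<phi> x $ i)"
    using m assms(1) out by (subst integral_lebesgue_on_eq(1)) (auto simp: integral_completion)
  also have "\<dots> = - (LINT x|lborel. gradient u x $ i * \<phi> x)"
    by (rule integration_by_parts[OF assms(2) D(1,2,4)])
  also have "(LINT x|lborel. gradient u x $ i * \<phi> x) = (LINT x|lebesgue_on \<Omega>. gradient u x $ i * \<phi> x)"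
    using m assms(1) out by (subst integral_lebesgue_on_eq(1)) (auto simp: integral_completion)
  finally show "(LINT x|lebesgue_on \<Omega>. u x * gradient \<phi> x $ i) = - (LINT x|lebesgue_on \<Omega>. gradient u x $ i * \<phi> x)" .
qed

lemma has_weak_gradient_wgrad:
  "has_weak_gradient \<Omega> u G \<Longrightarrow> has_weak_gradient \<Omega> u (wgrad \<Omega> u)"
  unfolding wgrad_def by (rule someI[of "has_weak_gradient \<Omega> u"])

lemma wgrad_AE_eq:
  "open \<Omega> \<Longrightarrow> has_weak_gradient \<Omega> u G \<Longrightarrow> AE x in lebesgue_on \<Omega>. wgrad \<Omega> u x = G x"
  using has_weak_gradient_unique has_weak_gradient_wgrad by blast

text \<open>Test functions supported in the open set \<open>\<Omega> - K\<close> make the term with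
  \<open>u\<close> vanish, so the fundamental lemma applies there to each component of
  \<open>G\<close>.\<close>

lemma weak_gradient_zero_outside:
  assumes \<Omega>: "open \<Omega>" and G: "has_weak_gradient \<Omega> u G" and K: "closed K" "\<And>x. x \<notin> K \<Longrightarrow> u x = 0"
  shows "AE x in lebesgue_on \<Omega>. x \<notin> K \<longrightarrow> G x = 0"
proof -
  have U: "open (\<Omega> - K)" using \<Omega> K(1) by (rule open_Diff)
  have "AE x in lebesgue_on (\<Omega> - K). G x $ i = 0" for i
  proof (rule du_bois_reymond[OF _ U])
    show "(\<lambda>x. G x $ i) \<in> L1_loc (\<Omega> - K)"
      using G by (auto simp: has_weak_gradient_def intro: L1_loc_component L1_loc_subset)
    fix \<phi> assume \<phi>: "\<phi> \<in> Cc_infty (\<Omega> - K)"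
    note D = Cc_inftyD[OF \<phi>]
    have \<phi>': "\<phi> \<in> Cc_infty \<Omega>" using \<phi> by (auto simp: Cc_infty_def compactly_inside_def)
    have out: "\<phi> x = 0" "gradient \<phi> x = 0" if "x \<notin> \<Omega> - K" for x using D(3,4,5) that by blast+
    have "(LINT x|lebesgue_on (\<Omega> - K). G x $ i * \<phi> x) = (LINT x|lebesgue. G x $ i * \<phi> x)"
      using out(1) U by (intro integral_lebesgue_on_eq(1)) simp_all
    also have "\<dots> = (LINT x|lebesgue_on \<Omega>. G x $ i * \<phi> x)"
      using out(1) \<Omega> by (intro integral_lebesgue_on_eq(1)[symmetric]) simp_all
    also have "\<dots> = - (LINT x|lebesgue_on \<Omega>. u x * gradient \<phi> x $ i)"
      using G \<phi>' by (simp add: has_weak_gradient_def)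
    also have "(\<lambda>x. u x * gradient \<phi> x $ i) = (\<lambda>x. 0)"
    proof
      fix x
      show "u x * gradient \<phi> x $ i = 0"
        using K(2)[of x] out(2)[of x] by (cases "x \<in> K") simp_all
    qed
    finally show "(LINT x|lebesgue_on (\<Omega> - K). G x $ i * \<phi> x) = 0" by simp
  qed
  then have "AE x in lebesgue_on (\<Omega> - K). \<forall>i. G x $ i = 0" by (subst AE_all_countable) auto
  then have "AE x in lebesgue. x \<in> \<Omega> - K \<longrightarrow> (\<forall>i. G x $ i = 0)"
    using U by (subst (asm) AE_restrict_space_iff) auto
  then show ?thesis
    using \<Omega> by (subst AE_restrict_space_iff) (auto simp: vec_eq_iff)
qed

section \<open>Energy seminorms\<close>

text \<open>Convexity on the positive half-line, extended to its end point: if one argument is zero,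
  the claim reduces to \<open>c powr p \<le> c\<close> for \<open>c\<close> in the unit
  interval.\<close>

lemma powr_convex_combination:
  fixes a b p t :: real
  assumes "0 \<le> a" "0 \<le> b" "1 < p" "0 \<le> t" "t \<le> 1"
  shows "(t * a + (1 - t) * b) powr p \<le> t * a powr p + (1 - t) * b powr p"
proof -
  have le: "c powr p \<le> c" if "0 \<le> c" "c \<le> 1" for c :: real
    using that assms(3) powr_mono'[of 1 p c] by (cases "c = 0") auto
  consider "a > 0" "b > 0" | "a = 0" | "b = 0" using assms by linarith
  then show ?thesis
  proof cases
    case 1
    then show ?thesis
      using convex_onD[OF powr_convex[of p], of "1 - t" a b] assms by simp
  next
    case 2
    then show ?thesis using le[of "1 - t"] assms by (auto simp: powr_mult intro: mult_right_mono)
  next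
    case 3
    then show ?thesis using le[of t] assms by (auto simp: powr_mult intro: mult_right_mono)
  qed
qed

text \<open>Feeds Jensen's inequality in \<open>conv_powr_le\<close>. Convexity gives the tangent
  bound for positive arguments; the cases with a zero argument are evaluated directly.\<close>

lemma powr_above_tangent:
  fixes s t p :: real
  assumes "0 \<le> s" "0 \<le> t" "1 < p"
  shows "s powr p + p * s powr (p - 1) * (t - s) \<le> t powr p"
proof -
  consider "s > 0" "t > 0" | "s = 0" | "s > 0" "t = 0" using assms by linarith
  then show ?thesis
  proof cases
    case 1
    have "t powr p - s powr p \<ge> (p * s powr (p - 1)) * (t - s)"
    proof (rule convex_on_imp_above_tangent[OF powr_convex])
      show "((\<lambda>x. x powr p) has_real_derivative p * s powr (p - 1)) (at s within {0<..})"
        using 1 by (auto intro!: derivative_eq_intros)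
    qed (use 1 assms in \<open>auto simp: interior_open\<close>)
    then show ?thesis by simp
  next
    case 2
    then show ?thesis by simp
  next
    case 3
    have "s powr (p - 1) * s = s powr p" using 3 by (simp add: powr_diff)
    then have "s powr p + p * s powr (p - 1) * (t - s) = (1 - p) * s powr p"
      using 3 by (simp add: algebra_simps)
    also have "\<dots> \<le> 0" using assms by (simp add: mult_nonpos_nonneg)
    finally show ?thesis using 3 by simp
  qed
qed

text \<open>The subadditivity is that of the gauge of the convex set where \<^term>\<open>F\<close> is at most 1.\<close>
lemma seminorm_on_powr_inverse:
  fixes F :: "('a \<Rightarrow> real) \<Rightarrow> real"
  assumes p: "1 < p" and nn: "\<And>u. u \<in> X \<Longrightarrow> 0 \<le> F u"
    and scale: "\<And>c u. u \<in> X \<Longrightarrow> (\<lambda>x. c * u x) \<in> X"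
    and hom: "\<And>c u. u \<in> X \<Longrightarrow> F (\<lambda>x. c * u x) = \<bar>c\<bar> powr p * F u"
    and conv_in: "\<And>t u v. u \<in> X \<Longrightarrow> v \<in> X \<Longrightarrow> 0 \<le> t \<Longrightarrow> t \<le> 1 \<Longrightarrow> (\<lambda>x. t * u x + (1 - t) * v x) \<in> X"
    and conv_le: "\<And>t u v. u \<in> X \<Longrightarrow> v \<in> X \<Longrightarrow> 0 \<le> t \<Longrightarrow> t \<le> 1 \<Longrightarrow>
      F (\<lambda>x. t * u x + (1 - t) * v x) \<le> t * F u + (1 - t) * F v"
  shows "seminorm_on X (\<lambda>u. F u powr (1 / p))"
proof -
  have add_in: "(\<lambda>x. u x + v x) \<in> X" if "u \<in> X" "v \<in> X" for u v
    using scale[OF conv_in[OF that, of "1/2"], of 2] by simp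
  have tri: "F (\<lambda>x. u x + v x) powr (1 / p) \<le> F u powr (1 / p) + F v powr (1 / p)" if uv: "u \<in> X" "v \<in> X" for u v
  proof (rule field_le_epsilon)
    fix e :: real assume e: "e > 0"
    \<comment> \<open>The extra \<open>e / 2\<close> makes both numbers positive, so that
      \<open>u\<close> and \<open>v\<close> can be normalized even where \<open>F\<close>
      vanishes.\<close>
    define a b where "a = F u powr (1 / p) + e / 2" and "b = F v powr (1 / p) + e / 2"
    have ab: "a > 0" "b > 0" using e by (auto simp: a_def b_def add_nonneg_pos)
    have unit: "F (\<lambda>x. inverse c * w x) \<le> 1" if "w \<in> X" "F w powr (1 / p) < c" for c w
    proof -
      have c: "c > 0" using that(2) powr_ge_zero[of "F w" "1 / p"] by linarith
      have "F w = (F w powr (1 / p)) powr p" using p nn[OF that(1)] by (simp add: powr_powr)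
      also have "\<dots> \<le> c powr p" using that p by (intro powr_mono2) auto
      finally have "F w \<le> c powr p" .
      moreover have "F (\<lambda>x. inverse c * w x) = inverse (c powr p) * F w"
        using c by (subst hom[OF that(1)]) (simp add: inverse_powr)
      ultimately show ?thesis using c by (simp add: pos_le_divide_eq divide_inverse[symmetric] mult.commute)
    qed
    \<comment> \<open>With this weight the convex combination of \<open>u / a\<close> and
      \<open>v / b\<close> is \<open>(u + v) / (a + b)\<close>.\<close>
    define t where "t = a / (a + b)"
    have t: "0 \<le> t" "t \<le> 1" "1 - t = b / (a + b)" using ab by (auto simp: t_def field_simps)
    have eq: "t * (inverse a * u x) + (1 - t) * (inverse b * v x) = inverse (a + b) * (u x + v x)" for x
    proof -
      have "t * inverse a = inverse (a + b)" using ab by (simp add: t_def field_simps)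
      moreover have "(1 - t) * inverse b = inverse (a + b)" unfolding t(3) using ab by (simp add: field_simps)
      ultimately show ?thesis by (metis distrib_left mult.assoc)
    qed
    have "inverse (a + b) powr p * F (\<lambda>x. u x + v x) = F (\<lambda>x. inverse (a + b) * (u x + v x))"
      using ab by (subst hom[OF add_in[OF uv]]) simp
    also have "\<dots> \<le> t * F (\<lambda>x. inverse a * u x) + (1 - t) * F (\<lambda>x. inverse b * v x)"
      using conv_le[OF scale[OF uv(1), of "inverse a"] scale[OF uv(2), of "inverse b"] t(1,2)] by (simp add: eq)
    also have "\<dots> \<le> t * 1 + (1 - t) * 1"
      using t e uv by (intro add_mono mult_left_mono unit) (auto simp: a_def b_def)
    finally have "inverse (a + b) powr p * F (\<lambda>x. u x + v x) \<le> 1" by simp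
    from mult_left_mono[OF this, of "(a + b) powr p"] have "F (\<lambda>x. u x + v x) \<le> (a + b) powr p"
      using ab by (simp add: mult.assoc[symmetric] powr_mult[symmetric])
    then have "F (\<lambda>x. u x + v x) powr (1 / p) \<le> ((a + b) powr p) powr (1 / p)"
      using p nn[OF add_in[OF uv]] by (intro powr_mono2) auto
    also have "\<dots> = a + b" using ab p by (simp add: powr_powr)
    finally show "F (\<lambda>x. u x + v x) powr (1 / p) \<le> F u powr (1 / p) + F v powr (1 / p) + e"
      by (simp add: a_def b_def)
  qed
  have "F (\<lambda>x. c * u x) powr (1 / p) = \<bar>c\<bar> * F u powr (1 / p)" if "u \<in> X" for c u
    using p nn[OF that] by (simp add: hom[OF that] powr_mult powr_powr)
  then show ?thesis unfolding seminorm_on_def using add_in scale tri by blast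
qed

lemma borel_measurable_lebesgue_on_AE:
  fixes f g :: "'a::euclidean_space \<Rightarrow> 'b::euclidean_space"
  assumes "S \<in> sets lebesgue" "f \<in> borel_measurable (lebesgue_on S)" "AE x in lebesgue_on S. f x = g x"
  shows "g \<in> borel_measurable (lebesgue_on S)"
proof -
  have "(\<lambda>x. indicator S x *\<^sub>R f x) \<in> borel_measurable lebesgue"
    using assms(1,2) by (subst (asm) borel_measurable_restrict_space_iff) auto
  moreover have "AE x in lebesgue. indicator S x *\<^sub>R f x = indicator S x *\<^sub>R g x"
    using assms(3) unfolding AE_restrict_space_iff[of S lebesgue, simplified, OF assms(1)]
    by eventually_elim (auto simp: indicator_def)
  ultimately have "(\<lambda>x. indicator S x *\<^sub>R g x) \<in> borel_measurable lebesgue"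
    by (rule borel_measurable_AE)
  then show ?thesis using assms(1) by (subst borel_measurable_restrict_space_iff) auto
qed

section \<open>Measurability and convexity of gradient energies\<close>

lemma is_normD:
  assumes "is_norm N"
  shows "0 \<le> N \<xi>" "N (c *\<^sub>R \<xi>) = \<bar>c\<bar> * N \<xi>" "N (\<xi> + \<eta>) \<le> N \<xi> + N \<eta>" "N 0 = 0"
  using assms by (auto simp: is_norm_def)

text \<open>Expansion in the standard basis bounds \<open>N\<close> by a multiple of the Euclidean
  norm, and the triangle inequality then makes \<open>N\<close> Lipschitz.\<close>

lemma is_norm_continuous:
  fixes N :: "real^'n \<Rightarrow> real"
  assumes N: "is_norm N"
  shows "continuous_on UNIV N"
proof -
  note D = is_normD[OF N]
  define B where "B = (\<Sum>i\<in>UNIV. N (axis i 1))"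
  have sum_le: "N (\<Sum>i\<in>I. f i) \<le> (\<Sum>i\<in>I. N (f i))" if "finite I" for I and f :: "'n \<Rightarrow> real^'n"
    using that by (induction I) (auto simp: D(4) intro: order_trans[OF D(3)])
  have bound: "N \<xi> \<le> B * norm \<xi>" for \<xi>
  proof -
    have "\<xi> = (\<Sum>i\<in>UNIV. (\<xi> $ i) *\<^sub>R axis i 1)"
      using basis_expansion[of \<xi>] by (simp add: scalar_mult_eq_scaleR)
    then have "N \<xi> \<le> (\<Sum>i\<in>UNIV. N ((\<xi> $ i) *\<^sub>R axis i 1))" using sum_le[of UNIV] by (metis finite)
    also have "\<dots> \<le> (\<Sum>i\<in>UNIV. norm \<xi> * N (axis i 1))"
      by (intro sum_mono) (auto simp: D(2) intro!: mult_right_mono D(1) component_le_norm_cart)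
    finally show ?thesis by (simp add: B_def sum_distrib_left mult.commute)
  qed
  have tri: "N \<xi> - N \<eta> \<le> N (\<xi> - \<eta>)" for \<xi> \<eta> using D(3)[of "\<xi> - \<eta>" \<eta>] by simp
  have minus: "N (\<xi> - \<eta>) = N (\<eta> - \<xi>)" for \<xi> \<eta> using D(2)[of "- 1" "\<eta> - \<xi>"] by simp
  have "\<bar>N \<xi> - N \<eta>\<bar> \<le> B * norm (\<xi> - \<eta>)" for \<xi> \<eta>
    using tri[of \<xi> \<eta>] tri[of \<eta> \<xi>] minus[of \<xi> \<eta>] bound[of "\<xi> - \<eta>"] by linarith
  moreover have "B \<ge> 0" by (simp add: B_def sum_nonneg D(1))
  ultimately have "B-lipschitz_on UNIV N" by (intro lipschitz_onI) (auto simp: dist_norm)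
  then show ?thesis by (rule lipschitz_on_continuous_on)
qed

locale norm_energy =
  fixes \<Omega> :: "(real^'n) set" and H :: "real^'n \<Rightarrow> real^'n \<Rightarrow> real" and p :: real
  assumes p: "1 < p" and open_\<Omega>: "open \<Omega>"
    and norm_AE: "AE x in lebesgue_on \<Omega>. is_norm (H x)"
    and H_measurable: "(\<lambda>x. H x \<xi>) \<in> borel_measurable (lebesgue_on \<Omega>)"
begin

lemma \<Omega>_sets: "\<Omega> \<in> sets lebesgue"
  using open_\<Omega> by simp

text \<open>The Caratheodory argument: \<open>H\<close> is measurable in the point and, wherever it
  is a norm, continuous in the vector, so approximating \<open>G\<close> by simple functions
  suffices.\<close>

lemma H_comp_measurable:
  assumes G: "G \<in> borel_measurable (lebesgue_on \<Omega>)"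
  shows "(\<lambda>x. H x (G x)) \<in> borel_measurable (lebesgue_on \<Omega>)"
proof -
  let ?M = "lebesgue_on \<Omega>"
  obtain s where s: "\<And>i :: nat. simple_function ?M (s i)" "\<And>x. x \<in> space ?M \<Longrightarrow> (\<lambda>i. s i x) \<longlonglongrightarrow> G x"
    using borel_measurable_implies_sequence_metric[OF G, of 0] by metis
  have sm: "(\<lambda>x. H x (s i x)) \<in> borel_measurable ?M" for i
  proof (rule measurable_compose_countable'[where I = "s i ` space ?M" and g = "s i" and f = "\<lambda>\<xi> x. H x \<xi>"])
    show "s i \<in> measurable ?M (count_space (s i ` space ?M))"
      using s(1)[of i] by (subst measurable_count_space_eq2) (auto simp: simple_function_def)
    show "countable (s i ` space ?M)"
      using s(1)[of i] by (auto simp: simple_function_def intro: countable_finite)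
  qed (rule H_measurable)
  \<comment> \<open>Off this null set \<open>H x\<close> is continuous. The indicator of its
    complement gives a limit at every point, and completeness of the measure removes the indicator
    afterwards.\<close>
  obtain N where N: "N \<in> null_sets ?M" "{x \<in> space ?M. \<not> is_norm (H x)} \<subseteq> N"
    using norm_AE unfolding eventually_ae_filter by (elim bexE)
  have [measurable]: "N \<in> sets ?M" using N by auto
  have "(\<lambda>x. indicator (- N) x * H x (G x)) \<in> borel_measurable ?M"
  proof (rule borel_measurable_LIMSEQ_real)
    show "(\<lambda>x. indicator (- N) x * H x (s i x)) \<in> borel_measurable ?M" for i
    proof -
      have "(\<lambda>x. (1 - indicator N x) * H x (s i x)) \<in> borel_measurable ?M"
        using sm[of i] by measurable
      moreover have "(\<lambda>x. (1 - indicator N x) * H x (s i x)) = (\<lambda>x. indicator (- N) x * H x (s i x))"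
        by (auto simp: indicator_def fun_eq_iff)
      ultimately show ?thesis by simp
    qed
    fix x assume x: "x \<in> space ?M"
    show "(\<lambda>i. indicator (- N) x * H x (s i x)) \<longlonglongrightarrow> indicator (- N) x * H x (G x)"
    proof (cases "x \<in> N")
      case False
      then have "isCont (H x) (G x)"
        using N(2) x is_norm_continuous continuous_on_eq_continuous_at[OF open_UNIV] by blast
      then have "(\<lambda>i. H x (s i x)) \<longlonglongrightarrow> H x (G x)" by (rule isCont_tendsto_compose) (rule s(2)[OF x])
      then show ?thesis by (intro tendsto_intros)
    qed simp
  qed
  then show ?thesis
  proof (rule borel_measurable_lebesgue_on_AE[OF \<Omega>_sets])
    show "AE x in ?M. indicator (- N) x * H x (G x) = H x (G x)"
      using AE_not_in[OF N(1)] by eventually_elim simp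
  qed
qed

definition grad_energy :: "(real^'n \<Rightarrow> real) \<Rightarrow> real^'n \<Rightarrow> real" where
  "grad_energy u x = H x (wgrad \<Omega> u x) powr p"

lemma grad_energy_measurable:
  assumes "has_weak_gradient \<Omega> u G"
  shows "grad_energy u \<in> borel_measurable (lebesgue_on \<Omega>)"
proof -
  have "wgrad \<Omega> u \<in> borel_measurable (lebesgue_on \<Omega>)"
    using has_weak_gradient_wgrad[OF assms] open_\<Omega>
    by (intro L1_loc_borel_measurable) (auto simp: has_weak_gradient_def)
  from H_comp_measurable[OF this] show ?thesis unfolding grad_energy_def by measurable
qed

lemma grad_energy_nonneg: "0 \<le> grad_energy u x"
  by (simp add: grad_energy_def)

lemma grad_energy_cong:
  "has_weak_gradient \<Omega> u G \<Longrightarrow> AE x in lebesgue_on \<Omega>. grad_energy u x = H x (G x) powr p"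
  by (drule wgrad_AE_eq[OF open_\<Omega>], erule eventually_mono) (simp add: grad_energy_def)

lemma grad_energy_scale:
  assumes "has_weak_gradient \<Omega> u G"
  shows "AE x in lebesgue_on \<Omega>. grad_energy (\<lambda>x. c * u x) x = \<bar>c\<bar> powr p * grad_energy u x"
  using grad_energy_cong[OF assms] grad_energy_cong[OF has_weak_gradient_scale[OF assms, of c]] norm_AE
  by eventually_elim (simp add: is_normD powr_mult)

lemma grad_energy_convex:
  assumes u: "has_weak_gradient \<Omega> u G" and v: "has_weak_gradient \<Omega> v G'" and t: "0 \<le> t" "t \<le> 1"
  shows "AE x in lebesgue_on \<Omega>.
    grad_energy (\<lambda>x. t * u x + (1 - t) * v x) x \<le> t * grad_energy u x + (1 - t) * grad_energy v x"
  using grad_energy_cong[OF u] grad_energy_cong[OF v] norm_AE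
    grad_energy_cong[OF has_weak_gradient_add[OF open_\<Omega> has_weak_gradient_scale[OF u] has_weak_gradient_scale[OF v]], of t "1 - t"]
proof eventually_elim
  case (elim x)
  have "H x (t *\<^sub>R G x + (1 - t) *\<^sub>R G' x) \<le> t * H x (G x) + (1 - t) * H x (G' x)"
    using is_normD(3)[OF elim(3), of "t *\<^sub>R G x" "(1 - t) *\<^sub>R G' x"] t by (simp add: is_normD(2)[OF elim(3)])
  then have "H x (t *\<^sub>R G x + (1 - t) *\<^sub>R G' x) powr p \<le> (t * H x (G x) + (1 - t) * H x (G' x)) powr p"
    using p is_normD(1)[OF elim(3)] by (intro powr_mono2) auto
  also have "\<dots> \<le> t * H x (G x) powr p + (1 - t) * H x (G' x) powr p"
    using p t is_normD(1)[OF elim(3)] by (intro powr_convex_combination) auto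
  finally show ?case by (simp add: elim(1,2,4))
qed

text \<open>The weight is a parameter because two weights occur: \<open>\<bar>V\<bar> + \<V>\<close>
  gives the space \<open>Wt\<close> with its norm, while \<open>V\<close> gives a space on which the
  root of \<open>Q\<close> is a seminorm.\<close>

definition finite_energy :: "(real^'n \<Rightarrow> real) \<Rightarrow> (real^'n \<Rightarrow> real) set" where
  "finite_energy W = {u. u \<in> borel_measurable (lebesgue_on \<Omega>) \<and>
     integrable (lebesgue_on \<Omega>) (\<lambda>x. W x * \<bar>u x\<bar> powr p) \<and>
     (\<exists>G. has_weak_gradient \<Omega> u G) \<and> integrable (lebesgue_on \<Omega>) (grad_energy u)}"

definition energy :: "(real^'n \<Rightarrow> real) \<Rightarrow> (real^'n \<Rightarrow> real) \<Rightarrow> real" where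
  "energy W u = (LINT x|lebesgue_on \<Omega>. grad_energy u x + W x * \<bar>u x\<bar> powr p)"

lemma energy_eq_Q_functional: "energy W u = Q_functional H p W \<Omega> u"
  by (simp add: energy_def Q_functional_def grad_energy_def)

lemma finite_energy_integrable:
  "u \<in> finite_energy W \<Longrightarrow> integrable (lebesgue_on \<Omega>) (\<lambda>x. grad_energy u x + W x * \<bar>u x\<bar> powr p)"
  by (simp add: finite_energy_def)

context
  fixes W :: "real^'n \<Rightarrow> real"
  assumes W_meas: "W \<in> borel_measurable (lebesgue_on \<Omega>)"
    and W_nonneg: "AE x in lebesgue_on \<Omega>. 0 \<le> W x"
begin

lemma energy_nonneg: "0 \<le> energy W u"
  unfolding energy_def
  by (rule integral_nonneg_AE) (use W_nonneg in \<open>eventually_elim, simp add: grad_energy_nonneg\<close>)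

lemma finite_energy_scale:
  assumes u: "u \<in> finite_energy W"
  shows "(\<lambda>x. c * u x) \<in> finite_energy W" "energy W (\<lambda>x. c * u x) = \<bar>c\<bar> powr p * energy W u"
proof -
  obtain G where G: "has_weak_gradient \<Omega> u G" using u by (auto simp: finite_energy_def)
  have Gc: "has_weak_gradient \<Omega> (\<lambda>x. c * u x) (\<lambda>x. c *\<^sub>R G x)" using G by (rule has_weak_gradient_scale)
  have um[measurable]: "u \<in> borel_measurable (lebesgue_on \<Omega>)" using u by (auto simp: finite_energy_def)
  note m[measurable] = grad_energy_measurable[OF G] grad_energy_measurable[OF Gc] W_meas
  have eq: "W x * \<bar>c * u x\<bar> powr p = \<bar>c\<bar> powr p * (W x * \<bar>u x\<bar> powr p)" for x
    by (simp add: abs_mult powr_mult)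
  have "integrable (lebesgue_on \<Omega>) (grad_energy (\<lambda>x. c * u x)) \<longleftrightarrow>
      integrable (lebesgue_on \<Omega>) (\<lambda>x. \<bar>c\<bar> powr p * grad_energy u x)"
    by (rule integrable_cong_AE) (use grad_energy_scale[OF G] in auto)
  then show "(\<lambda>x. c * u x) \<in> finite_energy W"
    using u Gc by (auto simp: finite_energy_def eq)
  have "energy W (\<lambda>x. c * u x) = (LINT x|lebesgue_on \<Omega>. \<bar>c\<bar> powr p * (grad_energy u x + W x * \<bar>u x\<bar> powr p))"
    unfolding energy_def
  proof (rule integral_cong_AE)
    show "AE x in lebesgue_on \<Omega>. grad_energy (\<lambda>x. c * u x) x + W x * \<bar>c * u x\<bar> powr p =
        \<bar>c\<bar> powr p * (grad_energy u x + W x * \<bar>u x\<bar> powr p)"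
      using grad_energy_scale[OF G, of c] by eventually_elim (simp add: eq distrib_left)
  qed measurable
  then show "energy W (\<lambda>x. c * u x) = \<bar>c\<bar> powr p * energy W u" by (simp add: energy_def)
qed

text \<open>The \<open>p\<close>-th power of a norm is convex at each point. The same pointwise
  bounds give first integrability of the combination and then the inequality of the
  energies.\<close>

lemma finite_energy_convex:
  assumes u: "u \<in> finite_energy W" and v: "v \<in> finite_energy W" and t: "0 \<le> t" "t \<le> 1"
  shows "(\<lambda>x. t * u x + (1 - t) * v x) \<in> finite_energy W"
    "energy W (\<lambda>x. t * u x + (1 - t) * v x) \<le> t * energy W u + (1 - t) * energy W v"
proof -
  let ?M = "lebesgue_on \<Omega>" and ?w = "\<lambda>x. t * u x + (1 - t) * v x"
  obtain G G' where G: "has_weak_gradient \<Omega> u G" "has_weak_gradient \<Omega> v G'"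
    using u v by (auto simp: finite_energy_def)
  have Gw: "has_weak_gradient \<Omega> ?w (\<lambda>x. t *\<^sub>R G x + (1 - t) *\<^sub>R G' x)"
    by (intro has_weak_gradient_add has_weak_gradient_scale G open_\<Omega>)
  have um[measurable]: "u \<in> borel_measurable ?M" "v \<in> borel_measurable ?M"
    using u v by (auto simp: finite_energy_def)
  note m[measurable] = grad_energy_measurable[OF Gw] W_meas
  have ge: "AE x in ?M. grad_energy ?w x \<le> t * grad_energy u x + (1 - t) * grad_energy v x"
    by (rule grad_energy_convex[OF G t])
  have We: "AE x in ?M. 0 \<le> W x * \<bar>?w x\<bar> powr p \<and>
      W x * \<bar>?w x\<bar> powr p \<le> t * (W x * \<bar>u x\<bar> powr p) + (1 - t) * (W x * \<bar>v x\<bar> powr p)"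
    using W_nonneg
  proof eventually_elim
    case (elim x)
    have "\<bar>?w x\<bar> powr p \<le> (t * \<bar>u x\<bar> + (1 - t) * \<bar>v x\<bar>) powr p"
      using p t by (intro powr_mono2) (auto simp: abs_mult intro: order_trans[OF abs_triangle_ineq])
    also have "\<dots> \<le> t * \<bar>u x\<bar> powr p + (1 - t) * \<bar>v x\<bar> powr p"
      using p t by (intro powr_convex_combination) auto
    finally have "W x * \<bar>?w x\<bar> powr p \<le> W x * (t * \<bar>u x\<bar> powr p + (1 - t) * \<bar>v x\<bar> powr p)"
      using elim by (rule mult_left_mono)
    then show ?case using elim by (simp add: algebra_simps)
  qed
  have iu: "integrable ?M (grad_energy u)" "integrable ?M (\<lambda>x. W x * \<bar>u x\<bar> powr p)"
    and iv: "integrable ?M (grad_energy v)" "integrable ?M (\<lambda>x. W x * \<bar>v x\<bar> powr p)"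
    using u v by (auto simp: finite_energy_def)
  have "integrable ?M (grad_energy ?w)"
  proof (rule Bochner_Integration.integrable_bound)
    show "integrable ?M (\<lambda>x. t * grad_energy u x + (1 - t) * grad_energy v x)" using iu iv by simp
    show "AE x in ?M. norm (grad_energy ?w x) \<le> norm (t * grad_energy u x + (1 - t) * grad_energy v x)"
      using ge by eventually_elim (use grad_energy_nonneg in \<open>simp add: order_trans[OF _ abs_ge_self]\<close>)
  qed measurable
  moreover have "integrable ?M (\<lambda>x. W x * \<bar>?w x\<bar> powr p)"
  proof (rule Bochner_Integration.integrable_bound)
    show "integrable ?M (\<lambda>x. t * (W x * \<bar>u x\<bar> powr p) + (1 - t) * (W x * \<bar>v x\<bar> powr p))" using iu iv by simp
    show "AE x in ?M. norm (W x * \<bar>?w x\<bar> powr p) \<le> norm (t * (W x * \<bar>u x\<bar> powr p) + (1 - t) * (W x * \<bar>v x\<bar> powr p))"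
      using We by eventually_elim (unfold real_norm_def, linarith)
  qed measurable
  ultimately show w: "?w \<in> finite_energy W"
    using Gw unfolding finite_energy_def by auto
  have "energy W ?w \<le> (LINT x|?M. t * (grad_energy u x + W x * \<bar>u x\<bar> powr p) + (1 - t) * (grad_energy v x + W x * \<bar>v x\<bar> powr p))"
    unfolding energy_def
  proof (rule integral_mono_AE)
    show "integrable ?M (\<lambda>x. grad_energy ?w x + W x * \<bar>?w x\<bar> powr p)" by (rule finite_energy_integrable[OF w])
    show "integrable ?M (\<lambda>x. t * (grad_energy u x + W x * \<bar>u x\<bar> powr p) + (1 - t) * (grad_energy v x + W x * \<bar>v x\<bar> powr p))"
      by (intro Bochner_Integration.integrable_add integrable_mult_right iu iv)
    show "AE x in ?M. grad_energy ?w x + W x * \<bar>?w x\<bar> powr p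
        \<le> t * (grad_energy u x + W x * \<bar>u x\<bar> powr p) + (1 - t) * (grad_energy v x + W x * \<bar>v x\<bar> powr p)"
      using ge We by eventually_elim (simp add: algebra_simps)
  qed
  also have "\<dots> = t * energy W u + (1 - t) * energy W v"
    unfolding energy_def using finite_energy_integrable[OF u] finite_energy_integrable[OF v]
    by (subst Bochner_Integration.integral_add) auto
  finally show "energy W ?w \<le> t * energy W u + (1 - t) * energy W v" .
qed

lemma seminorm_on_energy: "seminorm_on (finite_energy W) (\<lambda>u. energy W u powr (1 / p))"
  by (rule seminorm_on_powr_inverse[OF p])
     (rule energy_nonneg finite_energy_scale finite_energy_convex; assumption)+

end

end

section \<open>Smooth approximation of Sobolev functions\<close>

text \<open>Jensen's inequality for the probability density \<^term>\<open>\<lambda>y. \<rho> (x - y)\<close>.\<close>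
lemma conv_powr_le:
  fixes f :: "real^'n \<Rightarrow> real"
  assumes f: "integrable lebesgue f" "integrable lebesgue (\<lambda>x. \<bar>f x\<bar> powr p)" and p: "1 < p"
    and \<rho>: "mollifier \<epsilon> \<rho>"
  shows "\<bar>conv f \<rho> x\<bar> powr p \<le> conv (\<lambda>x. \<bar>f x\<bar> powr p) \<rho> x"
proof -
  note D = mollifierD[OF \<rho>]
  have [measurable]: "\<rho> \<in> borel_measurable borel" by (rule D)
  define s where "s = conv (\<lambda>y. \<bar>f y\<bar>) \<rho> x"
  have \<rho>i: "integrable lebesgue (\<lambda>y. \<rho> (x - y))" "(LINT y|lebesgue. \<rho> (x - y)) = 1"
  proof -
    have m: "(\<lambda>y. \<rho> (x - y)) \<in> borel_measurable lborel" by measurable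
    have "integrable lborel (\<lambda>y. \<rho> (x - y))"
    proof (rule integrable_lborel_continuous_compact_support[OF _ compact_cball[of x \<epsilon>]])
      show "continuous_on UNIV (\<lambda>y. \<rho> (x - y))" by (intro continuous_on_compose2[OF D(2)] continuous_intros) auto
      show "\<rho> (x - y) = 0" if "y \<notin> cball x \<epsilon>" for y using that D(4)[of "x - y"] by (simp add: dist_norm)
    qed
    then show "integrable lebesgue (\<lambda>y. \<rho> (x - y))" using m by (simp add: integrable_completion)
    show "(LINT y|lebesgue. \<rho> (x - y)) = 1"
      using m by (simp add: integral_completion integral_lborel_minus D(8))
  qed
  have fi: "integrable lebesgue (\<lambda>y. \<bar>f y\<bar> * \<rho> (x - y))" "integrable lebesgue (\<lambda>y. \<bar>f y\<bar> powr p * \<rho> (x - y))"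
    using conv_integrable[OF integrable_abs[OF f(1)] \<rho>] conv_integrable[OF f(2) \<rho>] .
  have "\<bar>conv f \<rho> x\<bar> \<le> (LINT y|lebesgue. \<bar>f y * \<rho> (x - y)\<bar>)"
    unfolding conv_def by (rule integral_abs_bound)
  also have "\<dots> = s" using D(3) by (simp add: s_def conv_def abs_mult)
  finally have le_s: "\<bar>conv f \<rho> x\<bar> \<le> s" .
  then have s: "s \<ge> 0" by simp
  \<comment> \<open>The last bracket is zero, because \<open>s\<close> is the mean of
    \<open>\<bar>f\<bar>\<close> for a density of total mass one. Adding it produces the tangent
    line at \<open>s\<close> under the integral.\<close>
  have "s powr p = s powr p * (LINT y|lebesgue. \<rho> (x - y)) +
      p * s powr (p - 1) * ((LINT y|lebesgue. \<bar>f y\<bar> * \<rho> (x - y)) - s * (LINT y|lebesgue. \<rho> (x - y)))"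
    by (simp add: \<rho>i s_def conv_def)
  also have "\<dots> = (LINT y|lebesgue. s powr p * \<rho> (x - y) + p * s powr (p - 1) * (\<bar>f y\<bar> * \<rho> (x - y) - s * \<rho> (x - y)))"
    using fi(1) \<rho>i(1) by simp
  also have "\<dots> \<le> (LINT y|lebesgue. \<bar>f y\<bar> powr p * \<rho> (x - y))"
  proof (rule integral_mono)
    fix y
    have "(s powr p + p * s powr (p - 1) * (\<bar>f y\<bar> - s)) * \<rho> (x - y) \<le> \<bar>f y\<bar> powr p * \<rho> (x - y)"
      by (intro mult_right_mono powr_above_tangent s p D(3)) auto
    then show "s powr p * \<rho> (x - y) + p * s powr (p - 1) * (\<bar>f y\<bar> * \<rho> (x - y) - s * \<rho> (x - y))
        \<le> \<bar>f y\<bar> powr p * \<rho> (x - y)"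
      by (simp add: algebra_simps)
  qed (use fi \<rho>i(1) in auto)
  also have "\<dots> = conv (\<lambda>x. \<bar>f x\<bar> powr p) \<rho> x" by (simp add: conv_def)
  finally show ?thesis
    using powr_mono2[of p "\<bar>conv f \<rho> x\<bar>" s] le_s p by simp
qed

text \<open>Splitting \<open>f n = min (f n) g + max 0 (f n - g)\<close>
  reduces the claim to ordinary dominated convergence.\<close>
lemma integral_tendsto_moving_dominant:
  fixes f g :: "nat \<Rightarrow> 'a \<Rightarrow> real"
  assumes meas: "\<And>n. f n \<in> borel_measurable M" "f' \<in> borel_measurable M"
    and int: "\<And>n. integrable M (g n)" "integrable M g'"
    and bound: "\<And>n. AE x in M. 0 \<le> f n x \<and> f n x \<le> g n x" "AE x in M. f' x \<le> g' x"
    and g: "(\<lambda>n. LINT x|M. \<bar>g n x - g' x\<bar>) \<longlonglongrightarrow> 0"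
    and lim: "AE x in M. (\<lambda>n. f n x) \<longlonglongrightarrow> f' x"
  shows "(\<lambda>n. LINT x|M. f n x) \<longlonglongrightarrow> (LINT x|M. f' x)"
proof -
  note [measurable] = meas borel_measurable_integrable[OF int(1)] borel_measurable_integrable[OF int(2)]
  have fi: "integrable M (f n)" for n
  proof (rule Bochner_Integration.integrable_bound[OF int(1)[of n]])
    show "AE x in M. norm (f n x) \<le> norm (g n x)"
      using bound(1)[of n] by eventually_elim simp
  qed (rule meas)
  have allb: "AE x in M. \<forall>n. 0 \<le> f n x \<and> f n x \<le> g n x" using bound(1) by (subst AE_all_countable) auto
  have nn: "AE x in M. 0 \<le> f' x"
    using allb lim by eventually_elim (auto intro: LIMSEQ_le_const)
  define m where "m = (\<lambda>n x. min (f n x) (g' x))"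
  have mm[measurable]: "m n \<in> borel_measurable M" for n unfolding m_def by measurable
  have mb: "AE x in M. norm (m n x) \<le> \<bar>g' x\<bar>" for n
    using bound(1)[of n] nn bound(2) by eventually_elim (auto simp: m_def)
  have mi: "integrable M (m n)" for n
    by (rule Bochner_Integration.integrable_bound[OF integrable_abs[OF int(2)]]) (use mb in auto)
  have m_lim: "(\<lambda>n. LINT x|M. m n x) \<longlonglongrightarrow> (LINT x|M. f' x)"
  proof (rule integral_dominated_convergence[where w = "\<lambda>x. \<bar>g' x\<bar>"])
    show "AE x in M. (\<lambda>n. m n x) \<longlonglongrightarrow> f' x"
      using lim bound(2)
    proof eventually_elim
      case (elim x)
      have "(\<lambda>n. m n x) \<longlonglongrightarrow> min (f' x) (g' x)" unfolding m_def by (intro tendsto_intros elim)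
      then show ?case using elim(2) by (simp add: min_absorb1)
    qed
  qed (use int mb in auto)
  \<comment> \<open>Since \<open>f n \<le> g n\<close>, the excess of \<open>f n\<close> over
    \<open>g'\<close> is at most \<open>\<bar>g n - g'\<bar>\<close>, whose integral tends to
    0.\<close>
  have diff: "0 \<le> (LINT x|M. f n x) - (LINT x|M. m n x) \<and> (LINT x|M. f n x) - (LINT x|M. m n x) \<le> (LINT x|M. \<bar>g n x - g' x\<bar>)" for n
  proof
    have "(LINT x|M. m n x) \<le> (LINT x|M. f n x)"
      by (intro integral_mono mi fi) (simp add: m_def)
    then show "0 \<le> (LINT x|M. f n x) - (LINT x|M. m n x)" by simp
    have "(LINT x|M. f n x) - (LINT x|M. m n x) = (LINT x|M. f n x - m n x)"
      using fi mi by simp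
    also have "\<dots> \<le> (LINT x|M. \<bar>g n x - g' x\<bar>)"
      by (intro integral_mono_AE Bochner_Integration.integrable_diff fi mi integrable_abs int)
         (use bound(1)[of n] in \<open>eventually_elim, auto simp: m_def\<close>)
    finally show "(LINT x|M. f n x) - (LINT x|M. m n x) \<le> (LINT x|M. \<bar>g n x - g' x\<bar>)" .
  qed
  have "(\<lambda>n. (LINT x|M. f n x) - (LINT x|M. m n x)) \<longlonglongrightarrow> 0"
    by (rule tendsto_sandwich[OF _ _ tendsto_const g]) (use diff in auto)
  from tendsto_add[OF this m_lim] show ?thesis by simp
qed

section \<open>Algebra of compactly supported Sobolev functions\<close>

lemma CcD:
  assumes "u \<in> Cc \<Omega>"
  shows "continuous_on UNIV u" "compact (closure {x. u x \<noteq> 0})" "closure {x. u x \<noteq> 0} \<subseteq> \<Omega>"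
    "x \<notin> closure {x. u x \<noteq> 0} \<Longrightarrow> u x = 0"
  using assms closure_subset[of "{x. u x \<noteq> 0}"] by (auto simp: Cc_def compactly_inside_def)

lemma CcI:
  fixes u :: "'a::t2_space \<Rightarrow> real"
  assumes "continuous_on UNIV u" "compact K" "K \<subseteq> \<Omega>" "\<And>x. x \<notin> K \<Longrightarrow> u x = 0"
  shows "u \<in> Cc \<Omega>"
proof -
  have "closure {x. u x \<noteq> 0} \<subseteq> K"
    using assms(4) by (intro closure_minimal compact_imp_closed[OF assms(2)]) auto
  moreover have "compact (K \<inter> closure {x. u x \<noteq> 0})"
    by (intro compact_Int_closed assms closed_closure)
  ultimately show ?thesis
    using assms(1,3) unfolding Cc_def compactly_inside_def by (simp add: inf_absorb2)
qed

lemma Cc_lincomb: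
  fixes u v :: "'a::t2_space \<Rightarrow> real"
  assumes "u \<in> Cc \<Omega>" "v \<in> Cc \<Omega>"
  shows "(\<lambda>x. a * u x + b * v x) \<in> Cc \<Omega>"
proof (rule CcI)
  show "continuous_on UNIV (\<lambda>x. a * u x + b * v x)" using CcD(1) assms by (intro continuous_intros)
  show "compact (closure {x. u x \<noteq> 0} \<union> closure {x. v x \<noteq> 0})" using CcD(2) assms by (intro compact_Un)
  show "closure {x. u x \<noteq> 0} \<union> closure {x. v x \<noteq> 0} \<subseteq> \<Omega>" using CcD(3) assms by blast
  show "a * u x + b * v x = 0" if "x \<notin> closure {x. u x \<noteq> 0} \<union> closure {x. v x \<noteq> 0}" for x
  proof -
    have "x \<notin> closure {x. u x \<noteq> 0}" "x \<notin> closure {x. v x \<noteq> 0}" using that by blast+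
    then have "u x = 0" "v x = 0" using CcD(4) assms by blast+
    then show ?thesis by simp
  qed
qed

lemma continuous_on_abs_powr:
  fixes u :: "'a::topological_space \<Rightarrow> real"
  assumes "continuous_on S u" "0 < p"
  shows "continuous_on S (\<lambda>x. \<bar>u x\<bar> powr p)"
  using assms by (intro continuous_on_powr' continuous_intros) auto

lemma Lp_continuous_compact_support:
  fixes f :: "real^'n \<Rightarrow> 'b::euclidean_space"
  assumes "open \<Omega>" "continuous_on UNIV f" "compact K" "K \<subseteq> \<Omega>" "\<And>x. x \<notin> K \<Longrightarrow> f x = 0" "0 < p"
  shows "f \<in> Lp p \<Omega>"
proof -
  have m: "f \<in> borel_measurable borel" using assms(2) by (rule borel_measurable_continuous_onI)
  then have "f \<in> borel_measurable lebesgue" by (simp add: measurable_completion)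
  moreover have c: "continuous_on UNIV (\<lambda>x. norm (f x) powr p)"
    using continuous_on_abs_powr[OF continuous_on_norm[OF assms(2)] assms(6)] by simp
  have "integrable lborel (\<lambda>x. norm (f x) powr p)"
    by (rule integrable_lborel_continuous_compact_support[OF c assms(3)]) (use assms(5) in simp)
  then have "integrable lebesgue (\<lambda>x. norm (f x) powr p)"
    using continuous_on_UNIV_borel[OF c] by (simp add: integrable_completion)
  moreover have "norm (f x) powr p = 0" if "x \<notin> \<Omega>" for x using assms(4,5) that by auto
  ultimately show ?thesis
    using assms(1) unfolding Lp_def
    by (auto simp: integral_lebesgue_on_eq(2) intro: measurable_restrict_space1)
qed

text \<open>Both terms are bounded by the larger of the two norms, whose \<open>p\<close>-th power
  is at most the sum of the two powers; this is the origin of the constant \<open>c\<close>.\<close>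

lemma Lp_lincomb:
  assumes f: "f \<in> Lp p S" and g: "g \<in> Lp p S" and p: "0 < p"
  shows "(\<lambda>x. a *\<^sub>R f x + b *\<^sub>R g x) \<in> Lp p S"
proof -
  have fm: "f \<in> borel_measurable (lebesgue_on S)" "g \<in> borel_measurable (lebesgue_on S)"
    and fi: "integrable (lebesgue_on S) (\<lambda>x. norm (f x) powr p)" "integrable (lebesgue_on S) (\<lambda>x. norm (g x) powr p)"
    using f g by (auto simp: Lp_def)
  define c where "c = (\<bar>a\<bar> + \<bar>b\<bar>) powr p"
  have le: "norm (a *\<^sub>R f x + b *\<^sub>R g x) powr p \<le> c * (norm (f x) powr p + norm (g x) powr p)" for x
  proof -
    define m where "m = max (norm (f x)) (norm (g x))"
    have m: "norm (f x) \<le> m" "norm (g x) \<le> m" "0 \<le> m" by (auto simp: m_def le_max_iff_disj)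
    have "norm (a *\<^sub>R f x + b *\<^sub>R g x) \<le> \<bar>a\<bar> * norm (f x) + \<bar>b\<bar> * norm (g x)"
      using norm_triangle_ineq[of "a *\<^sub>R f x" "b *\<^sub>R g x"] by simp
    also have "\<dots> \<le> \<bar>a\<bar> * m + \<bar>b\<bar> * m" by (intro add_mono mult_left_mono m) auto
    finally have "norm (a *\<^sub>R f x + b *\<^sub>R g x) \<le> (\<bar>a\<bar> + \<bar>b\<bar>) * m" by (simp add: distrib_right)
    then have "norm (a *\<^sub>R f x + b *\<^sub>R g x) powr p \<le> ((\<bar>a\<bar> + \<bar>b\<bar>) * m) powr p"
      using p by (intro powr_mono2) auto
    also have "\<dots> = c * m powr p" using m by (simp add: powr_mult c_def)
    also have "m powr p \<le> norm (f x) powr p + norm (g x) powr p" by (auto simp: m_def max_def)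
    finally show ?thesis by (simp add: c_def mult_left_mono)
  qed
  have "integrable (lebesgue_on S) (\<lambda>x. norm (a *\<^sub>R f x + b *\<^sub>R g x) powr p)"
  proof (rule Bochner_Integration.integrable_bound)
    show "integrable (lebesgue_on S) (\<lambda>x. c * (norm (f x) powr p + norm (g x) powr p))"
      using fi by simp
    have "c \<ge> 0" by (simp add: c_def)
    then show "AE x in lebesgue_on S. norm (norm (a *\<^sub>R f x + b *\<^sub>R g x) powr p)
        \<le> norm (c * (norm (f x) powr p + norm (g x) powr p))"
      using le by (intro AE_I2) (simp add: abs_mult)
    show "(\<lambda>x. norm (a *\<^sub>R f x + b *\<^sub>R g x) powr p) \<in> borel_measurable (lebesgue_on S)"
      using fm by measurable
  qed
  then show ?thesis using fm unfolding Lp_def by auto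
qed

lemma W1p_Cc_lincomb:
  fixes u v :: "real^'n \<Rightarrow> real"
  assumes \<Omega>: "open \<Omega>" and p: "0 < p" and u: "u \<in> W1p p \<Omega> \<inter> Cc \<Omega>" and v: "v \<in> W1p p \<Omega> \<inter> Cc \<Omega>"
  shows "(\<lambda>x. a * u x + b * v x) \<in> W1p p \<Omega> \<inter> Cc \<Omega>"
proof -
  obtain G G' where G: "has_weak_gradient \<Omega> u G" "G \<in> Lp p \<Omega>" and G': "has_weak_gradient \<Omega> v G'" "G' \<in> Lp p \<Omega>"
    using u v by (auto simp: W1p_def)
  have "has_weak_gradient \<Omega> (\<lambda>x. a * u x + b * v x) (\<lambda>x. a *\<^sub>R G x + b *\<^sub>R G' x)"
    by (intro has_weak_gradient_add has_weak_gradient_scale G G' \<Omega>)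
  moreover have "(\<lambda>x. a *\<^sub>R G x + b *\<^sub>R G' x) \<in> Lp p \<Omega>" by (intro Lp_lincomb G G' p)
  moreover have "(\<lambda>x. a * u x + b * v x) \<in> Lp p \<Omega>"
    using Lp_lincomb[of u p \<Omega> v a b] u v p by (simp add: W1p_def)
  moreover have "(\<lambda>x. a * u x + b * v x) \<in> Cc \<Omega>" using u v by (intro Cc_lincomb) simp_all
  ultimately show ?thesis unfolding W1p_def by blast
qed

lemma Cc_infty_subset_W1p_Cc:
  assumes "open \<Omega>" "\<phi> \<in> Cc_infty \<Omega>" "0 < p"
  shows "\<phi> \<in> W1p p \<Omega> \<inter> Cc \<Omega>"
proof -
  note D = Cc_inftyD[OF assms(2)]
  have gc: "continuous_on UNIV (gradient \<phi>)"
    using continuous_on_vec_lambda[of UNIV "\<lambda>i z. gradient \<phi> z $ i"] D(7) by simp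
  have "\<phi> \<in> Cc \<Omega>" using D(2,3,6) by (simp add: Cc_def compactly_inside_def)
  moreover have "\<phi> \<in> Lp p \<Omega>"
    by (rule Lp_continuous_compact_support[OF assms(1) D(6,2,3,4) assms(3)])
  moreover have "gradient \<phi> \<in> Lp p \<Omega>"
    by (rule Lp_continuous_compact_support[OF assms(1) gc D(2,3,5) assms(3)])
  ultimately show ?thesis
    using has_weak_gradient_C1[OF assms(1) D(1)] unfolding W1p_def by blast
qed

text \<open>\<open>K'\<close> will hold the supports of all mollifications of radius at most
  \<open>d\<close> of a function supported in \<open>K\<close>. The last property makes mollifiers
  centred near \<open>K\<close> admissible test functions. Halving an admissible radius leaves room
  for both.\<close>

lemma compact_neighbourhood:
  fixes K :: "'a::euclidean_space set"
  assumes "compact K" "open \<Omega>" "K \<subseteq> \<Omega>"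
  obtains d K' where "d > 0" "compact K'" "K' \<subseteq> \<Omega>" "\<And>x y. x \<in> K \<Longrightarrow> dist x y \<le> d \<Longrightarrow> y \<in> K'"
    "\<And>x y. x \<in> K \<Longrightarrow> dist x y \<le> d \<Longrightarrow> cball y d \<subseteq> \<Omega>"
proof -
  obtain e where e: "e > 0" "(\<Union>x\<in>K. cball x e) \<subseteq> \<Omega>"
    using compact_subset_open_imp_cball_epsilon_subset[OF assms] by blast
  show ?thesis
  proof (rule that[of "e / 2" "{x + y | x y. x \<in> K \<and> y \<in> cball 0 (e / 2)}"])
    show "compact {x + y | x y. x \<in> K \<and> y \<in> cball 0 (e / 2)}"
      by (intro compact_sums assms compact_cball)
    show "{x + y | x y. x \<in> K \<and> y \<in> cball 0 (e / 2)} \<subseteq> \<Omega>"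
    proof safe
      fix x y :: 'a assume "x \<in> K" "y \<in> cball 0 (e / 2)"
      then have "x + y \<in> cball x e" using e by (simp add: dist_norm)
      then show "x + y \<in> \<Omega>" using e \<open>x \<in> K\<close> by blast
    qed
    fix x y assume xy: "x \<in> K" "dist x y \<le> e / 2"
    have "y = x + (y - x)" "y - x \<in> cball 0 (e / 2)" using xy by (auto simp: dist_norm norm_minus_commute)
    then show "y \<in> {x + y | x y. x \<in> K \<and> y \<in> cball 0 (e / 2)}" using xy by blast
    have "cball y (e / 2) \<subseteq> cball x e"
    proof
      fix z assume "z \<in> cball y (e / 2)"
      then show "z \<in> cball x e" using dist_triangle[of x z y] xy by simp
    qed
    then show "cball y (e / 2) \<subseteq> \<Omega>" using e xy by blast
  qed (use e in auto)
qed

section \<open>Estimates for mollified gradients\<close>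

lemma integral_lebesgue_on_le:
  fixes f :: "'a::euclidean_space \<Rightarrow> real"
  assumes "integrable lebesgue f" "S \<in> sets lebesgue"
  shows "integrable (lebesgue_on S) f" "(\<And>x. 0 \<le> f x) \<Longrightarrow> (LINT x|lebesgue_on S. f x) \<le> (LINT x|lebesgue. f x)"
proof -
  have i: "integrable lebesgue (\<lambda>x. indicator S x *\<^sub>R f x)"
    by (rule integrable_mult_indicator[OF assms(2,1)])
  then show "integrable (lebesgue_on S) f"
    using assms(2) by (subst integrable_restrict_space) auto
  assume nn: "\<And>x. 0 \<le> f x"
  have "(LINT x|lebesgue_on S. f x) = (LINT x|lebesgue. indicator S x *\<^sub>R f x)"
    using assms(2) by (subst integral_restrict_space) auto
  also have "\<dots> \<le> (LINT x|lebesgue. f x)"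
    by (rule integral_mono[OF i assms(1)]) (use nn in \<open>simp add: indicator_def\<close>)
  finally show "(LINT x|lebesgue_on S. f x) \<le> (LINT x|lebesgue. f x)" .
qed

text \<open>Allows gradients to be estimated one component at a time; the crude constant comes from
  bounding the norm by the dimension times the largest component.\<close>

lemma norm_powr_le_sum:
  fixes v :: "real^'n"
  assumes "0 < p"
  shows "norm v powr p \<le> real CARD('n) powr p * (\<Sum>i\<in>UNIV. \<bar>v $ i\<bar> powr p)"
proof -
  have "Max (range (\<lambda>i. \<bar>v $ i\<bar>)) \<in> range (\<lambda>i. \<bar>v $ i\<bar>)" by (rule Max_in) auto
  then obtain k where k: "Max (range (\<lambda>i. \<bar>v $ i\<bar>)) = \<bar>v $ k\<bar>" by blast
  have j: "\<bar>v $ i\<bar> \<le> \<bar>v $ k\<bar>" for i unfolding k[symmetric] by (rule Max_ge) auto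
  have "norm v \<le> (\<Sum>i\<in>UNIV. \<bar>v $ i\<bar>)" by (rule norm_le_l1_cart)
  also have "\<dots> \<le> (\<Sum>i\<in>(UNIV :: 'n set). \<bar>v $ k\<bar>)" by (intro sum_mono j)
  finally have "norm v powr p \<le> (real CARD('n) * \<bar>v $ k\<bar>) powr p"
    using assms by (intro powr_mono2) auto
  also have "\<dots> = real CARD('n) powr p * \<bar>v $ k\<bar> powr p" by (simp add: powr_mult)
  also have "\<bar>v $ k\<bar> powr p \<le> (\<Sum>i\<in>UNIV. \<bar>v $ i\<bar> powr p)"
    by (rule member_le_sum) auto
  finally show ?thesis by (simp add: mult_left_mono)
qed

text \<open>Near \<open>K\<close> the reflected mollifier is a test function, and the definition of
  the weak gradient moves the derivative from the mollifier to \<open>u\<close>. Far from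
  \<open>K\<close> both sides vanish. The indicator turns the components of \<open>G\<close> into
  functions on the whole space and changes them only on a null subset of
  \<open>\<Omega>\<close>.\<close>

lemma gradient_conv:
  fixes u :: "real^'n \<Rightarrow> real"
  assumes \<Omega>: "open \<Omega>" and u: "continuous_on UNIV u" and G: "has_weak_gradient \<Omega> u G"
    and K: "compact K" "K \<subseteq> \<Omega>" "\<And>x. x \<notin> K \<Longrightarrow> u x = 0" and \<rho>: "mollifier \<epsilon> \<rho>"
    and near: "\<And>x y. x \<in> K \<Longrightarrow> dist x y \<le> \<epsilon> \<Longrightarrow> cball y \<epsilon> \<subseteq> \<Omega>"
  shows "gradient (conv u \<rho>) x $ i = conv (\<lambda>y. indicator K y * G y $ i) \<rho> x"
proof -
  note D = mollifierD[OF \<rho>]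
  obtain R where R: "\<And>x. x \<in> K \<Longrightarrow> norm x \<le> R"
    using compact_imp_bounded[OF K(1)] unfolding bounded_iff by blast
  have "GDERIV (conv u \<rho>) x :> (\<chi> i. conv u (\<lambda>z. gradient \<rho> z $ i) x)"
    by (rule GDERIV_conv[OF u _ D(1), of R]) (use R K(3) in force)
  then have eq: "gradient (conv u \<rho>) x $ i = conv u (\<lambda>z. gradient \<rho> z $ i) x"
    by (simp add: gradient_eqI)
  show ?thesis
  proof (cases "\<exists>y\<in>K. dist y x \<le> \<epsilon>")
    case True
    then have sub: "cball x \<epsilon> \<subseteq> \<Omega>" using near by blast
    define \<phi> where "\<phi> = (\<lambda>y. \<rho> (x - y))"
    have \<phi>: "\<phi> \<in> Cc_infty \<Omega>" unfolding \<phi>_def by (rule Cc_infty_reflected_mollifier[OF \<rho> sub])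
    have g\<phi>: "gradient \<phi> y = - gradient \<rho> (x - y)" for y
      unfolding \<phi>_def by (intro gradient_eqI GDERIV_reflect Ck_1_GDERIV D)
    have L: "u \<in> L1_loc \<Omega>" "(\<lambda>x. G x $ i) \<in> L1_loc \<Omega>"
      using G by (auto simp: has_weak_gradient_def intro: L1_loc_component)
    \<comment> \<open>Reflecting the mollifier produces one minus sign and the weak gradient
      identity the other.\<close>
    have "conv u (\<lambda>z. gradient \<rho> z $ i) x = (LINT y|lebesgue. - (u y * gradient \<phi> y $ i))"
      by (simp add: conv_def g\<phi>)
    also have "\<dots> = - (LINT y|lebesgue. u y * gradient \<phi> y $ i)" by simp
    also have "(LINT y|lebesgue. u y * gradient \<phi> y $ i) = (LINT y|lebesgue_on \<Omega>. u y * gradient \<phi> y $ i)"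
      using \<Omega> K(2,3) by (intro integral_lebesgue_on_eq(1)[symmetric]) auto
    also have "\<dots> = - (LINT y|lebesgue_on \<Omega>. G y $ i * \<phi> y)"
      using G \<phi> by (simp add: has_weak_gradient_def)
    also have "(LINT y|lebesgue_on \<Omega>. G y $ i * \<phi> y) = (LINT y|lebesgue_on \<Omega>. indicator K y * G y $ i * \<phi> y)"
    proof (rule integral_cong_AE)
      have [measurable]: "(\<lambda>y. G y $ i * \<phi> y) \<in> borel_measurable (lebesgue_on \<Omega>)"
        using L1_loc_Cc_infty_integrable(1)[OF L(2) \<Omega> \<phi>] by auto
      then show "(\<lambda>y. G y $ i * \<phi> y) \<in> borel_measurable (lebesgue_on \<Omega>)" .
      have [measurable]: "K \<in> sets lebesgue" using K(1) by (simp add: lmeasurable_compact fmeasurableD)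
      have "indicator K \<in> borel_measurable (lebesgue_on \<Omega>)" by (rule measurable_restrict_space1) measurable
      then have "(\<lambda>y. indicator K y * (G y $ i * \<phi> y)) \<in> borel_measurable (lebesgue_on \<Omega>)" by measurable
      then show "(\<lambda>y. indicator K y * G y $ i * \<phi> y) \<in> borel_measurable (lebesgue_on \<Omega>)"
        by (simp add: mult.assoc)
      show "AE y in lebesgue_on \<Omega>. G y $ i * \<phi> y = indicator K y * G y $ i * \<phi> y"
        using weak_gradient_zero_outside[OF \<Omega> G compact_imp_closed[OF K(1)], OF K(3), simplified]
        by eventually_elim (auto simp: indicator_def)
    qed
    also have "\<dots> = (LINT y|lebesgue. indicator K y * G y $ i * \<phi> y)"
      using \<Omega> K(2) by (intro integral_lebesgue_on_eq(1)) (auto simp: indicator_def)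
    finally show ?thesis by (simp add: eq conv_def \<phi>_def)
  next
    case False
    have "conv (\<lambda>y. indicator K y * G y $ i) \<rho> x = 0"
      by (rule conv_eq_0[OF _ \<rho>]) (use False in \<open>force simp: dist_norm norm_minus_commute indicator_def\<close>)
    moreover have "(\<lambda>y. u y * gradient \<rho> (x - y) $ i) = (\<lambda>y. 0)"
    proof
      fix y
      show "u y * gradient \<rho> (x - y) $ i = 0"
      proof (cases "y \<in> K")
        case True
        then have "x - y \<notin> cball 0 \<epsilon>" using False by (auto simp: dist_norm norm_minus_commute)
        moreover have "\<rho> z = 0" if "z \<notin> cball 0 \<epsilon>" for z using that D(4)[of z] by simp
        ultimately have "gradient \<rho> (x - y) = 0"
          by (intro gradient_eqI GDERIV_zero_outside[OF closed_cball[of 0 \<epsilon>]])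
        then show ?thesis by simp
      qed (simp add: K(3))
    qed
    ultimately show ?thesis by (simp add: eq conv_def)
  qed
qed

text \<open>Admissibility bounds \<open>H\<close> on domains compactly inside
  \<open>\<Omega>\<close>, whereas supports are compact sets;
  \<open>admissible_norm_family_upper_bound\<close> passes from one to the other.\<close>

locale locally_bounded_norm_energy = norm_energy \<Omega> H p
  for \<Omega> :: "(real^'n) set" and H :: "real^'n \<Rightarrow> real^'n \<Rightarrow> real" and p :: real +
  assumes H_loc: "compact K \<Longrightarrow> K \<subseteq> \<Omega> \<Longrightarrow>
    \<exists>\<nu>>0. AE x in lebesgue_on \<Omega>. x \<in> K \<longrightarrow> (\<forall>\<xi>. H x \<xi> \<le> \<nu> * norm \<xi>)"
begin

lemma p_pos: "0 < p"
  using p by simp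

text \<open>The weak gradient vanishes off the support of \<open>u\<close>, and on the support
  \<open>H\<close> is at most a multiple of the Euclidean norm. For the other term, \<open>u\<close>
  is bounded and \<open>W\<close> is integrable on the support.\<close>

lemma W1p_Cc_finite_energy:
  assumes u: "u \<in> W1p p \<Omega> \<inter> Cc \<Omega>" and W: "W \<in> L1_loc \<Omega>"
  shows "u \<in> finite_energy W"
proof -
  note D = CcD[OF IntD2[OF u]]
  define K where "K = closure {x. u x \<noteq> 0}"
  obtain G where G: "has_weak_gradient \<Omega> u G" "G \<in> Lp p \<Omega>" using u by (auto simp: W1p_def)
  obtain \<nu> where \<nu>: "\<nu> > 0" "AE x in lebesgue_on \<Omega>. x \<in> K \<longrightarrow> (\<forall>\<xi>. H x \<xi> \<le> \<nu> * norm \<xi>)"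
    using H_loc[OF D(2,3)] unfolding K_def by blast
  have um: "u \<in> borel_measurable (lebesgue_on \<Omega>)"
    by (intro measurable_restrict_space1 measurable_completion) (use continuous_on_UNIV_borel[OF D(1)] in simp)
  have "integrable (lebesgue_on \<Omega>) (grad_energy u)"
  proof (rule Bochner_Integration.integrable_bound)
    show "integrable (lebesgue_on \<Omega>) (\<lambda>x. \<nu> powr p * norm (G x) powr p)"
      using G(2) by (simp add: Lp_def)
    show "grad_energy u \<in> borel_measurable (lebesgue_on \<Omega>)" by (rule grad_energy_measurable[OF G(1)])
    have "AE x in lebesgue_on \<Omega>. x \<notin> K \<longrightarrow> G x = 0"
      unfolding K_def by (rule weak_gradient_zero_outside[OF open_\<Omega> G(1) closed_closure D(4)])
    then show "AE x in lebesgue_on \<Omega>. norm (grad_energy u x) \<le> norm (\<nu> powr p * norm (G x) powr p)"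
      using \<nu>(2) norm_AE grad_energy_cong[OF G(1)]
    proof eventually_elim
      case (elim x)
      have "H x (G x) \<le> \<nu> * norm (G x)"
        using elim(1,2) is_normD(4)[OF elim(3)] by (cases "x \<in> K") auto
      then have "H x (G x) powr p \<le> (\<nu> * norm (G x)) powr p"
        using p_pos is_normD(1)[OF elim(3)] by (intro powr_mono2) auto
      then show ?case using \<nu>(1) by (simp add: elim(4) powr_mult)
    qed
  qed
  moreover have "\<bar>u x\<bar> powr p = 0" if "x \<notin> closure {x. u x \<noteq> 0}" for x
    using D(4)[OF that] by simp
  then have "integrable (lebesgue_on \<Omega>) (\<lambda>x. W x * \<bar>u x\<bar> powr p)"
    by (rule L1_loc_mult_integrable(2)[OF W open_\<Omega> continuous_on_abs_powr[OF D(1) p_pos] D(2,3)])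
  ultimately show ?thesis using um G(1) by (auto simp: finite_energy_def)
qed

end

section \<open>Convergence of the mollifications\<close>

lemma conv_L1_tendsto:
  fixes f :: "real^'n \<Rightarrow> real"
  assumes f: "integrable lebesgue f" and \<epsilon>: "\<And>n. 0 < \<epsilon> n" "\<epsilon> \<longlonglongrightarrow> 0"
    and \<rho>: "\<And>n. mollifier (\<epsilon> n) (\<rho> n)"
  shows "(\<lambda>n. LINT x|lebesgue. \<bar>conv f (\<rho> n) x - f x\<bar>) \<longlonglongrightarrow> 0"
proof (rule LIMSEQ_I)
  fix \<eta> :: real assume "\<eta> > 0"
  then obtain d where d: "d > 0"
    "\<And>\<epsilon> \<rho>. 0 < \<epsilon> \<Longrightarrow> \<epsilon> \<le> d \<Longrightarrow> mollifier \<epsilon> \<rho> \<Longrightarrow> (LINT x|lebesgue. \<bar>conv f \<rho> x - f x\<bar>) < \<eta>"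
    using mollification_L1[OF f] by blast
  have "eventually (\<lambda>n. \<epsilon> n < d) sequentially" using order_tendstoD(2)[OF \<epsilon>(2) d(1)] .
  then obtain N where "\<And>n. n \<ge> N \<Longrightarrow> \<epsilon> n < d" unfolding eventually_sequentially by blast
  then have "norm ((LINT x|lebesgue. \<bar>conv f (\<rho> n) x - f x\<bar>) - 0) < \<eta>" if "n \<ge> N" for n
    using d(2)[OF \<epsilon>(1) _ \<rho>, of n] that by (simp add: less_imp_le)
  then show "\<exists>N. \<forall>n\<ge>N. norm ((LINT x|lebesgue. \<bar>conv f (\<rho> n) x - f x\<bar>) - 0) < \<eta>" by blast
qed

lemma conv_pointwise_tendsto:
  fixes u :: "real^'n \<Rightarrow> real"
  assumes u: "continuous_on UNIV u" and \<epsilon>: "\<epsilon> \<longlonglongrightarrow> 0" and \<rho>: "\<And>n. mollifier (\<epsilon> n) (\<rho> n)"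
  shows "(\<lambda>n. conv u (\<rho> n) x) \<longlonglongrightarrow> u x"
proof (rule LIMSEQ_I)
  fix \<eta> :: real assume \<eta>: "\<eta> > 0"
  have "isCont u x" using u by (simp add: continuous_on_eq_continuous_at)
  then obtain d where d: "d > 0" "\<And>y. dist y x < d \<Longrightarrow> dist (u y) (u x) < \<eta> / 2"
    using \<eta> unfolding continuous_at_eps_delta by (meson half_gt_zero)
  have "eventually (\<lambda>n. \<epsilon> n < d) sequentially" using order_tendstoD(2)[OF \<epsilon> d(1)] .
  then obtain N where N: "\<And>n. n \<ge> N \<Longrightarrow> \<epsilon> n < d" unfolding eventually_sequentially by blast
  have "norm (conv u (\<rho> n) x - u x) < \<eta>" if "n \<ge> N" for n
  proof -
    have "\<bar>conv u (\<rho> n) x - u x\<bar> \<le> \<eta> / 2"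
    proof (rule conv_continuous_close[OF u \<rho>])
      fix y assume "norm (x - y) < \<epsilon> n"
      then have "dist (u y) (u x) < \<eta> / 2"
        using N[OF that] by (intro d(2)) (simp add: dist_norm norm_minus_commute)
      then show "\<bar>u y - u x\<bar> \<le> \<eta> / 2" by (simp add: dist_real_def)
    qed
    then show ?thesis using \<eta> by simp
  qed
  then show "\<exists>N. \<forall>n\<ge>N. norm (conv u (\<rho> n) x - u x) < \<eta>" by blast
qed

text \<open>A common compact support and a common bound give a multiple of
  \<open>\<bar>W\<bar>\<close> on \<open>K\<close> as the dominant, so local integrability of the
  weight is enough.\<close>

lemma weighted_integral_tendsto:
  fixes u :: "real^'n \<Rightarrow> real"
  assumes W: "W \<in> L1_loc \<Omega>" and \<Omega>: "open \<Omega>" and p: "0 < p"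
    and K: "compact K" "K \<subseteq> \<Omega>" and \<phi>: "\<And>n. continuous_on UNIV (\<phi> n)" "\<And>n x. x \<notin> K \<Longrightarrow> \<phi> n x = 0"
    and bound: "\<And>n x. \<bar>\<phi> n x\<bar> \<le> B" and lim: "\<And>x. (\<lambda>n. \<phi> n x) \<longlonglongrightarrow> u x" and u: "continuous_on UNIV u"
  shows "(\<lambda>n. LINT x|lebesgue_on \<Omega>. W x * \<bar>\<phi> n x\<bar> powr p) \<longlonglongrightarrow> (LINT x|lebesgue_on \<Omega>. W x * \<bar>u x\<bar> powr p)"
proof (rule integral_dominated_convergence[where w = "\<lambda>x. indicator K x *\<^sub>R \<bar>W x\<bar> * \<bar>B\<bar> powr p"])
  have u0: "u x = 0" if "x \<notin> K" for x
    using lim[of x] by (simp add: \<phi>(2)[OF that] LIMSEQ_const_iff)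
  show "(\<lambda>x. W x * \<bar>u x\<bar> powr p) \<in> borel_measurable (lebesgue_on \<Omega>)"
    by (intro borel_measurable_integrable L1_loc_mult_integrable(2)[OF W \<Omega> _ K] continuous_on_abs_powr u p)
       (simp add: u0)
  show "(\<lambda>x. W x * \<bar>\<phi> n x\<bar> powr p) \<in> borel_measurable (lebesgue_on \<Omega>)" for n
    by (intro borel_measurable_integrable L1_loc_mult_integrable(2)[OF W \<Omega> _ K] continuous_on_abs_powr \<phi> p)
       (simp add: \<phi>)
  have "integrable lebesgue (\<lambda>x. \<bar>indicator K x *\<^sub>R W x\<bar> * \<bar>B\<bar> powr p)"
    by (intro integrable_mult_left integrable_abs L1_loc_integrable_on[OF W K])
  then have "integrable lebesgue (\<lambda>x. indicator K x *\<^sub>R \<bar>W x\<bar> * \<bar>B\<bar> powr p)"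
    by (simp add: abs_mult)
  then show "integrable (lebesgue_on \<Omega>) (\<lambda>x. indicator K x *\<^sub>R \<bar>W x\<bar> * \<bar>B\<bar> powr p)"
    by (rule integral_lebesgue_on_le(1)) (use \<Omega> in simp)
  have "(\<lambda>n. W x * \<bar>\<phi> n x\<bar> powr p) \<longlonglongrightarrow> W x * \<bar>u x\<bar> powr p" for x
    by (intro tendsto_intros tendsto_powr' lim) (use p in auto)
  then show "AE x in lebesgue_on \<Omega>. (\<lambda>n. W x * \<bar>\<phi> n x\<bar> powr p) \<longlonglongrightarrow> W x * \<bar>u x\<bar> powr p" by simp
  have "\<bar>W x\<bar> * \<bar>\<phi> n x\<bar> powr p \<le> indicator K x *\<^sub>R \<bar>W x\<bar> * \<bar>B\<bar> powr p" for n x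
  proof (cases "x \<in> K")
    case True
    have "\<bar>\<phi> n x\<bar> powr p \<le> \<bar>B\<bar> powr p"
      using p bound[of n x] by (intro powr_mono2) auto
    then show ?thesis using True by (simp add: mult_left_mono)
  qed (simp add: \<phi>)
  then show "AE x in lebesgue_on \<Omega>. norm (W x * \<bar>\<phi> n x\<bar> powr p) \<le> indicator K x *\<^sub>R \<bar>W x\<bar> * \<bar>B\<bar> powr p" for n
    by (simp add: abs_mult)
qed

context locally_bounded_norm_energy
begin

text \<open>One sequence serves all weights, because mollifications of a continuous function
  converge everywhere and are uniformly bounded. The gradients converge almost everywhere only along
  a subsequence, and their energies have dominants that move with \<open>n\<close> but converge in
  L1.\<close>

lemma exists_smooth_approximation:
  assumes u: "u \<in> W1p p \<Omega> \<inter> Cc \<Omega>"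
  obtains \<phi> where "\<And>n :: nat. \<phi> n \<in> Cc_infty \<Omega>"
    "(\<lambda>n. LINT x|lebesgue_on \<Omega>. grad_energy (\<phi> n) x) \<longlonglongrightarrow> (LINT x|lebesgue_on \<Omega>. grad_energy u x)"
    "\<And>W. W \<in> L1_loc \<Omega> \<Longrightarrow>
      (\<lambda>n. LINT x|lebesgue_on \<Omega>. W x * \<bar>\<phi> n x\<bar> powr p) \<longlonglongrightarrow> (LINT x|lebesgue_on \<Omega>. W x * \<bar>u x\<bar> powr p)"
proof -
  note D = CcD[OF IntD2[OF u]]
  define K where "K = closure {x. u x \<noteq> 0}"
  have K: "compact K" "K \<subseteq> \<Omega>" and u0: "\<And>x. x \<notin> K \<Longrightarrow> u x = 0"
    using D(2,3) D(4) unfolding K_def by blast+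
  have Ks: "K \<in> sets lebesgue" using K(1) by (simp add: lmeasurable_compact fmeasurableD)
  obtain G where G: "has_weak_gradient \<Omega> u G" "G \<in> Lp p \<Omega>" using u by (auto simp: W1p_def)
  have GL: "G \<in> L1_loc \<Omega>" using G(1) by (simp add: has_weak_gradient_def)
  obtain d K' where d: "d > 0" and K': "compact K'" "K' \<subseteq> \<Omega>" "\<And>x y. x \<in> K \<Longrightarrow> dist x y \<le> d \<Longrightarrow> y \<in> K'"
    and near: "\<And>x y. x \<in> K \<Longrightarrow> dist x y \<le> d \<Longrightarrow> cball y d \<subseteq> \<Omega>"
    using compact_neighbourhood[OF K(1) open_\<Omega> K(2)] by blast
  obtain \<nu> where \<nu>: "\<nu> > 0" "AE x in lebesgue_on \<Omega>. x \<in> K' \<longrightarrow> (\<forall>\<xi>. H x \<xi> \<le> \<nu> * norm \<xi>)"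
    using H_loc[OF K'(1,2)] by blast
  define \<epsilon> where "\<epsilon> = (\<lambda>n. d * inverse (real (Suc n)))"
  have \<epsilon>: "0 < \<epsilon> n" "\<epsilon> n \<le> d" for n using d by (auto simp: \<epsilon>_def field_simps)
  have \<epsilon>0: "\<epsilon> \<longlonglongrightarrow> 0"
    using tendsto_mult_right_zero[OF LIMSEQ_inverse_real_of_nat, of d] by (simp add: \<epsilon>_def)
  obtain \<rho> :: "nat \<Rightarrow> real^'n \<Rightarrow> real" where \<rho>: "\<And>n. mollifier (\<epsilon> n) (\<rho> n)"
    using exists_mollifier[OF \<epsilon>(1)] by metis
  have near': "cball y (\<epsilon> n) \<subseteq> \<Omega>" if "x \<in> K" "dist x y \<le> \<epsilon> n" for x y n
    using near[of x y] that \<epsilon>(2)[of n] by (meson order_trans subset_cball)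
  obtain R where R: "\<And>x. x \<in> K \<Longrightarrow> norm x \<le> R"
    using compact_imp_bounded[OF K(1)] unfolding bounded_iff by blast
  obtain B where B: "B > 0" "\<And>x. \<bar>u x\<bar> \<le> B"
    using bounded_continuous_compact_support[OF D(1) K(1) u0] by (metis real_norm_def)
  define \<psi> where "\<psi> = (\<lambda>n. conv u (\<rho> n))"
  have far: "conv f (\<rho> n) x = 0" if "x \<notin> K'" "\<And>y. y \<notin> K \<Longrightarrow> f y = 0" for f n x
  proof (rule conv_eq_0[OF _ \<rho>])
    fix y assume "norm (x - y) < \<epsilon> n"
    then have "dist y x \<le> d" using \<epsilon>(2)[of n] by (simp add: dist_norm norm_minus_commute)
    then show "f y = 0" using K'(3) that by blast
  qed
  have \<psi>Ck: "Ck k (\<psi> n)" for k n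
    unfolding \<psi>_def by (rule Ck_conv[OF D(1) _ mollifierD(1)[OF \<rho>], of R]) (use R u0 in force)
  have \<psi>0: "\<psi> n x = 0" if "x \<notin> K'" for n x unfolding \<psi>_def by (rule far[OF that u0])
  have \<psi>Cc: "\<psi> n \<in> Cc_infty \<Omega>" for n
    using CcI[OF Ck_continuous[OF \<psi>Ck] K'(1,2) \<psi>0] \<psi>Ck by (auto simp: Cc_infty_def Cc_def)
  have \<psi>lim: "(\<lambda>n. \<psi> n x) \<longlonglongrightarrow> u x" for x
    unfolding \<psi>_def by (rule conv_pointwise_tendsto[OF D(1) \<epsilon>0 \<rho>])
  \<comment> \<open>The bound \<open>B\<close> for \<open>u\<close> plus the largest possible
    oscillation \<open>2 * B\<close>.\<close>
  have \<psi>B: "\<bar>\<psi> n x\<bar> \<le> 3 * B" for n x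
  proof -
    have "\<bar>\<psi> n x - u x\<bar> \<le> 2 * B" unfolding \<psi>_def
    proof (rule conv_continuous_close[OF D(1) \<rho>])
      show "\<bar>u y - u x\<bar> \<le> 2 * B" for y using B(2)[of x] B(2)[of y] by linarith
    qed
    then show ?thesis using B(2)[of x] by linarith
  qed
  \<comment> \<open>The gradient components are cut off outside \<open>K\<close> so that they are
    integrable on the whole space and can be convolved; \<open>h\<close> holds their
    \<open>p\<close>-th powers, to which Jensen's inequality leads.\<close>
  define g where "g = (\<lambda>i y. indicator K y * G y $ i)"
  have g0: "g i y = 0" if "y \<notin> K" for i y using that by (simp add: g_def)
  have gi: "integrable lebesgue (g i)" for i
    using L1_loc_integrable_on[OF L1_loc_component[OF GL] K, of i] by (simp add: g_def)
  define h where "h = (\<lambda>i y. \<bar>g i y\<bar> powr p)"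
  have hi: "integrable lebesgue (h i)" for i
  proof (rule Bochner_Integration.integrable_bound)
    show "integrable lebesgue (\<lambda>x. indicator \<Omega> x *\<^sub>R norm (G x) powr p)"
      using G(2) \<Omega>_sets by (simp add: Lp_def integrable_restrict_space)
    show "h i \<in> borel_measurable lebesgue" unfolding h_def using gi[of i] by measurable
    have "h i x \<le> indicator \<Omega> x *\<^sub>R norm (G x) powr p" for x
      using K(2) p component_le_norm_cart[of "G x" i]
      by (auto simp: h_def g_def indicator_def intro!: powr_mono2)
    then show "AE x in lebesgue. norm (h i x) \<le> norm (indicator \<Omega> x *\<^sub>R norm (G x) powr p)"
      by (intro AE_I2) (simp add: h_def)
  qed
  have grad: "gradient (\<psi> n) x $ i = conv (g i) (\<rho> n) x" for n x i
    unfolding \<psi>_def g_def by (rule gradient_conv[OF open_\<Omega> D(1) G(1) K u0 \<rho> near'])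
  \<comment> \<open>Summing the errors of all components yields a single subsequence along which
    every component converges almost everywhere.\<close>
  define E where "E = (\<lambda>n x. \<Sum>i\<in>UNIV. \<bar>conv (g i) (\<rho> n) x - g i x\<bar>)"
  have Ei: "integrable lebesgue (\<lambda>x. \<bar>conv (g i) (\<rho> n) x - g i x\<bar>)" for i n
    by (intro integrable_abs Bochner_Integration.integrable_diff conv_L1_bound(1)[OF gi \<rho>] gi)
  have "(\<lambda>n. \<Sum>i\<in>UNIV. (LINT x|lebesgue. \<bar>conv (g i) (\<rho> n) x - g i x\<bar>)) \<longlonglongrightarrow> (\<Sum>i\<in>(UNIV :: 'n set). 0)"
    by (intro tendsto_sum conv_L1_tendsto[OF gi \<epsilon>(1) \<epsilon>0 \<rho>])
  moreover have "(LINT x|lebesgue. norm (E n x)) = (\<Sum>i\<in>UNIV. (LINT x|lebesgue. \<bar>conv (g i) (\<rho> n) x - g i x\<bar>))" for n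
  proof -
    have "(LINT x|lebesgue. norm (E n x)) = (LINT x|lebesgue. E n x)" by (simp add: E_def sum_nonneg)
    then show ?thesis unfolding E_def by (simp add: Bochner_Integration.integral_sum Ei)
  qed
  ultimately have "(\<lambda>n. LINT x|lebesgue. norm (E n x)) \<longlonglongrightarrow> 0" by simp
  moreover have "integrable lebesgue (E n)" for n unfolding E_def by (intro Bochner_Integration.integrable_sum Ei)
  ultimately obtain r :: "nat \<Rightarrow> nat" where r: "strict_mono r" "AE x in lebesgue. (\<lambda>n. E (r n) x) \<longlonglongrightarrow> 0"
    using tendsto_L1_AE_subseq by blast
  define \<phi> where "\<phi> = (\<lambda>n. \<psi> (r n))"
  \<comment> \<open>One factor is the bound of \<open>H\<close> on \<open>K'\<close>, the other the
    constant in \<open>norm_powr_le_sum\<close>.\<close>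
  define c where "c = \<nu> powr p * real CARD('n) powr p"
  have c: "c \<ge> 0" by (simp add: c_def)
  \<comment> \<open>Jensen's inequality bounds the energy density of the \<open>n\<close>-th
    approximant by \<open>b n\<close>; being built from mollifications of the integrable functions
    \<open>h i\<close>, these dominants converge to \<open>b'\<close> in L1.\<close>
  define b where "b = (\<lambda>n x. c * (\<Sum>i\<in>UNIV. conv (h i) (\<rho> (r n)) x))"
  define b' where "b' = (\<lambda>x. c * (\<Sum>i\<in>UNIV. h i x))"
  have H_bound: "H x \<xi> powr p \<le> c * (\<Sum>i\<in>UNIV. \<bar>\<xi> $ i\<bar> powr p)"
    if "is_norm (H x)" "H x \<xi> \<le> \<nu> * norm \<xi>" for x \<xi>
  proof -
    have "H x \<xi> powr p \<le> (\<nu> * norm \<xi>) powr p"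
      using p that by (intro powr_mono2) (auto simp: is_normD)
    also have "\<dots> = \<nu> powr p * norm \<xi> powr p" using \<nu>(1) by (simp add: powr_mult)
    also have "\<dots> \<le> \<nu> powr p * (real CARD('n) powr p * (\<Sum>i\<in>UNIV. \<bar>\<xi> $ i\<bar> powr p))"
      by (intro mult_left_mono norm_powr_le_sum p_pos) auto
    finally show ?thesis by (simp add: c_def mult.assoc)
  qed
  have ge_\<phi>: "AE x in lebesgue_on \<Omega>. grad_energy (\<phi> n) x = H x (gradient (\<phi> n) x) powr p" for n
    unfolding \<phi>_def by (rule grad_energy_cong[OF has_weak_gradient_C1[OF open_\<Omega> \<psi>Ck]])
  have Gg: "AE x in lebesgue_on \<Omega>. G x = (\<chi> i. g i x)"
    using weak_gradient_zero_outside[OF open_\<Omega> G(1) compact_imp_closed[OF K(1)], OF u0, simplified]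
    by eventually_elim (auto simp: g_def vec_eq_iff indicator_def)
  have "(\<lambda>n. LINT x|lebesgue_on \<Omega>. grad_energy (\<phi> n) x) \<longlonglongrightarrow> (LINT x|lebesgue_on \<Omega>. grad_energy u x)"
  proof (rule integral_tendsto_moving_dominant[where g = b and g' = b'])
    show "grad_energy (\<phi> n) \<in> borel_measurable (lebesgue_on \<Omega>)" for n
      unfolding \<phi>_def by (rule grad_energy_measurable[OF has_weak_gradient_C1[OF open_\<Omega> \<psi>Ck]])
    show "grad_energy u \<in> borel_measurable (lebesgue_on \<Omega>)" by (rule grad_energy_measurable[OF G(1)])
    have bi: "integrable lebesgue (b n)" for n unfolding b_def
      by (intro integrable_mult_right Bochner_Integration.integrable_sum conv_L1_bound(1)[OF hi \<rho>])
    have b'i: "integrable lebesgue b'" unfolding b'_def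
      by (intro integrable_mult_right Bochner_Integration.integrable_sum hi)
    show "integrable (lebesgue_on \<Omega>) (b n)" for n by (rule integral_lebesgue_on_le(1)[OF bi \<Omega>_sets])
    show "integrable (lebesgue_on \<Omega>) b'" by (rule integral_lebesgue_on_le(1)[OF b'i \<Omega>_sets])
    show "AE x in lebesgue_on \<Omega>. 0 \<le> grad_energy (\<phi> n) x \<and> grad_energy (\<phi> n) x \<le> b n x" for n
      using ge_\<phi>[of n] norm_AE \<nu>(2)
    proof eventually_elim
      case (elim x)
      \<comment> \<open>The constant \<open>\<nu>\<close> is valid on \<open>K'\<close> only, but
        outside \<open>K'\<close> the gradient of the approximant is zero.\<close>
      have Hle: "H x (gradient (\<phi> n) x) \<le> \<nu> * norm (gradient (\<phi> n) x)"
      proof (cases "x \<in> K'")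
        case False
        then have "gradient (\<phi> n) x = 0"
          using far[OF False g0] by (simp add: \<phi>_def vec_eq_iff grad)
        then show ?thesis using is_normD(4)[OF elim(2)] by simp
      qed (use elim in blast)
      have "grad_energy (\<phi> n) x \<le> c * (\<Sum>i\<in>UNIV. \<bar>conv (g i) (\<rho> (r n)) x\<bar> powr p)"
        using H_bound[OF elim(2) Hle] unfolding elim(1) unfolding \<phi>_def grad .
      also have "\<dots> \<le> b n x"
        unfolding b_def h_def using hi
        by (intro mult_left_mono sum_mono conv_powr_le[OF gi _ p \<rho>] c) (simp add: h_def)
      finally show ?case by (simp add: grad_energy_nonneg)
    qed
    show "AE x in lebesgue_on \<Omega>. grad_energy u x \<le> b' x"
      using grad_energy_cong[OF G(1)] norm_AE \<nu>(2) Gg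
    proof eventually_elim
      case (elim x)
      have "H x (\<chi> i. g i x) \<le> \<nu> * norm (\<chi> i. g i x)"
      proof (cases "x \<in> K")
        case True
        then have "x \<in> K'" using K'(3)[of x x] d by simp
        then show ?thesis using elim(3) by blast
      next
        case False
        then have "(\<chi> i. g i x) = 0" by (simp add: g0 vec_eq_iff)
        then show ?thesis using is_normD(4)[OF elim(2)] by simp
      qed
      then show ?case using H_bound[OF elim(2), of "\<chi> i. g i x"] elim(1,4) by (simp add: b'_def h_def)
    qed
    define err where "err = (\<lambda>i n. LINT x|lebesgue. \<bar>conv (h i) (\<rho> (r n)) x - h i x\<bar>)"
    have hsub: "(err i) \<longlonglongrightarrow> 0" for i
      using LIMSEQ_subseq_LIMSEQ[OF conv_L1_tendsto[OF hi \<epsilon>(1) \<epsilon>0 \<rho>, of i] r(1)] by (simp add: o_def err_def)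
    have hsi: "integrable lebesgue (\<lambda>x. \<bar>conv (h i) (\<rho> (r n)) x - h i x\<bar>)" for i n
      by (intro integrable_abs Bochner_Integration.integrable_diff conv_L1_bound(1)[OF hi \<rho>] hi)
    have bd: "(LINT x|lebesgue_on \<Omega>. \<bar>b n x - b' x\<bar>) \<le> c * (\<Sum>i\<in>UNIV. err i n)" for n
    proof -
      have "(LINT x|lebesgue_on \<Omega>. \<bar>b n x - b' x\<bar>) \<le> (LINT x|lebesgue. \<bar>b n x - b' x\<bar>)"
        by (rule integral_lebesgue_on_le(2)[OF integrable_abs[OF Bochner_Integration.integrable_diff[OF bi b'i]] \<Omega>_sets]) simp
      also have "\<dots> \<le> (LINT x|lebesgue. c * (\<Sum>i\<in>UNIV. \<bar>conv (h i) (\<rho> (r n)) x - h i x\<bar>))"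
      proof (rule integral_mono)
        show "\<bar>b n x - b' x\<bar> \<le> c * (\<Sum>i\<in>UNIV. \<bar>conv (h i) (\<rho> (r n)) x - h i x\<bar>)" for x
        proof -
          have "\<bar>b n x - b' x\<bar> = c * \<bar>\<Sum>i\<in>UNIV. conv (h i) (\<rho> (r n)) x - h i x\<bar>"
            using c by (simp add: b_def b'_def right_diff_distrib[symmetric] sum_subtractf[symmetric] abs_mult)
          also have "\<dots> \<le> c * (\<Sum>i\<in>UNIV. \<bar>conv (h i) (\<rho> (r n)) x - h i x\<bar>)"
            by (intro mult_left_mono sum_abs c)
          finally show ?thesis .
        qed
      qed (intro integrable_abs Bochner_Integration.integrable_diff bi b'i integrable_mult_right
          Bochner_Integration.integrable_sum hsi)+
      also have "\<dots> = c * (\<Sum>i\<in>UNIV. err i n)"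
        by (simp add: Bochner_Integration.integral_sum hsi err_def)
      finally show ?thesis .
    qed
    have "(\<lambda>n. c * (\<Sum>i\<in>UNIV. err i n)) \<longlonglongrightarrow> c * (\<Sum>i\<in>(UNIV :: 'n set). 0)"
      by (intro tendsto_intros hsub)
    then have "(\<lambda>n. c * (\<Sum>i\<in>UNIV. err i n)) \<longlonglongrightarrow> 0" by simp
    then show "(\<lambda>n. LINT x|lebesgue_on \<Omega>. \<bar>b n x - b' x\<bar>) \<longlonglongrightarrow> 0"
      by (rule tendsto_sandwich[OF _ _ tendsto_const, rotated -1]) (use bd in auto)
    have "AE x in lebesgue_on \<Omega>. (\<lambda>n. E (r n) x) \<longlonglongrightarrow> 0"
      using r(2) \<Omega>_sets by (subst AE_restrict_space_iff) auto
    moreover have "AE x in lebesgue_on \<Omega>. \<forall>n. grad_energy (\<phi> n) x = H x (gradient (\<phi> n) x) powr p"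
      using ge_\<phi> by (subst AE_all_countable) auto
    ultimately show "AE x in lebesgue_on \<Omega>. (\<lambda>n. grad_energy (\<phi> n) x) \<longlonglongrightarrow> grad_energy u x"
      using norm_AE Gg grad_energy_cong[OF G(1)]
    proof eventually_elim
      case (elim x)
      have "(\<lambda>n. conv (g i) (\<rho> (r n)) x) \<longlonglongrightarrow> g i x" for i
      proof -
        have "(\<lambda>n. conv (g i) (\<rho> (r n)) x - g i x) \<longlonglongrightarrow> 0"
        proof (rule Lim_null_comparison[OF _ elim(1)], intro always_eventually allI)
          show "norm (conv (g i) (\<rho> (r n)) x - g i x) \<le> E (r n) x" for n
            unfolding E_def real_norm_def by (rule member_le_sum) auto
        qed
        then show ?thesis by (simp add: LIM_zero_iff)
      qed
      then have "(\<lambda>n. gradient (\<phi> n) x) \<longlonglongrightarrow> G x"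
        unfolding elim(4) by (intro vec_tendstoI) (simp add: \<phi>_def grad)
      moreover have "isCont (H x) (G x)"
        using is_norm_continuous[OF elim(3)] continuous_on_eq_continuous_at[OF open_UNIV] by blast
      ultimately have "(\<lambda>n. H x (gradient (\<phi> n) x)) \<longlonglongrightarrow> H x (G x)"
        by (intro isCont_tendsto_compose[of _ "H x"])
      then have "(\<lambda>n. H x (gradient (\<phi> n) x) powr p) \<longlonglongrightarrow> H x (G x) powr p"
        by (intro tendsto_powr' tendsto_const) (use p_pos is_normD(1)[OF elim(3)] in auto)
      then show ?case using elim(2,5) by simp
    qed
  qed
  moreover have "(\<lambda>n. LINT x|lebesgue_on \<Omega>. W x * \<bar>\<phi> n x\<bar> powr p) \<longlonglongrightarrow> (LINT x|lebesgue_on \<Omega>. W x * \<bar>u x\<bar> powr p)"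
    if "W \<in> L1_loc \<Omega>" for W
  proof (rule weighted_integral_tendsto[OF that open_\<Omega> p_pos K'(1,2) _ _ _ _ D(1)])
    show "(\<lambda>n. \<phi> n x) \<longlonglongrightarrow> u x" for x
      using LIMSEQ_subseq_LIMSEQ[OF \<psi>lim r(1)] by (simp add: \<phi>_def o_def)
    show "\<bar>\<phi> n x\<bar> \<le> 3 * B" for n x by (simp add: \<phi>_def \<psi>B)
    show "continuous_on UNIV (\<phi> n)" for n unfolding \<phi>_def by (rule Ck_continuous[OF \<psi>Ck])
    show "\<phi> n x = 0" if "x \<notin> K'" for n x using \<psi>0[OF that] by (simp add: \<phi>_def)
  qed
  ultimately show ?thesis using that[of \<phi>] \<psi>Cc by (simp add: \<phi>_def)
qed

text \<open>Both sides pass to the limit along the same smooth sequence, the left one with weight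
  \<open>\<bar>W\<bar>\<close> and the right one with weight \<open>V\<close>.\<close>

lemma hardy_inequality_W1p_Cc:
  assumes V: "V \<in> L1_loc \<Omega>" and W: "W \<in> hardy_weights H p V \<Omega>"
  obtains C where "C > 0" "\<And>u. u \<in> W1p p \<Omega> \<inter> Cc \<Omega> \<Longrightarrow>
    C * (LINT x|lebesgue_on \<Omega>. \<bar>W x\<bar> * \<bar>u x\<bar> powr p) \<le> energy V u"
proof -
  obtain C where C: "C > 0" "\<And>\<phi>. \<phi> \<in> Cc_infty \<Omega> \<Longrightarrow>
      C * (LINT x|lebesgue_on \<Omega>. \<bar>W x\<bar> * \<bar>\<phi> x\<bar> powr p) \<le> energy V \<phi>"
    using W by (auto simp: hardy_weights_def energy_eq_Q_functional)
  have Wabs: "(\<lambda>x. \<bar>W x\<bar>) \<in> L1_loc \<Omega>" using W by (auto simp: hardy_weights_def L1_loc_def)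
  have split: "energy V u = (LINT x|lebesgue_on \<Omega>. grad_energy u x) + (LINT x|lebesgue_on \<Omega>. V x * \<bar>u x\<bar> powr p)"
    if "u \<in> W1p p \<Omega> \<inter> Cc \<Omega>" for u
    using W1p_Cc_finite_energy[OF that V] by (simp add: energy_def finite_energy_def)
  show ?thesis
  proof (rule that[OF C(1)])
    fix u assume u: "u \<in> W1p p \<Omega> \<inter> Cc \<Omega>"
    obtain \<phi> where \<phi>: "\<And>n :: nat. \<phi> n \<in> Cc_infty \<Omega>"
      "(\<lambda>n. LINT x|lebesgue_on \<Omega>. grad_energy (\<phi> n) x) \<longlonglongrightarrow> (LINT x|lebesgue_on \<Omega>. grad_energy u x)"
      "\<And>W. W \<in> L1_loc \<Omega> \<Longrightarrow>
        (\<lambda>n. LINT x|lebesgue_on \<Omega>. W x * \<bar>\<phi> n x\<bar> powr p) \<longlonglongrightarrow> (LINT x|lebesgue_on \<Omega>. W x * \<bar>u x\<bar> powr p)"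
      using exists_smooth_approximation[OF u] by blast
    have "(\<lambda>n. energy V (\<phi> n)) \<longlonglongrightarrow> energy V u"
      unfolding split[OF u] split[OF Cc_infty_subset_W1p_Cc[OF open_\<Omega> \<phi>(1) p_pos]]
      by (intro tendsto_add \<phi>(2) \<phi>(3)[OF V])
    moreover have "(\<lambda>n. C * (LINT x|lebesgue_on \<Omega>. \<bar>W x\<bar> * \<bar>\<phi> n x\<bar> powr p)) \<longlonglongrightarrow> C * (LINT x|lebesgue_on \<Omega>. \<bar>W x\<bar> * \<bar>u x\<bar> powr p)"
      by (intro tendsto_intros \<phi>(3)[OF Wabs])
    ultimately show "C * (LINT x|lebesgue_on \<Omega>. \<bar>W x\<bar> * \<bar>u x\<bar> powr p) \<le> energy V u"
      by (intro LIMSEQ_le) (use C(2) \<phi>(1) in auto)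
  qed
qed

end

section \<open>Existence of a minimizer\<close>

lemma seminorm_on_closed_subset:
  assumes "seminorm_on Y P" "seminorm_on X N" "X \<subseteq> Y"
  shows "seminorm_on X P"
  using assms unfolding seminorm_on_def by blast

lemma seminorm_on_lincomb:
  assumes N: "seminorm_on X N" and "u \<in> X" "v \<in> X"
  shows "(\<lambda>x. a * u x + b * v x) \<in> X" "N (\<lambda>x. a * u x + b * v x) \<le> \<bar>a\<bar> * N u + \<bar>b\<bar> * N v"
    "(\<lambda>x. u x - v x) \<in> X"
proof -
  note S = seminorm_onD[OF N]
  show "(\<lambda>x. a * u x + b * v x) \<in> X" for a b using S(1)[OF S(2) S(2)] assms by blast
  from this[of 1 "- 1"] show "(\<lambda>x. u x - v x) \<in> X" by simp
  show "N (\<lambda>x. a * u x + b * v x) \<le> \<bar>a\<bar> * N u + \<bar>b\<bar> * N v"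
    using S(3)[OF S(2)[OF assms(2), of a] S(2)[OF assms(3), of b]] S(4)[OF assms(2), of a] S(4)[OF assms(3), of b]
    by simp
qed

lemma seminorm_on_triangle_diff:
  assumes N: "seminorm_on X N" and uv: "u \<in> X" "v \<in> X"
  shows "\<bar>N u - N v\<bar> \<le> N (\<lambda>x. u x - v x)"
proof -
  note S = seminorm_on_lincomb[OF N]
  have "N u \<le> N (\<lambda>x. u x - v x) + N v"
    using S(2)[OF S(3)[OF uv] uv(2), of 1 1] by simp
  moreover have "N v \<le> N (\<lambda>x. u x - v x) + N u"
    using S(2)[OF S(3)[OF uv] uv(1), of "- 1" 1] by simp
  ultimately show ?thesis by linarith
qed

text \<open>Will be applied with \<open>Wt\<close> as \<open>X\<close> and
  \<open>W1p p \<Omega> \<inter> Cc \<Omega>\<close> as \<open>D\<close>; then \<open>Y\<close> is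
  \<open>Wt0\<close>.\<close>

lemma seminorm_on_closure:
  assumes N: "seminorm_on X N" and D: "D \<subseteq> X" and lin: "\<And>a b u v. u \<in> D \<Longrightarrow> v \<in> D \<Longrightarrow> (\<lambda>x. a * u x + b * v x) \<in> D"
    and ne: "D \<noteq> {}"
  defines "Y \<equiv> {u \<in> X. \<forall>\<epsilon>>0. \<exists>\<phi>\<in>D. N (\<lambda>x. u x - \<phi> x) < \<epsilon>}"
  shows "seminorm_on Y N" "D \<subseteq> Y"
proof -
  note S = seminorm_on_lincomb[OF N]
  have comb: "(\<lambda>x. a * u x + b * v x) \<in> Y" if uv: "u \<in> Y" "v \<in> Y" for a b u v
  proof -
    have X: "u \<in> X" "v \<in> X" using uv by (auto simp: Y_def)
    have "\<exists>\<phi>\<in>D. N (\<lambda>x. (a * u x + b * v x) - \<phi> x) < \<epsilon>" if "\<epsilon> > 0" for \<epsilon>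
    proof -
      \<comment> \<open>The tolerance for each of the two functions; the 1 covers
        \<open>a = b = 0\<close> and gives a strict inequality.\<close>
      define \<eta> where "\<eta> = \<epsilon> / (\<bar>a\<bar> + \<bar>b\<bar> + 1)"
      have \<eta>: "\<eta> > 0" "(\<bar>a\<bar> + \<bar>b\<bar>) * \<eta> < \<epsilon>" using that by (auto simp: \<eta>_def field_simps add_nonneg_pos)
      obtain \<phi> \<psi> where \<phi>: "\<phi> \<in> D" "N (\<lambda>x. u x - \<phi> x) < \<eta>" and \<psi>: "\<psi> \<in> D" "N (\<lambda>x. v x - \<psi> x) < \<eta>"
        using uv \<eta>(1) unfolding Y_def by blast
      have "N (\<lambda>x. a * (u x - \<phi> x) + b * (v x - \<psi> x)) \<le> \<bar>a\<bar> * N (\<lambda>x. u x - \<phi> x) + \<bar>b\<bar> * N (\<lambda>x. v x - \<psi> x)"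
        using \<phi> \<psi> D X by (intro S(2) S(3)) auto
      also have "\<dots> \<le> \<bar>a\<bar> * \<eta> + \<bar>b\<bar> * \<eta>" using \<phi> \<psi> by (intro add_mono mult_left_mono) auto
      also have "\<dots> < \<epsilon>" using \<eta> by (simp add: distrib_right)
      finally have "N (\<lambda>x. (a * u x + b * v x) - (a * \<phi> x + b * \<psi> x)) < \<epsilon>" by (simp add: algebra_simps)
      then show ?thesis by (rule bexI[OF _ lin[OF \<phi>(1) \<psi>(1), of a b]])
    qed
    then show ?thesis using S(1)[OF X] by (auto simp: Y_def)
  qed
  have "(\<lambda>x. u x + v x) \<in> Y" "(\<lambda>x. c * u x) \<in> Y" if "u \<in> Y" "v \<in> Y" for u v c
    using comb[OF that, of 1 1] comb[OF that, of c 0] by simp_all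
  moreover have "u \<in> X" if "u \<in> Y" for u using that by (simp add: Y_def)
  ultimately show "seminorm_on Y N" using N unfolding seminorm_on_def by blast
  show "D \<subseteq> Y"
  proof
    fix u assume u: "u \<in> D"
    have "N (\<lambda>x. 0 * u x) = 0" using seminorm_onD(4)[OF N, of u 0] u D by auto
    then have "N (\<lambda>x. u x - u x) = 0" by simp
    then show "u \<in> Y" using u D by (force simp: Y_def)
  qed
qed

section \<open>Localization to balls\<close>

lemma compact_ball_subcover:
  fixes K :: "'a::euclidean_space set"
  assumes "compact K" "\<And>x. x \<in> K \<Longrightarrow> r x > 0"
  obtains F where "finite F" "F \<subseteq> K" "K \<subseteq> (\<Union>x\<in>F. ball x (r x))"
proof -
  obtain F where "F \<subseteq> K" "finite F" "K \<subseteq> (\<Union>x\<in>F. ball x (r x))"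
    by (rule compactE_image[OF assms(1), of K "\<lambda>x. ball x (r x)"]) (use assms(2) in force)+
  then show ?thesis using that by blast
qed

lemma compactly_inside_ball:
  fixes x :: "'a::euclidean_space"
  assumes "cball x r \<subseteq> \<Omega>" "r > 0"
  shows "is_domain (ball x r)" "compactly_inside (ball x r) \<Omega>"
  using assms by (auto simp: is_domain_def compactly_inside_def)

text \<open>\<open>morrey_loc\<close> gives information only on domains compactly inside
  \<open>\<Omega>\<close>, so \<open>K\<close> is covered by finitely many balls. If
  \<open>p\<close> is at most the dimension, this information is local integrability inside each
  ball, whence the balls of half the radius.\<close>

lemma morrey_loc_subset_L1_loc:
  fixes V :: "real^'n \<Rightarrow> real"
  assumes \<Omega>: "open \<Omega>" and V: "V \<in> morrey_loc p q \<Omega>"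
  shows "V \<in> L1_loc \<Omega>"
  unfolding L1_loc_def
proof (intro CollectI allI impI)
  fix K assume K: "compact K \<and> K \<subseteq> \<Omega>"
  have "\<exists>r>0. cball x r \<subseteq> \<Omega>" if "x \<in> K" for x
    using K \<Omega> that open_contains_cball by blast
  then obtain r where r: "\<And>x. x \<in> K \<Longrightarrow> r x > 0" "\<And>x. x \<in> K \<Longrightarrow> cball x (r x) \<subseteq> \<Omega>" by metis
  have int: "set_integrable lebesgue (cball x (r x / 2)) V" if x: "x \<in> K" for x
  proof -
    have "V \<in> morrey_space p q (ball x (r x))"
      using V compactly_inside_ball[OF r(2,1)[OF x]] by (auto simp: morrey_loc_def)
    then consider "V \<in> L1_loc (ball x (r x))" | "integrable (lebesgue_on (ball x (r x))) V"
      unfolding morrey_space_def by (auto split: if_splits)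
    then show ?thesis
    proof cases
      case 1
      then show ?thesis unfolding set_integrable_def
        by (rule L1_loc_integrable_on) (use r(1)[OF x] in auto)
    next
      case 2
      then have "set_integrable lebesgue (ball x (r x)) V"
        unfolding set_integrable_def by (subst (asm) integrable_restrict_space) auto
      then show ?thesis by (rule set_integrable_subset) (use r(1)[OF x] in auto)
    qed
  qed
  obtain F where F: "finite F" "F \<subseteq> K" "K \<subseteq> (\<Union>x\<in>F. ball x (r x / 2))"
    using compact_ball_subcover[of K "\<lambda>x. r x / 2"] K r(1) by auto
  have U: "set_integrable lebesgue (\<Union>x\<in>F. cball x (r x / 2)) V"
    by (rule set_integrable_UN) (use F int in auto)
  have Ks: "K \<in> sets lebesgue" using K by (simp add: lmeasurable_compact fmeasurableD)
  have "set_integrable lebesgue K V"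
    by (rule set_integrable_subset[OF U Ks]) (use F(3) ball_subset_cball in blast)
  then show "integrable (lebesgue_on K) V"
    unfolding set_integrable_def using Ks by (subst integrable_restrict_space) auto
qed

text \<open>A compact set need not lie in a single domain that is known to be compactly inside
  \<open>\<Omega>\<close>; the bounds are collected over a finite cover by balls, which are such
  domains.\<close>

lemma admissible_norm_family_upper_bound:
  fixes \<Omega> :: "(real^'n) set"
  assumes \<Omega>: "open \<Omega>" and H: "admissible_norm_family \<Omega> H" and K: "compact K" "K \<subseteq> \<Omega>"
  shows "\<exists>\<nu>>0. AE x in lebesgue_on \<Omega>. x \<in> K \<longrightarrow> (\<forall>\<xi>. H x \<xi> \<le> \<nu> * norm \<xi>)"
proof -
  have "\<exists>r>0. cball x r \<subseteq> \<Omega>" if "x \<in> K" for x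
    using K \<Omega> that open_contains_cball by blast
  then obtain r where r: "\<And>x. x \<in> K \<Longrightarrow> r x > 0" "\<And>x. x \<in> K \<Longrightarrow> cball x (r x) \<subseteq> \<Omega>" by metis
  have "\<exists>\<nu>>0. AE y in lebesgue_on (ball x (r x)). \<forall>\<xi>. H y \<xi> \<le> \<nu> * norm \<xi>" if x: "x \<in> K" for x
  proof -
    obtain \<kappa> \<nu> where "0 < \<kappa>" "\<kappa> \<le> \<nu>"
      "AE y in lebesgue_on (ball x (r x)). \<forall>\<xi>. \<kappa> * norm \<xi> \<le> H y \<xi> \<and> H y \<xi> \<le> \<nu> * norm \<xi>"
      using H compactly_inside_ball[OF r(2,1)[OF x]] unfolding admissible_norm_family_def by blast
    then show ?thesis by (intro exI[of _ \<nu>]) (auto elim: eventually_mono)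
  qed
  then have "\<forall>x\<in>K. \<exists>\<nu>. \<nu> > 0 \<and> (AE y in lebesgue_on (ball x (r x)). \<forall>\<xi>. H y \<xi> \<le> \<nu> * norm \<xi>)"
    by (intro ballI)
  from bchoice[OF this] obtain \<nu> where \<nu>': "\<forall>x\<in>K. \<nu> x > 0 \<and>
      (AE y in lebesgue_on (ball x (r x)). \<forall>\<xi>. H y \<xi> \<le> \<nu> x * norm \<xi>)" ..
  have \<nu>: "\<nu> x > 0" "AE y in lebesgue_on (ball x (r x)). \<forall>\<xi>. H y \<xi> \<le> \<nu> x * norm \<xi>" if "x \<in> K" for x
    using bspec[OF \<nu>' that] by (rule conjunct1, rule conjunct2)
  obtain F where F: "finite F" "F \<subseteq> K" "K \<subseteq> (\<Union>x\<in>F. ball x (r x))"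
    using compact_ball_subcover[OF K(1), of r] r(1) by auto
  \<comment> \<open>The sum dominates each of its nonnegative terms, and the 1 keeps it positive
    even for an empty cover.\<close>
  define C where "C = (\<Sum>x\<in>F. \<nu> x) + 1"
  have C: "\<nu> x \<le> C" if "x \<in> F" for x
  proof -
    have "\<nu> x \<le> (\<Sum>x\<in>F. \<nu> x)"
    proof (rule member_le_sum[OF that _ F(1)])
      show "0 \<le> \<nu> y" if "y \<in> F - {x}" for y using \<nu>(1)[of y] F(2) that by auto
    qed
    then show ?thesis by (simp add: C_def)
  qed
  have "AE y in lebesgue. \<forall>x\<in>F. y \<in> ball x (r x) \<longrightarrow> (\<forall>\<xi>. H y \<xi> \<le> \<nu> x * norm \<xi>)"
  proof (rule AE_finite_allI[OF F(1)])
    fix x assume "x \<in> F"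
    then have "x \<in> K" using F(2) by blast
    then have "AE y in lebesgue_on (ball x (r x)). \<forall>\<xi>. H y \<xi> \<le> \<nu> x * norm \<xi>" by (rule \<nu>(2))
    then show "AE y in lebesgue. y \<in> ball x (r x) \<longrightarrow> (\<forall>\<xi>. H y \<xi> \<le> \<nu> x * norm \<xi>)"
      by (subst (asm) AE_restrict_space_iff) auto
  qed
  then have "AE y in lebesgue. y \<in> K \<longrightarrow> (\<forall>\<xi>. H y \<xi> \<le> C * norm \<xi>)"
  proof eventually_elim
    case (elim y)
    show ?case
    proof (intro impI allI)
      fix \<xi> assume "y \<in> K"
      then obtain x where x: "x \<in> F" "y \<in> ball x (r x)" using F(3) by blast
      then have "H y \<xi> \<le> \<nu> x * norm \<xi>" using elim by blast
      also have "\<dots> \<le> C * norm \<xi>" by (intro mult_right_mono C x) simp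
      finally show "H y \<xi> \<le> C * norm \<xi>" .
    qed
  qed
  then have "AE x in lebesgue_on \<Omega>. x \<in> K \<longrightarrow> (\<forall>\<xi>. H x \<xi> \<le> C * norm \<xi>)"
    using \<Omega> by (subst AE_restrict_space_iff) (simp, erule eventually_mono, simp)
  moreover have "(\<Sum>x\<in>F. \<nu> x) \<ge> 0"
  proof (rule sum_nonneg)
    show "0 \<le> \<nu> y" if "y \<in> F" for y using \<nu>(1)[of y] F(2) that by auto
  qed
  then have "C > 0" by (simp add: C_def)
  ultimately show ?thesis by (intro exI[of _ C] conjI)
qed

definition weighted_integral :: "(real^'n) set \<Rightarrow> real \<Rightarrow> (real^'n \<Rightarrow> real) \<Rightarrow> (real^'n \<Rightarrow> real) \<Rightarrow> real" where
  "weighted_integral \<Omega> p g u = (LINT x|lebesgue_on \<Omega>. \<bar>g x\<bar> * \<bar>u x\<bar> powr p)"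

section \<open>The weighted integral and the variational problem\<close>

lemma weighted_integral_nonneg: "0 \<le> weighted_integral \<Omega> p g u"
  by (simp add: weighted_integral_def)

lemma weighted_integral_scale: "weighted_integral \<Omega> p g (\<lambda>x. c * u x) = \<bar>c\<bar> powr p * weighted_integral \<Omega> p g u"
proof -
  have "(\<lambda>x. \<bar>g x\<bar> * \<bar>c * u x\<bar> powr p) = (\<lambda>x. \<bar>c\<bar> powr p * (\<bar>g x\<bar> * \<bar>u x\<bar> powr p))"
    by (simp add: abs_mult powr_mult fun_eq_iff)
  then show ?thesis by (simp add: weighted_integral_def)
qed

text \<open>Ensures that the set of Hardy quotients is nonempty, so that its infimum is a genuine
  one. If all these integrals vanished, bumps positive on a ball would force \<open>g\<close> to
  vanish almost everywhere on it, and hence on \<open>\<Omega>\<close>.\<close>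

lemma exists_weighted_integral_pos:
  fixes g :: "real^'n \<Rightarrow> real"
  assumes \<Omega>: "open \<Omega>" and p: "0 < p" and g: "g \<in> L1_loc \<Omega>" and ne: "\<not> (AE x in lebesgue_on \<Omega>. g x = 0)"
  obtains \<phi> where "\<phi> \<in> Cc_infty \<Omega>" "weighted_integral \<Omega> p g \<phi> > 0"
proof -
  have "\<exists>\<phi>\<in>Cc_infty \<Omega>. weighted_integral \<Omega> p g \<phi> \<noteq> 0"
  proof (rule ccontr)
    assume "\<not> ?thesis"
    then have zero: "weighted_integral \<Omega> p g \<phi> = 0" if "\<phi> \<in> Cc_infty \<Omega>" for \<phi> using that by blast
    have "AE x in lebesgue_on \<Omega>. g x = 0"
    proof (rule AE_lebesgue_on_local[OF open_lebesgue[OF \<Omega>]])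
      fix x assume "x \<in> \<Omega>"
      then obtain r where r: "r > 0" "cball x r \<subseteq> \<Omega>" using \<Omega> open_contains_cball by blast
      obtain \<rho> :: "real^'n \<Rightarrow> real" where \<rho>: "mollifier r \<rho>" using exists_mollifier[OF r(1)] .
      define \<phi> where "\<phi> = (\<lambda>y. \<rho> (x - y))"
      have \<phi>: "\<phi> \<in> Cc_infty \<Omega>" unfolding \<phi>_def by (rule Cc_infty_reflected_mollifier[OF \<rho> r(2)])
      note D = Cc_inftyD[OF \<phi>]
      have gabs: "(\<lambda>x. \<bar>g x\<bar>) \<in> L1_loc \<Omega>" using g by (simp add: L1_loc_def)
      have \<phi>0: "\<bar>\<phi> x\<bar> powr p = 0" if "x \<notin> closure {x. \<phi> x \<noteq> 0}" for x using D(4)[OF that] by simp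
      have int: "integrable (lebesgue_on \<Omega>) (\<lambda>x. \<bar>g x\<bar> * \<bar>\<phi> x\<bar> powr p)"
        by (rule L1_loc_mult_integrable(2)[OF gabs \<Omega> continuous_on_abs_powr[OF D(6) p] D(2,3) \<phi>0])
      have "AE y in lebesgue_on \<Omega>. \<bar>g y\<bar> * \<bar>\<phi> y\<bar> powr p = 0"
        using zero[OF \<phi>] integral_nonneg_eq_0_iff_AE[OF int] by (simp add: weighted_integral_def)
      then have "AE y in lebesgue. y \<in> \<Omega> \<longrightarrow> \<bar>g y\<bar> * \<bar>\<phi> y\<bar> powr p = 0"
        using \<Omega> by (subst (asm) AE_restrict_space_iff) auto
      then have "AE y in lebesgue. y \<in> ball x r \<longrightarrow> g y = 0"
      proof eventually_elim
        case (elim y)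
        show ?case
        proof
          assume y: "y \<in> ball x r"
          then have "\<phi> y > 0" unfolding \<phi>_def by (intro mollifierD(5)[OF \<rho>]) (simp add: dist_norm)
          moreover have "y \<in> \<Omega>" using y r(2) by auto
          ultimately show "g y = 0" using elim by simp
        qed
      qed
      then show "\<exists>r>0. AE y in lebesgue. y \<in> ball x r \<longrightarrow> g y = 0" using r(1) by blast
    qed
    with ne show False by blast
  qed
  then obtain \<phi> where "\<phi> \<in> Cc_infty \<Omega>" "weighted_integral \<Omega> p g \<phi> \<noteq> 0" by blast
  then show ?thesis using that[of \<phi>] weighted_integral_nonneg[of \<Omega> p g \<phi>] by linarith
qed

context locally_bounded_norm_energy
begin

text \<open>Trades quotients for energies under a normalization. The last conclusion keeps the
  quotient bound as a product, a form in which both sides pass to limits.\<close>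

lemma hardy_constant_minimizing_sequence:
  assumes V: "V \<in> L1_loc \<Omega>" "AE x in lebesgue_on \<Omega>. 0 \<le> V x"
    and g: "g \<in> L1_loc \<Omega>" "\<not> (AE x in lebesgue_on \<Omega>. g x = 0)"
  obtains u where "0 \<le> hardy_constant H p V \<Omega> g"
    "\<And>k :: nat. u k \<in> W1p p \<Omega> \<inter> Cc \<Omega>" "\<And>k. weighted_integral \<Omega> p g (u k) = 1"
    "(\<lambda>k. energy V (u k)) \<longlonglongrightarrow> hardy_constant H p V \<Omega> g"
    "\<And>\<phi>. \<phi> \<in> W1p p \<Omega> \<inter> Cc \<Omega> \<Longrightarrow> weighted_integral \<Omega> p g \<phi> > 0 \<Longrightarrow>
      hardy_constant H p V \<Omega> g * weighted_integral \<Omega> p g \<phi> \<le> energy V \<phi>"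
proof -
  let ?I = "weighted_integral \<Omega> p g" and ?D = "W1p p \<Omega> \<inter> Cc \<Omega>"
  have Vm: "V \<in> borel_measurable (lebesgue_on \<Omega>)" using V(1) open_\<Omega> by (rule L1_loc_borel_measurable)
  define A where "A = {energy V \<phi> / ?I \<phi> | \<phi>. \<phi> \<in> ?D \<and> ?I \<phi> > 0}"
  define S where "S = hardy_constant H p V \<Omega> g"
  have S: "S = Inf A" by (simp add: S_def A_def hardy_constant_def energy_eq_Q_functional weighted_integral_def)
  obtain \<phi>0 where "\<phi>0 \<in> Cc_infty \<Omega>" "?I \<phi>0 > 0"
    using exists_weighted_integral_pos[OF open_\<Omega> p_pos g] .
  then have Ane: "A \<noteq> {}" using Cc_infty_subset_W1p_Cc[OF open_\<Omega> _ p_pos] unfolding A_def by blast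
  have A0: "0 \<le> a" if "a \<in> A" for a
    using that energy_nonneg[OF Vm V(2)] weighted_integral_nonneg by (auto simp: A_def)
  have bdd: "bdd_below A" using A0 by (rule bdd_belowI)
  have S0: "0 \<le> S" unfolding S using Ane A0 by (rule cInf_greatest)
  have S_le: "S \<le> energy V \<phi> / ?I \<phi>" if "\<phi> \<in> ?D" "?I \<phi> > 0" for \<phi>
    unfolding S using that by (intro cInf_lower[OF _ bdd]) (auto simp: A_def)
  have "\<exists>u. u \<in> ?D \<and> ?I u = 1 \<and> S \<le> energy V u \<and> energy V u < S + inverse (real (Suc k))" for k
  proof -
    have "Inf A < S + inverse (real (Suc k))" by (simp add: S)
    then obtain a where "a \<in> A" "a < S + inverse (real (Suc k))" using cInf_lessD[OF Ane] by blast
    then obtain \<phi> where \<phi>: "\<phi> \<in> ?D" "?I \<phi> > 0" "energy V \<phi> / ?I \<phi> < S + inverse (real (Suc k))"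
      by (auto simp: A_def)
    \<comment> \<open>Energy and weighted integral are both homogeneous of degree \<open>p\<close>,
      so this factor normalizes the integral and leaves the quotient unchanged.\<close>
    define c where "c = ?I \<phi> powr (- (1 / p))"
    have c: "\<bar>c\<bar> powr p = inverse (?I \<phi>)"
    proof -
      have "\<bar>c\<bar> powr p = ?I \<phi> powr (- 1)" using p by (simp add: c_def powr_powr)
      then show ?thesis using \<phi>(2) by (simp add: powr_minus)
    qed
    have "energy V (\<lambda>x. c * \<phi> x) = energy V \<phi> / ?I \<phi>"
      using finite_energy_scale(2)[OF Vm V(2) W1p_Cc_finite_energy[OF \<phi>(1) V(1)], of c]
      by (simp add: c divide_inverse mult.commute)
    moreover have "?I (\<lambda>x. c * \<phi> x) = 1" using \<phi>(2) by (simp add: weighted_integral_scale c)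
    moreover have "(\<lambda>x. c * \<phi> x) \<in> ?D"
      using W1p_Cc_lincomb[OF open_\<Omega> p_pos \<phi>(1) \<phi>(1), of c 0] by simp
    ultimately show ?thesis using \<phi>(3) S_le[OF \<phi>(1,2)]
      by (intro exI[of _ "\<lambda>x. c * \<phi> x"]) simp
  qed
  then obtain u where u: "\<And>k. u k \<in> ?D" "\<And>k. ?I (u k) = 1" "\<And>k. S \<le> energy V (u k)"
    "\<And>k. energy V (u k) < S + inverse (real (Suc k))" by metis
  have "(\<lambda>k. S + inverse (real (Suc k))) \<longlonglongrightarrow> S + 0"
    by (intro tendsto_intros LIMSEQ_inverse_real_of_nat)
  then have "(\<lambda>k. S + inverse (real (Suc k))) \<longlonglongrightarrow> S" by simp
  then have "(\<lambda>k. energy V (u k)) \<longlonglongrightarrow> S"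
    by (rule tendsto_sandwich[OF _ _ tendsto_const, rotated -1]) (intro always_eventually allI u(3) less_imp_le[OF u(4)])+
  moreover have "S * ?I \<phi> \<le> energy V \<phi>" if "\<phi> \<in> ?D" "?I \<phi> > 0" for \<phi>
    using S_le[OF that] that(2) by (simp add: pos_le_divide_eq)
  ultimately show ?thesis using u(1,2) S0 unfolding S_def by (intro that)
qed

text \<open>\<open>W\<close> stands for \<open>\<V>\<close>. The minimizer is produced in normalized
  form, so that its energy is the Hardy constant itself.\<close>

theorem hardy_constant_attained:
  assumes V: "V \<in> L1_loc \<Omega>" "AE x in lebesgue_on \<Omega>. 0 \<le> V x"
    and W: "continuous_on \<Omega> W" "\<And>x. x \<in> \<Omega> \<Longrightarrow> W x > 0" "W \<in> hardy_weights H p V \<Omega>"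
    and g: "g \<in> L1_loc \<Omega>" "\<not> (AE x in lebesgue_on \<Omega>. g x = 0)"
    and compactness: "\<And>\<phi> :: nat \<Rightarrow> real^'n \<Rightarrow> real. (\<And>k. \<phi> k \<in> Wt0 H p V W \<Omega>) \<Longrightarrow>
      (\<exists>B. \<forall>k. Wt_norm H p V W \<Omega> (\<phi> k) \<le> B) \<Longrightarrow>
      \<exists>\<psi>\<in>Wt0 H p V W \<Omega>. \<exists>s. strict_mono s \<and>
        weakly_converges (Wt0 H p V W \<Omega>) (Wt_norm H p V W \<Omega>) (\<lambda>k. \<phi> (s k)) \<psi> \<and>
        (\<lambda>k. weighted_integral \<Omega> p g (\<phi> (s k))) \<longlonglongrightarrow> weighted_integral \<Omega> p g \<psi>"
  shows "\<exists>\<psi>\<in>Wt0 H p V W \<Omega>. weighted_integral \<Omega> p g \<psi> = 1 \<and> energy V \<psi> = hardy_constant H p V \<Omega> g"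
proof -
  let ?I = "weighted_integral \<Omega> p g" and ?D = "W1p p \<Omega> \<inter> Cc \<Omega>" and ?M = "lebesgue_on \<Omega>"
  define U where "U = (\<lambda>x. \<bar>V x\<bar> + W x)"
  define X where "X = finite_energy U"
  define Y where "Y = Wt0 H p V W \<Omega>"
  define N where "N = Wt_norm H p V W \<Omega>"
  define P where "P = (\<lambda>u. energy V u powr (1 / p))"
  define S where "S = hardy_constant H p V \<Omega> g"
  have WL: "W \<in> L1_loc \<Omega>" by (rule L1_loc_continuous[OF W(1)])
  have VabsL: "(\<lambda>x. \<bar>V x\<bar>) \<in> L1_loc \<Omega>" using V(1) by (simp add: L1_loc_def)
  have UL: "U \<in> L1_loc \<Omega>" unfolding U_def by (rule L1_loc_add[OF VabsL WL])
  have in_\<Omega>: "AE x in ?M. x \<in> \<Omega>" by (rule AE_I2) (simp add: space_restrict_space)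
  note [measurable] = L1_loc_borel_measurable[OF V(1) open_\<Omega>] L1_loc_borel_measurable[OF WL open_\<Omega>]
    L1_loc_borel_measurable[OF UL open_\<Omega>] L1_loc_borel_measurable[OF g(1) open_\<Omega>]
  have U0: "AE x in ?M. 0 \<le> U x"
    using in_\<Omega> by eventually_elim (use W(2) in \<open>force simp: U_def less_imp_le\<close>)
  have N: "N = (\<lambda>u. energy U u powr (1 / p))"
    by (simp add: N_def Wt_norm_def energy_def grad_energy_def U_def fun_eq_iff)
  have NX: "seminorm_on X N" unfolding X_def N by (rule seminorm_on_energy[OF _ U0]) measurable
  have DX: "?D \<subseteq> X" unfolding X_def using W1p_Cc_finite_energy[OF _ UL] by blast
  have Dne: "?D \<noteq> {}" using Cc_infty_subset_W1p_Cc[OF open_\<Omega> _ p_pos]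
      exists_weighted_integral_pos[OF open_\<Omega> p_pos g] by blast
  have WtX: "Wt H p V W \<Omega> = X"
    by (auto simp: Wt_def X_def finite_energy_def grad_energy_def[abs_def] U_def)
  have Y: "Y = {u \<in> X. \<forall>\<epsilon>>0. \<exists>\<phi>\<in>?D. N (\<lambda>x. u x - \<phi> x) < \<epsilon>}"
    by (simp add: Y_def Wt0_def WtX N_def)
  have DD: "(\<lambda>x. a * u x + b * v x) \<in> ?D" if "u \<in> ?D" "v \<in> ?D" for a b u v
    by (rule W1p_Cc_lincomb[OF open_\<Omega> p_pos that])
  have NY: "seminorm_on Y N" unfolding Y by (rule seminorm_on_closure(1)[OF NX DX _ Dne]) (rule DD)
  have DY: "?D \<subseteq> Y" unfolding Y by (rule seminorm_on_closure(2)[OF NX DX _ Dne]) (rule DD)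
  have YX: "Y \<subseteq> X" by (auto simp: Y)
  \<comment> \<open>Nonnegativity of \<open>V\<close> enters here: \<open>\<bar>V\<bar> = V\<close>
    almost everywhere, so the energy behind the norm is the energy of \<open>V\<close> plus a
    nonnegative remainder. This gives both \<open>P \<le> N\<close> and, through the Hardy
    inequality, the boundedness of the minimizing sequence.\<close>
  have split: "integrable ?M (\<lambda>x. V x * \<bar>u x\<bar> powr p) \<and> integrable ?M (\<lambda>x. W x * \<bar>u x\<bar> powr p) \<and>
      energy U u = energy V u + (LINT x|?M. W x * \<bar>u x\<bar> powr p)" if u: "u \<in> X" for u
  proof -
    have um[measurable]: "u \<in> borel_measurable ?M" and ui: "integrable ?M (\<lambda>x. U x * \<bar>u x\<bar> powr p)"
      "integrable ?M (grad_energy u)"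
      using u by (auto simp: X_def finite_energy_def)
    have le: "AE x in ?M. \<bar>V x * \<bar>u x\<bar> powr p\<bar> \<le> U x * \<bar>u x\<bar> powr p \<and> \<bar>W x * \<bar>u x\<bar> powr p\<bar> \<le> U x * \<bar>u x\<bar> powr p"
      using in_\<Omega>
    proof eventually_elim
      case (elim x)
      then have "\<bar>V x\<bar> \<le> U x" "\<bar>W x\<bar> \<le> U x" using W(2)[OF elim] by (auto simp: U_def)
      then show ?case by (auto simp: abs_mult intro!: mult_right_mono)
    qed
    have i: "integrable ?M (\<lambda>x. V x * \<bar>u x\<bar> powr p)"
    proof (rule Bochner_Integration.integrable_bound[OF ui(1)])
      show "(\<lambda>x. V x * \<bar>u x\<bar> powr p) \<in> borel_measurable ?M" by measurable
      show "AE x in ?M. norm (V x * \<bar>u x\<bar> powr p) \<le> norm (U x * \<bar>u x\<bar> powr p)"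
        using le by eventually_elim (unfold real_norm_def, linarith)
    qed
    have i': "integrable ?M (\<lambda>x. W x * \<bar>u x\<bar> powr p)"
    proof (rule Bochner_Integration.integrable_bound[OF ui(1)])
      show "(\<lambda>x. W x * \<bar>u x\<bar> powr p) \<in> borel_measurable ?M" by measurable
      show "AE x in ?M. norm (W x * \<bar>u x\<bar> powr p) \<le> norm (U x * \<bar>u x\<bar> powr p)"
        using le by eventually_elim (unfold real_norm_def, linarith)
    qed
    have gm[measurable]: "grad_energy u \<in> borel_measurable ?M" using ui(2) by auto
    have "energy U u = (LINT x|?M. (grad_energy u x + V x * \<bar>u x\<bar> powr p) + W x * \<bar>u x\<bar> powr p)"
      unfolding energy_def
    proof (rule integral_cong_AE)
      show "AE x in ?M. grad_energy u x + U x * \<bar>u x\<bar> powr p = (grad_energy u x + V x * \<bar>u x\<bar> powr p) + W x * \<bar>u x\<bar> powr p"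
        using V(2) by eventually_elim (simp add: U_def algebra_simps)
    qed measurable
    also have "\<dots> = energy V u + (LINT x|?M. W x * \<bar>u x\<bar> powr p)"
      unfolding energy_def by (intro Bochner_Integration.integral_add Bochner_Integration.integrable_add ui i i')
    finally show ?thesis using i i' by simp
  qed
  have XV: "X \<subseteq> finite_energy V"
    using split by (auto simp: X_def finite_energy_def)
  have PY: "seminorm_on Y P"
  proof (rule seminorm_on_closed_subset[OF _ NY])
    show "seminorm_on (finite_energy V) P" unfolding P_def by (rule seminorm_on_energy[OF _ V(2)]) measurable
  qed (rule subset_trans[OF YX XV])
  have V_nonneg: "0 \<le> energy V u" for u by (rule energy_nonneg[OF _ V(2)]) measurable
  have W_int: "0 \<le> (LINT x|?M. W x * \<bar>u x\<bar> powr p)" for u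
    by (rule integral_nonneg_AE) (use in_\<Omega> in \<open>eventually_elim, use W(2) in \<open>simp add: less_imp_le\<close>\<close>)
  have PN: "P u \<le> N u" if "u \<in> Y" for u
    unfolding P_def N using split[of u] that YX W_int[of u] V_nonneg[of u] p by (intro powr_mono2) auto
  have P_powr: "P u powr p = energy V u" for u
    using V_nonneg[of u] p by (simp add: P_def powr_powr)
  obtain u where S0: "0 \<le> S" and u: "\<And>k :: nat. u k \<in> ?D" "\<And>k. ?I (u k) = 1"
    "(\<lambda>k. energy V (u k)) \<longlonglongrightarrow> S"
    and S_le: "\<And>\<phi>. \<phi> \<in> ?D \<Longrightarrow> ?I \<phi> > 0 \<Longrightarrow> S * ?I \<phi> \<le> energy V \<phi>"
    using hardy_constant_minimizing_sequence[OF V g] unfolding S_def by metis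
  have uY: "u k \<in> Y" for k using u(1) DY by blast
  obtain C where C: "C > 0" "\<And>u. u \<in> ?D \<Longrightarrow> C * (LINT x|?M. \<bar>W x\<bar> * \<bar>u x\<bar> powr p) \<le> energy V u"
    using hardy_inequality_W1p_Cc[OF V(1) W(3)] by blast
  have "\<exists>B. \<forall>k. N (u k) \<le> B"
  proof -
    obtain b where b: "\<And>k. energy V (u k) \<le> b"
      using convergent_imp_Bseq[OF convergentI[OF u(3)]] by (metis BseqE abs_le_D1 real_norm_def)
    \<comment> \<open>The Hardy inequality for \<open>W\<close> bounds the remainder by the energy
      of \<open>V\<close> divided by \<open>C\<close>, hence by \<open>b / C\<close>.\<close>
    have "N (u k) \<le> (b + b / C) powr (1 / p)" for k
    proof -
      have "(LINT x|?M. W x * \<bar>u k x\<bar> powr p) = (LINT x|?M. \<bar>W x\<bar> * \<bar>u k x\<bar> powr p)"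
      proof (rule Bochner_Integration.integral_cong)
        fix x assume "x \<in> space ?M"
        then have "W x > 0" by (intro W(2)) (simp add: space_restrict_space)
        then show "W x * \<bar>u k x\<bar> powr p = \<bar>W x\<bar> * \<bar>u k x\<bar> powr p" by simp
      qed simp
      also have "\<dots> \<le> energy V (u k) / C" using C(2)[OF u(1)] C(1) by (simp add: field_simps)
      also have "\<dots> \<le> b / C" using b C(1) by (simp add: divide_right_mono)
      finally have "energy U (u k) \<le> b + b / C" using split[of "u k"] uY[of k] YX b[of k] by auto
      moreover have "0 \<le> energy U (u k)" using split[of "u k"] uY[of k] YX V_nonneg[of "u k"] W_int[of "u k"] by auto
      ultimately show ?thesis unfolding N using p by (intro powr_mono2) auto
    qed
    then show ?thesis by blast
  qed
  from compactness[folded Y_def N_def, OF uY this] obtain \<psi> s where \<psi>: "\<psi> \<in> Y" and s: "strict_mono s"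
    and weak: "weakly_converges Y N (\<lambda>k. u (s k)) \<psi>" and lim: "(\<lambda>k. ?I (u (s k))) \<longlonglongrightarrow> ?I \<psi>" by blast
  have I\<psi>: "?I \<psi> = 1" using lim by (simp add: u(2) LIMSEQ_const_iff)
  have "(\<lambda>k. energy V (u (s k))) \<longlonglongrightarrow> S"
    using LIMSEQ_subseq_LIMSEQ[OF u(3) s] by (simp add: o_def)
  then have "(\<lambda>k. P (u (s k))) \<longlonglongrightarrow> S powr (1 / p)"
    unfolding P_def by (intro tendsto_powr' tendsto_const) (use V_nonneg p in auto)
  then have "P \<psi> \<le> S powr (1 / p)"
    by (intro weak_lower_semicontinuous[OF PY PN \<psi> uY weak])
  then have "P \<psi> powr p \<le> (S powr (1 / p)) powr p"
    using p by (intro powr_mono2) (auto simp: P_def)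
  then have upper: "energy V \<psi> \<le> S" using S0 p by (simp add: P_powr powr_powr)
  have "\<exists>v\<in>?D. N (\<lambda>x. \<psi> x - v x) < inverse (real (Suc k))" for k
    using \<psi> unfolding Y by (auto simp del: of_nat_Suc)
  then obtain v where v: "\<And>k. v k \<in> ?D" "\<And>k. N (\<lambda>x. \<psi> x - v k x) < inverse (real (Suc k))" by metis
  have vY: "v k \<in> Y" for k using v(1) DY by blast
  have N0: "0 \<le> N w" for w by (simp add: N)
  have N_lim: "(\<lambda>k. N (\<lambda>x. \<psi> x - v k x)) \<longlonglongrightarrow> 0"
    by (rule tendsto_sandwich[OF _ _ tendsto_const LIMSEQ_inverse_real_of_nat])
       (intro always_eventually allI N0 less_imp_le[OF v(2)])+
  have "N (v k) \<le> N \<psi> + 1" for k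
  proof -
    have "N (v k) \<le> N \<psi> + N (\<lambda>x. \<psi> x - v k x)"
      using seminorm_on_triangle_diff[OF NY \<psi> vY[of k]] by linarith
    also have "N (\<lambda>x. \<psi> x - v k x) \<le> 1"
      using v(2)[of k] by (rule order_trans[OF less_imp_le]) (simp add: field_simps)
    finally show ?thesis by simp
  qed
  then have "\<exists>B. \<forall>k. N (v k) \<le> B" by blast
  from compactness[folded Y_def N_def, OF vY this] obtain \<psi>' t where \<psi>': "\<psi>' \<in> Y" and t: "strict_mono t"
    and weak': "weakly_converges Y N (\<lambda>k. v (t k)) \<psi>'" and lim': "(\<lambda>k. ?I (v (t k))) \<longlonglongrightarrow> ?I \<psi>'" by blast
  \<comment> \<open>Seminorm convergence of the whole sequence passes to the subsequence chosen by
    the compactness hypothesis, so that \<open>weak_limit_unique\<close> can compare the two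
    limits.\<close>
  have strong: "(\<lambda>k. N (\<lambda>x. \<psi> x - v (t k) x)) \<longlonglongrightarrow> 0"
    using LIMSEQ_subseq_LIMSEQ[OF N_lim t] by (simp add: o_def)
  have "N (\<lambda>x. \<psi> x - \<psi>' x) = 0"
    by (rule weak_limit_unique[OF NY \<psi> \<psi>' vY weak' strong])
  then have "energy U (\<lambda>x. \<psi> x - \<psi>' x) = 0" by (simp add: N)
  moreover have dX: "(\<lambda>x. \<psi> x - \<psi>' x) \<in> X" using seminorm_on_lincomb(3)[OF NY \<psi> \<psi>'] YX by blast
  \<comment> \<open>Both summands of the split energy are nonnegative and their sum is zero. The
    term with \<open>W\<close> then determines the function almost everywhere, because
    \<open>W\<close> is positive.\<close>
  ultimately have "(LINT x|?M. W x * \<bar>\<psi> x - \<psi>' x\<bar> powr p) = 0"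
    using split[OF dX] V_nonneg[of "\<lambda>x. \<psi> x - \<psi>' x"] W_int[of "\<lambda>x. \<psi> x - \<psi>' x"] by linarith
  moreover have "AE x in ?M. 0 \<le> W x * \<bar>\<psi> x - \<psi>' x\<bar> powr p"
    using in_\<Omega> by eventually_elim (use W(2) in \<open>simp add: less_imp_le\<close>)
  ultimately have "AE x in ?M. W x * \<bar>\<psi> x - \<psi>' x\<bar> powr p = 0"
    using integral_nonneg_eq_0_iff_AE[of ?M "\<lambda>x. W x * \<bar>\<psi> x - \<psi>' x\<bar> powr p"] split[OF dX] by blast
  then have eq: "AE x in ?M. \<psi> x = \<psi>' x"
    using in_\<Omega> by eventually_elim (use W(2) in force)
  have [measurable]: "\<psi> \<in> borel_measurable ?M" "\<psi>' \<in> borel_measurable ?M"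
    using \<psi> \<psi>' YX by (auto simp: X_def finite_energy_def)
  have "?I \<psi> = ?I \<psi>'" unfolding weighted_integral_def
  proof (rule integral_cong_AE)
    show "AE x in ?M. \<bar>g x\<bar> * \<bar>\<psi> x\<bar> powr p = \<bar>g x\<bar> * \<bar>\<psi>' x\<bar> powr p"
      using eq by eventually_elim simp
  qed measurable
  then have lim1: "(\<lambda>k. ?I (v (t k))) \<longlonglongrightarrow> 1" using lim' I\<psi> by simp
  \<comment> \<open>\<open>P\<close> is continuous for \<open>N\<close>: values of \<open>P\<close>
    differ by at most \<open>P\<close> of the difference, which \<open>N\<close> dominates.\<close>
  have "(\<lambda>k. P (v (t k)) - P \<psi>) \<longlonglongrightarrow> 0"
  proof (rule Lim_null_comparison[OF always_eventually strong], rule allI)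
    fix k
    have "\<bar>P (v (t k)) - P \<psi>\<bar> \<le> P (\<lambda>x. \<psi> x - v (t k) x)"
      using seminorm_on_triangle_diff[OF PY \<psi> vY[of "t k"]] by linarith
    also have "\<dots> \<le> N (\<lambda>x. \<psi> x - v (t k) x)"
      by (rule PN[OF seminorm_on_lincomb(3)[OF NY \<psi> vY]])
    finally show "norm (P (v (t k)) - P \<psi>) \<le> N (\<lambda>x. \<psi> x - v (t k) x)" by simp
  qed
  then have "(\<lambda>k. P (v (t k))) \<longlonglongrightarrow> P \<psi>" by (simp add: LIM_zero_iff)
  then have "(\<lambda>k. P (v (t k)) powr p) \<longlonglongrightarrow> P \<psi> powr p"
    by (intro tendsto_powr' tendsto_const) (use p_pos in \<open>auto simp: P_def\<close>)
  then have "(\<lambda>k. energy V (v (t k))) \<longlonglongrightarrow> energy V \<psi>" by (simp add: P_powr)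
  moreover have "(\<lambda>k. S * ?I (v (t k))) \<longlonglongrightarrow> S * 1" by (intro tendsto_intros lim1)
  \<comment> \<open>\<open>S_le\<close> asks for a positive weighted integral, which is guaranteed
    from some index on because the limit is 1.\<close>
  moreover have "eventually (\<lambda>k. ?I (v (t k)) > 0) sequentially" using order_tendstoD(1)[OF lim1, of 0] by simp
  then have "eventually (\<lambda>k. S * ?I (v (t k)) \<le> energy V (v (t k))) sequentially"
    by eventually_elim (rule S_le[OF v(1)])
  ultimately have "S * 1 \<le> energy V \<psi>" by (rule tendsto_le[OF sequentially_bot, rotated 0])
  then show ?thesis using upper \<psi> I\<psi> by (auto simp: Y_def S_def)
qed

end

theorem theorem4p21:
  fixes \<Omega> :: "(real^'n) set"
    and H :: "real^'n \<Rightarrow> real^'n \<Rightarrow> real"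
    and V \<V> \<delta> g :: "real^'n \<Rightarrow> real"
    and p q :: real
  assumes "1 < p"
    and "CARD('n) \<ge> 2"
    and "is_domain \<Omega>"
    and "admissible_norm_family \<Omega> H"
    and "commonly_uniformly_convex \<Omega> H"
    and "bregman_lower_bound \<Omega> H p \<delta>"
    and "morrey_exponent TYPE('n) p q"
    and "V \<in> morrey_loc p q \<Omega>"
    and "gradient_regularity \<Omega> H p \<delta> V"
    and "subcritical H p V \<Omega>"
    and "continuous_on \<Omega> \<V>" "\<forall>x\<in>\<Omega>. \<V> x > 0" "\<V> \<in> hardy_weights H p V \<Omega>"
    and "AE x in lebesgue_on \<Omega>. V x \<ge> 0"
    and "g \<in> hardy_weights H p V \<Omega>" "\<not> (AE x in lebesgue_on \<Omega>. g x = 0)"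
    and "\<forall>\<phi> :: nat \<Rightarrow> real^'n \<Rightarrow> real.
           (\<forall>k. \<phi> k \<in> Wt0 H p V \<V> \<Omega>) \<and> (\<exists>B. \<forall>k. Wt_norm H p V \<V> \<Omega> (\<phi> k) \<le> B) \<longrightarrow>
           (\<exists>\<psi>\<in>Wt0 H p V \<V> \<Omega>. \<exists>s. strict_mono s \<and>
              weakly_converges (Wt0 H p V \<V> \<Omega>) (Wt_norm H p V \<V> \<Omega>) (\<lambda>k. \<phi> (s k)) \<psi> \<and>
              (\<lambda>k. LINT x|lebesgue_on \<Omega>. \<bar>g x\<bar> * \<bar>\<phi> (s k) x\<bar> powr p)
                \<longlonglongrightarrow> (LINT x|lebesgue_on \<Omega>. \<bar>g x\<bar> * \<bar>\<psi> x\<bar> powr p))"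
  shows "\<exists>\<phi>\<in>Wt0 H p V \<V> \<Omega>. \<not> (AE x in lebesgue_on \<Omega>. \<phi> x = 0) \<and>
           (LINT x|lebesgue_on \<Omega>. \<bar>g x\<bar> * \<bar>\<phi> x\<bar> powr p) > 0 \<and>
           hardy_constant H p V \<Omega> g =
             Q_functional H p V \<Omega> \<phi> / (LINT x|lebesgue_on \<Omega>. \<bar>g x\<bar> * \<bar>\<phi> x\<bar> powr p)"
proof -
  have \<Omega>: "open \<Omega>" using assms(3) by (simp add: is_domain_def)
  interpret locally_bounded_norm_energy \<Omega> H p
  proof
    show "1 < p" "open \<Omega>" by (rule assms(1) \<Omega>)+
    show "AE x in lebesgue_on \<Omega>. is_norm (H x)" "(\<lambda>x. H x \<xi>) \<in> borel_measurable (lebesgue_on \<Omega>)" for \<xi>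
      using assms(4) unfolding admissible_norm_family_def by blast+
    show "\<exists>\<nu>>0. AE x in lebesgue_on \<Omega>. x \<in> K \<longrightarrow> (\<forall>\<xi>. H x \<xi> \<le> \<nu> * norm \<xi>)"
      if "compact K" "K \<subseteq> \<Omega>" for K
      by (rule admissible_norm_family_upper_bound[OF \<Omega> assms(4) that])
  qed
  have gL: "g \<in> L1_loc \<Omega>" using assms(15) by (simp add: hardy_weights_def)
  obtain \<psi> where \<psi>: "\<psi> \<in> Wt0 H p V \<V> \<Omega>" "weighted_integral \<Omega> p g \<psi> = 1"
    "energy V \<psi> = hardy_constant H p V \<Omega> g"
    using hardy_constant_attained[OF morrey_loc_subset_L1_loc[OF \<Omega> assms(8)] assms(14,11) _ assms(13) gL assms(16)]
      assms(12,17) unfolding weighted_integral_def by blast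
  have "\<not> (AE x in lebesgue_on \<Omega>. \<psi> x = 0)"
  proof
    assume zero: "AE x in lebesgue_on \<Omega>. \<psi> x = 0"
    have [measurable]: "\<psi> \<in> borel_measurable (lebesgue_on \<Omega>)" "g \<in> borel_measurable (lebesgue_on \<Omega>)"
      using \<psi>(1) L1_loc_borel_measurable[OF gL \<Omega>] by (auto simp: Wt0_def Wt_def)
    have "weighted_integral \<Omega> p g \<psi> = (LINT x|lebesgue_on \<Omega>. 0)" unfolding weighted_integral_def
    proof (rule integral_cong_AE)
      show "AE x in lebesgue_on \<Omega>. \<bar>g x\<bar> * \<bar>\<psi> x\<bar> powr p = 0" using zero by eventually_elim simp
    qed measurable
    then show False using \<psi>(2) by simp
  qed
  then show ?thesis
    using \<psi> by (intro bexI[of _ \<psi>]) (auto simp: weighted_integral_def energy_eq_Q_functional)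
qed

end
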